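(* Let $(W,P)$ be a Hermitian symmetric pair and fix a reduced word $\underline{\nu}$ for every $\nu\in{}^PW$. For all $\lambda,\nu\in{}^PW$ let $\mathrm{NPath}(\lambda,\underline\nu)\subseteq \mathrm{Path}(\lambda,\underline\nu)$ be the set of paths $\mathsf T$ whose associated basis element $E_{\mathsf T}$ of the anti-spherical module $\mathsf 1_\varnothing \mathrm{TL}_{(W,P)}(q)$ is standard. Then the graded free $\mathbb Z$-module $\mathbb N_{\lambda,\underline\nu}$ of graded rank $n_{\lambda,\nu}(q)$ has a homogeneous basis indexed by the standard basis elements $\{E_{\mathsf T}\mid \mathsf T\in\mathrm{NPath}(\lambda,\underline\nu)\}$; that is, $$n_{\lambda,\nu}(q)=\sum_{\mathsf T\in \mathrm{NPath}(\lambda,\underline\nu)}q^{\deg(\mathsf T)} .$$ Moreover, the set of standard basis elements $\{E_{\mathsf T}\mid \mathsf T\in\mathrm{NPath}(\lambda,\underline\nu)\}$ is independent of the choice of the reduced word $\underline\nu$ of $\nu$.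
   Context: **Pairs.** $(W,S_W)$ is a Coxeter system with length function $\ell$ and $(s_is_j)^{m_{i,j}}=1$; $P$ is a standard parabolic subgroup; ${}^PW$ is the set of minimal length representatives of the cosets $P\backslash W$, with the Bruhat order $\leq$; the identity element is denoted $\varnothing$. $(W,P)$ is a Hermitian symmetric pair: one of $(A_n,A_{k-1}\times A_{n-k})$ ($1\le k\le n$), $(D_n,A_{n-1})$, $(D_n,D_{n-1})$, $(B_n,B_{n-1})$, $(C_n,A_{n-1})$ ($n\ge 2$), $(E_6,D_5)$, $(E_7,E_6)$. In each case $P$ is generated by all simple reflections except one: node $k$ for $(A_n,A_{k-1}\times A_{n-k})$; the end node at the double bond for $(C_n,A_{n-1})$; the end node furthest from the double bond (resp. fork) for $(B_n,B_{n-1})$ (resp. $(D_n,D_{n-1})$); one of the two end nodes at the fork for $(D_n,A_{n-1})$; the end node of a longest arm in types $E$. In type $B_n$ the end node at the double bond is the short simple root and the others are long; in type $C_n$ it is long and the others are short. **Paths.** $\widehat{\mathcal G}_{(W,P)}$ is the directed graph with vertex set ${}^PW$ and, for each $\lambda\in{}^PW$ and $s_i\in S_W$ with $\lambda s_i\in{}^PW$, edges labelled $i$: $\lambda\to\lambda$ and $\lambda\to\lambda s_i$. Degrees: $\deg(\lambda\xrightarrow{i}\lambda s_i)=0$; $\deg(\lambda\xrightarrow{i}\lambda)=1$ if $\lambda s_i>\lambda$ and $-1$ if $\lambda s_i<\lambda$. The degree of a path is the sum of the degrees of its edges, and the weight $\omega(\mathsf T)$ of a path with successive edge labels $i_1,\dots,i_r$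 is the word $s_{i_1}\cdots s_{i_r}$. $\mathrm{Path}(\lambda,\underline w)$ is the set of paths from $\varnothing$ to $\lambda$ of weight $\underline w$. **Kazhdan–Lusztig polynomials.** Set $n_{\lambda,\lambda}(q)=1=b_{\lambda,\underline\lambda}(q)$; for $\lambda\ne\mu$ the polynomials $b_{\lambda,\underline\mu}(q)\in\mathbb Z[q+q^{-1}]$ and $n_{\lambda,\mu}(q)\in q\mathbb Z[q]$ are uniquely determined recursively (on the Bruhat order) by $$b_{\lambda,\underline\mu}(q)+n_{\lambda,\mu}(q)=\sum_{\mathsf S\in\mathrm{Path}(\lambda,\underline\mu)}q^{\deg(\mathsf S)}-\sum_{\lambda<\nu<\mu}n_{\lambda,\nu}(q)\,b_{\nu,\underline\mu}(q).$$ The $n_{\lambda,\mu}(q)$ are the anti-spherical Kazhdan–Lusztig polynomials of $(W,P)$. **Oriented Temperley–Lieb algebra.** $\mathrm{TL}_{(W,P)}(q)$ is the unital associative $\mathbb Z[q,q^{-1}]$-algebra generated by $\mathsf 1_\lambda$ ($\lambda\in{}^PW$) and $E_i$ ($s_i\in S_W$) with relations: (i) $\sum_\lambda\mathsf 1_\lambda=1$, $\mathsf 1_\lambda\mathsf 1_\mu=\delta_{\lambda,\mu}\mathsf 1_\lambda$, $\mathsf 1_\lambda E_i\mathsf 1_\lambda=0$ if $\lambda s_i\notin{}^PW$, $\mathsf 1_\lambda E_i\mathsf 1_\mu=0$ if $\mu\notin\{\lambda,\lambda s_i\}$; (ii) $\mathsf 1_\mu E_i\mathsf 1_\lambda E_i\mathsf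 1_\nu=q^{\ell(\lambda s_i)-\ell(\lambda)}\mathsf 1_\mu E_i\mathsf 1_\nu$ whenever $\lambda,\lambda s_i\in{}^PW$ and $\mu,\nu\in\{\lambda,\lambda s_i\}$; (iii) $E_iE_j=E_jE_i$ if $m_{i,j}=2$ and $E_iE_jE_i=E_i$ if $m_{i,j}=3$; (iv) if $m_{i,j}=4$ and $\alpha_i$ is short, $\mathsf 1_\mu E_i\mathsf 1_\lambda E_j\mathsf 1_\lambda E_i\mathsf 1_\nu=\mathsf 1_\mu E_i\mathsf 1_\nu$ whenever $\lambda,\lambda s_i,\lambda s_j\in{}^PW$ and $\mu,\nu\in\{\lambda,\lambda s_i\}$. For a path $\mathsf T:\lambda_1\xrightarrow{i_1}\lambda_2\xrightarrow{i_2}\cdots\xrightarrow{i_{r}}\lambda_{r+1}$ put $E_{\mathsf T}=\mathsf 1_{\lambda_1}E_{i_1}\mathsf 1_{\lambda_2}E_{i_2}\cdots E_{i_r}\mathsf 1_{\lambda_{r+1}}$. The anti-spherical module is the right module $\mathsf 1_\varnothing\mathrm{TL}_{(W,P)}(q)$; the $E_{\mathsf T}$ with $\mathsf T\in\mathrm{Path}(\lambda,\underline\mu)$, $\lambda,\mu\in{}^PW$, are its basis elements. **Standard elements.** Let $\mathsf T\in\mathrm{Path}(\lambda,\underline\mu)$. * If $(W,P)$ is $(A_n,A_{k-1}\times A_{n-k})$, $(D_n,A_{n-1})$, $(D_n,D_{n-1})$, $(E_6,D_5)$ or $(E_7,E_6)$, every $E_{\mathsf T}$ is standard. * If $(W,P)=(B_n,B_{n-1})$,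 $E_{\mathsf T}$ is standard iff $\ell(\mu)-\ell(\lambda)\in\{0,1\}$ (in this type there is exactly one element of ${}^PW$ of each length $0,1,\dots,2n-1$). * If $(W,P)=(C_n,A_{n-1})$, label $S_W$ as $s_{1'},s_2,\dots,s_n$ along the Dynkin diagram with $s_{1'}$ the node not in $P$. Identify elements of ${}^PW$ with sequences of $n+1$ symbols, the first being $\circ$ and the others in $\{\wedge,\vee\}$, where $\varnothing=\circ\vee\cdots\vee$, right multiplication by $s_i$ ($i\ge2$) swaps the symbols in positions $i,i+1$, and $s_{1'}$ interchanges $\wedge\leftrightarrow\vee$ in position $2$. An $(n+1)$-tangle is a rectangle with $n+1$ northern and $n+1$ southern vertices joined in pairs by non-crossing strands (up to isotopy); strands which can be deformed to touch the left edge may carry beads, two beads on a strand being equal to one bead. A strand is decorated if it carries a bead. Let $\mathsf e_i$ ($i\geq 2$) be the undecorated tangle with an arc joining northern vertices $i,i+1$, an arc joining southern vertices $i,i+1$ and all other strands vertical, and let $\mathsf e_{1'}$ be the analogous tangle with arcs joining vertices $1,2$, each carrying one bead. For a reduced word $\underline\mu=s_{i_1}\cdots s_{i_r}$ let $\mathsf e_\mu=\mathsf e_{i_1}\cdots\mathsf e_{i_r}$, where $dd'$ places $d'$ above $d$ (no closed loops occur; $\mathsf e_\mu$ does not depend on the reduced word). Place $\varnothing$ on the southern edge and $\lambda$ on the northern edge of $\mathsf e_\mu$. A strand joining two symbols of $\{\wedge,\vee\}$ is flip-oriented if both arrows point into the strand or both point out of it (so: equal symbols for an arc, different symbols for a strand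 from north to south); a strand with one end labelled $\circ$ and the other in $\{\wedge,\vee\}$ counts as flip-oriented. $E_{\mathsf T}$ is standard iff every decorated strand of this labelled diagram is flip-oriented. *)

theory Defs
  imports
    "HOL-Algebra.Coset"
    "HOL-Algebra.Generated_Groups"
    "HOL-Algebra.QuotRing"
    "HOL-Library.Poly_Mapping"
    "HOL-Computational_Algebra.Polynomial"
    "Graph_Theory.Arc_Walk"
begin

section \<open>Coxeter groups by generators and relations\<close>

text \<open>
  The Coxeter group with generators \<open>s\<^sub>i\<close> (\<open>i \<in> S\<close>) and Coxeter matrix \<open>m\<close> is the
  set of words over \<open>S\<close> modulo the congruence generated by \<open>(s\<^sub>i s\<^sub>j)^m\<^sub>i\<^sub>j = 1\<close>.  With
  \<open>m\<^sub>i\<^sub>i = 1\<close> this contains \<open>s\<^sub>i s\<^sub>i = 1\<close>.  A group element is a congruence class of words.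
\<close>

inductive_set cox_rel :: "nat set \<Rightarrow> (nat \<Rightarrow> nat \<Rightarrow> nat) \<Rightarrow> (nat list \<times> nat list) set"
  for S m where
    refl: "u \<in> lists S \<Longrightarrow> (u, u) \<in> cox_rel S m"
  | sym: "(u, v) \<in> cox_rel S m \<Longrightarrow> (v, u) \<in> cox_rel S m"
  | trans: "(u, v) \<in> cox_rel S m \<Longrightarrow> (v, w) \<in> cox_rel S m \<Longrightarrow> (u, w) \<in> cox_rel S m"
  | cong: "(u, v) \<in> cox_rel S m \<Longrightarrow> x \<in> lists S \<Longrightarrow> y \<in> lists S \<Longrightarrow>
      (x @ u @ y, x @ v @ y) \<in> cox_rel S m"
  | rel: "i \<in> S \<Longrightarrow> j \<in> S \<Longrightarrow> (concat (replicate (m i j) [i, j]), []) \<in> cox_rel S m"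

type_synonym elt = "nat list set"

definition cox_group :: "nat set \<Rightarrow> (nat \<Rightarrow> nat \<Rightarrow> nat) \<Rightarrow> elt monoid" where
  "cox_group S m =
    \<lparr>carrier = lists S // cox_rel S m,
     monoid.mult = (\<lambda>x y. \<Union>u\<in>x. \<Union>v\<in>y. cox_rel S m `` {u @ v}),
     one = cox_rel S m `` {[]}\<rparr>"


section \<open>Hermitian symmetric pairs\<close>

text \<open>
  The last argument of \<open>PairA\<close>, \<open>PairDA\<close> and \<open>PairE6\<close> is the node not in \<open>P\<close>.
\<close>

datatype hs_pair =
    PairA nat nat    \<comment> \<open>\<open>(A\<^sub>n, A\<^bsub>k-1\<^esub> \<times> A\<^bsub>n-k\<^esub>)\<close>\<close>
  | PairDA nat nat   \<comment> \<open>\<open>(D\<^sub>n, A\<^bsub>n-1\<^esub>)\<close>\<close>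
  | PairDD nat       \<comment> \<open>\<open>(D\<^sub>n, D\<^bsub>n-1\<^esub>)\<close>\<close>
  | PairB nat        \<comment> \<open>\<open>(B\<^sub>n, B\<^bsub>n-1\<^esub>)\<close>\<close>
  | PairC nat        \<comment> \<open>\<open>(C\<^sub>n, A\<^bsub>n-1\<^esub>)\<close>\<close>
  | PairE6 nat       \<comment> \<open>\<open>(E\<^sub>6, D\<^sub>5)\<close>\<close>
  | PairE7           \<comment> \<open>\<open>(E\<^sub>7, E\<^sub>6)\<close>\<close>

text \<open>
  Nodes are numbered from \<open>1\<close>.  In types \<open>B\<close> and \<open>C\<close> the double bond joins \<open>1\<close> and \<open>2\<close>; in
  type \<open>D\<close> the fork is at \<open>3\<close>, with end nodes \<open>1\<close> and \<open>2\<close>; types \<open>E\<close> are numbered as in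
  Bourbaki.
\<close>

fun hermitian :: "hs_pair \<Rightarrow> bool" where
  "hermitian (PairA n k) \<longleftrightarrow> 1 \<le> k \<and> k \<le> n"
| "hermitian (PairDA n k) \<longleftrightarrow> 4 \<le> n \<and> k \<in> {1, 2}"
| "hermitian (PairDD n) \<longleftrightarrow> 4 \<le> n"
| "hermitian (PairB n) \<longleftrightarrow> 2 \<le> n"
| "hermitian (PairC n) \<longleftrightarrow> 2 \<le> n"
| "hermitian (PairE6 k) \<longleftrightarrow> k \<in> {1, 6}"
| "hermitian PairE7 \<longleftrightarrow> True"

fun cox_rank :: "hs_pair \<Rightarrow> nat" where
  "cox_rank (PairA n k) = n"
| "cox_rank (PairDA n k) = n"
| "cox_rank (PairDD n) = n"
| "cox_rank (PairB n) = n"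
| "cox_rank (PairC n) = n"
| "cox_rank (PairE6 k) = 6"
| "cox_rank PairE7 = 7"

definition nodes :: "hs_pair \<Rightarrow> nat set" where
  "nodes X = {1..cox_rank X}"

fun omitted :: "hs_pair \<Rightarrow> nat" where
  "omitted (PairA n k) = k"
| "omitted (PairDA n k) = k"
| "omitted (PairDD n) = n"
| "omitted (PairB n) = n"
| "omitted (PairC n) = 1"
| "omitted (PairE6 k) = k"
| "omitted PairE7 = 7"

fun single_bonds :: "hs_pair \<Rightarrow> nat set set" where
  "single_bonds (PairA n k) = {{i, i + 1} |i. 1 \<le> i \<and> i < n}"
| "single_bonds (PairDA n k) = insert {1, 3} {{i, i + 1} |i. 2 \<le> i \<and> i < n}"
| "single_bonds (PairDD n) = insert {1, 3} {{i, i + 1} |i. 2 \<le> i \<and> i < n}"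
| "single_bonds (PairB n) = {{i, i + 1} |i. 2 \<le> i \<and> i < n}"
| "single_bonds (PairC n) = {{i, i + 1} |i. 2 \<le> i \<and> i < n}"
| "single_bonds (PairE6 k) = {{1, 3}, {3, 4}, {4, 5}, {5, 6}, {2, 4}}"
| "single_bonds PairE7 = {{1, 3}, {3, 4}, {4, 5}, {5, 6}, {6, 7}, {2, 4}}"

fun double_bonds :: "hs_pair \<Rightarrow> nat set set" where
  "double_bonds (PairB n) = {{1, 2}}"
| "double_bonds (PairC n) = {{1, 2}}"
| "double_bonds _ = {}"

definition cmat :: "hs_pair \<Rightarrow> nat \<Rightarrow> nat \<Rightarrow> nat" where
  "cmat X i j =
    (if i = j then 1 else if {i, j} \<in> double_bonds X then 4
     else if {i, j} \<in> single_bonds X then 3 else 2)"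

text \<open>Only consulted for nodes at a double bond, so irrelevant in the simply laced types.\<close>

fun short_root :: "hs_pair \<Rightarrow> nat \<Rightarrow> bool" where
  "short_root (PairB n) i \<longleftrightarrow> i = 1"
| "short_root (PairC n) i \<longleftrightarrow> i \<noteq> 1"
| "short_root _ i \<longleftrightarrow> False"

definition WG :: "hs_pair \<Rightarrow> elt monoid" where
  "WG X = cox_group (nodes X) (cmat X)"

definition elt_of :: "hs_pair \<Rightarrow> nat list \<Rightarrow> elt" where
  "elt_of X w = cox_rel (nodes X) (cmat X) `` {w}"

definition gen :: "hs_pair \<Rightarrow> nat \<Rightarrow> elt" where
  "gen X i = elt_of X [i]"

definition rmul :: "hs_pair \<Rightarrow> elt \<Rightarrow> nat \<Rightarrow> elt" where
  "rmul X x i = x \<otimes>\<^bsub>WG X\<^esub> gen X i"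

definition cox_len :: "elt \<Rightarrow> nat" where
  "cox_len x = (LEAST r. \<exists>w\<in>x. length w = r)"

definition reduced_word :: "hs_pair \<Rightarrow> elt \<Rightarrow> nat list \<Rightarrow> bool" where
  "reduced_word X x w \<longleftrightarrow> w \<in> lists (nodes X) \<and> elt_of X w = x \<and> length w = cox_len x"

definition parabolic :: "hs_pair \<Rightarrow> elt set" where
  "parabolic X = generate (WG X) (gen X ` (nodes X - {omitted X}))"

definition PW :: "hs_pair \<Rightarrow> elt set" where
  "PW X = {x \<in> carrier (WG X). \<forall>y \<in> parabolic X #>\<^bsub>WG X\<^esub> x. cox_len x \<le> cox_len y}"

definition reflections :: "hs_pair \<Rightarrow> elt set" where
  "reflections X =
    {x \<otimes>\<^bsub>WG X\<^esub> gen X i \<otimes>\<^bsub>WG X\<^esub> inv\<^bsub>WG X\<^esub> x |x i. x \<in> carrier (WG X) \<and> i \<in> nodes X}"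

definition bruhat_less :: "hs_pair \<Rightarrow> elt \<Rightarrow> elt \<Rightarrow> bool" where
  "bruhat_less X u v \<longleftrightarrow>
    (u, v) \<in> {(x, x \<otimes>\<^bsub>WG X\<^esub> t) |x t. x \<in> carrier (WG X) \<and> t \<in> reflections X \<and>
                cox_len x < cox_len (x \<otimes>\<^bsub>WG X\<^esub> t)}\<^sup>+"

abbreviation empty_elt :: "hs_pair \<Rightarrow> elt" where
  "empty_elt X \<equiv> \<one>\<^bsub>WG X\<^esub>"


section \<open>Laurent polynomials\<close>

text \<open>The group ring of \<open>\<int>\<close> over \<open>\<int>\<close>, that is \<open>\<int>[q, q\<^sup>-\<^sup>1]\<close>; \<open>lookup p d\<close> is the coefficient of \<open>q\<^sup>d\<close>.\<close>

type_synonym laurent = "int \<Rightarrow>\<^sub>0 int"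

definition qpow :: "int \<Rightarrow> laurent" where
  "qpow d = Poly_Mapping.single d 1"

definition q_ideal :: "laurent set" where
  "q_ideal = {p. Poly_Mapping.keys p \<subseteq> {1..}}"  \<comment> \<open>\<open>q\<int>[q]\<close>\<close>

definition sym_laurent :: "laurent set" where
  "sym_laurent = range (\<lambda>p :: int poly. poly (map_poly of_int p) (qpow 1 + qpow (- 1)))"
  \<comment> \<open>\<open>\<int>[q + q\<^sup>-\<^sup>1]\<close>\<close>


section \<open>Paths and Kazhdan-Lusztig polynomials\<close>

text \<open>An edge is the triple of its source, its label and its target.\<close>

type_synonym edge = "elt \<times> nat \<times> elt"

definition path_graph :: "hs_pair \<Rightarrow> (elt, edge) pre_digraph" where
  "path_graph X =
    \<lparr>verts = PW X,
     arcs = {(x, i, y) |x i y. x \<in> PW X \<and> i \<in> nodes X \<and> rmul X x i \<in> PW X \<and> y \<in> {x, rmul X x i}},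
     tail = (\<lambda>(x, i, y). x),
     head = (\<lambda>(x, i, y). y)\<rparr>"

fun edge_deg :: "hs_pair \<Rightarrow> edge \<Rightarrow> int" where
  "edge_deg X (x, i, y) =
    (if y \<noteq> x then 0 else if bruhat_less X x (rmul X x i) then 1 else - 1)"

definition path_deg :: "hs_pair \<Rightarrow> edge list \<Rightarrow> int" where
  "path_deg X T = sum_list (map (edge_deg X) T)"

definition path_weight :: "edge list \<Rightarrow> nat list" where
  "path_weight T = map (\<lambda>(x, i, y). i) T"

definition Path :: "hs_pair \<Rightarrow> elt \<Rightarrow> nat list \<Rightarrow> edge list set" where
  "Path X x w = {T. pre_digraph.awalk (path_graph X) (empty_elt X) T x \<and> path_weight T = w}"

text \<open>
  \<open>n\<close> depends on two elements of \<open>PW X\<close>; \<open>b\<close> on an element and a reduced word of another one.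
  The equations are imposed for all reduced words.
\<close>

definition kl_recursion ::
    "hs_pair \<Rightarrow> (elt \<Rightarrow> elt \<Rightarrow> laurent) \<Rightarrow> (elt \<Rightarrow> nat list \<Rightarrow> laurent) \<Rightarrow> bool" where
  "kl_recursion X n b \<longleftrightarrow>
    (\<forall>x\<in>PW X. \<forall>y\<in>PW X. \<forall>w. reduced_word X y w \<longrightarrow>
      (if x = y then n x y = 1 \<and> b x w = 1
       else b x w \<in> sym_laurent \<and> n x y \<in> q_ideal \<and>
         b x w + n x y =
           (\<Sum>T\<in>Path X x w. qpow (path_deg X T))
           - (\<Sum>z | z \<in> PW X \<and> bruhat_less X x z \<and> bruhat_less X z y. n x z * b z w)))"

text \<open>The second conjunct only fixes the values outside \<open>PW X\<close>, so that \<open>n\<close> is unique as a function.\<close>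

definition kl_poly :: "hs_pair \<Rightarrow> elt \<Rightarrow> elt \<Rightarrow> laurent" where
  "kl_poly X =
    (THE n. (\<exists>b. kl_recursion X n b) \<and> (\<forall>x y. x \<notin> PW X \<or> y \<notin> PW X \<longrightarrow> n x y = 0))"


section \<open>The oriented Temperley-Lieb algebra\<close>

text \<open>
  Words in the generators form a monoid; \<open>poly_mapping\<close> on them with coefficients in
  \<open>laurent\<close> is the free associative algebra.
\<close>

datatype tl_gen = IGen elt | EGen nat

datatype tl_word = TLW (letters: "tl_gen list")

instantiation tl_word :: monoid_add
begin
definition zero_tl_word :: tl_word where "zero_tl_word = TLW []"
definition plus_tl_word :: "tl_word \<Rightarrow> tl_word \<Rightarrow> tl_word" where
  "plus_tl_word u v = TLW (letters u @ letters v)"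
instance by standard (auto simp: zero_tl_word_def plus_tl_word_def)
end

type_synonym tl_free = "tl_word \<Rightarrow>\<^sub>0 laurent"

definition tl_gens :: "hs_pair \<Rightarrow> tl_gen set" where
  "tl_gens X = IGen ` PW X \<union> EGen ` nodes X"

definition free_algebra :: "hs_pair \<Rightarrow> tl_free ring" where
  "free_algebra X =
    \<lparr>carrier = {f. \<forall>w\<in>Poly_Mapping.keys f. set (letters w) \<subseteq> tl_gens X},
     monoid.mult = (*), one = 1, zero = 0, add = (+)\<rparr>"

definition mon :: "tl_gen list \<Rightarrow> tl_free" where
  "mon gs = Poly_Mapping.single (TLW gs) 1"

definition scal :: "laurent \<Rightarrow> tl_free \<Rightarrow> tl_free" where
  "scal c f = Poly_Mapping.single 0 c * f"

text \<open>A relation \<open>a = b\<close> is recorded as the element \<open>a - b\<close>.\<close>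

definition tl_rels_idem :: "hs_pair \<Rightarrow> tl_free set" where
  "tl_rels_idem X =
    {(\<Sum>x\<in>PW X. mon [IGen x]) - 1}
    \<union> {mon [IGen x, IGen y] - (if x = y then mon [IGen x] else 0) |x y. x \<in> PW X \<and> y \<in> PW X}
    \<union> {mon [IGen x, EGen i, IGen x] |x i. x \<in> PW X \<and> i \<in> nodes X \<and> rmul X x i \<notin> PW X}
    \<union> {mon [IGen x, EGen i, IGen y] |x y i.
         x \<in> PW X \<and> y \<in> PW X \<and> i \<in> nodes X \<and> y \<notin> {x, rmul X x i}}"

definition tl_rels_quad :: "hs_pair \<Rightarrow> tl_free set" where
  "tl_rels_quad X =
    {mon [IGen y, EGen i, IGen x, EGen i, IGen z]
       - scal (qpow (int (cox_len (rmul X x i)) - int (cox_len x))) (mon [IGen y, EGen i, IGen z]) |x y z i.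
      i \<in> nodes X \<and> x \<in> PW X \<and> rmul X x i \<in> PW X \<and>
      y \<in> {x, rmul X x i} \<and> z \<in> {x, rmul X x i}}"

definition tl_rels_braid :: "hs_pair \<Rightarrow> tl_free set" where
  "tl_rels_braid X =
    {mon [EGen i, EGen j] - mon [EGen j, EGen i] |i j. i \<in> nodes X \<and> j \<in> nodes X \<and> cmat X i j = 2}
    \<union> {mon [EGen i, EGen j, EGen i] - mon [EGen i] |i j. i \<in> nodes X \<and> j \<in> nodes X \<and> cmat X i j = 3}
    \<union> {mon [IGen y, EGen i, IGen x, EGen j, IGen x, EGen i, IGen z] - mon [IGen y, EGen i, IGen z] |x y z i j.
         i \<in> nodes X \<and> j \<in> nodes X \<and> cmat X i j = 4 \<and> short_root X i \<and>
         x \<in> PW X \<and> rmul X x i \<in> PW X \<and> rmul X x j \<in> PW X \<and>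
         y \<in> {x, rmul X x i} \<and> z \<in> {x, rmul X x i}}"

definition tl_ideal :: "hs_pair \<Rightarrow> tl_free set" where
  "tl_ideal X = Idl\<^bsub>free_algebra X\<^esub> (tl_rels_idem X \<union> tl_rels_quad X \<union> tl_rels_braid X)"

definition TL :: "hs_pair \<Rightarrow> tl_free set ring" where
  "TL X = free_algebra X Quot tl_ideal X"

definition tl_class :: "hs_pair \<Rightarrow> tl_free \<Rightarrow> tl_free set" where
  "tl_class X f = tl_ideal X +>\<^bsub>free_algebra X\<^esub> f"

definition one_idem :: "hs_pair \<Rightarrow> elt \<Rightarrow> tl_free set" where
  "one_idem X x = tl_class X (mon [IGen x])"

definition tlE :: "hs_pair \<Rightarrow> nat \<Rightarrow> tl_free set" where
  "tlE X i = tl_class X (mon [EGen i])"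

fun path_elt_from :: "hs_pair \<Rightarrow> tl_free set \<Rightarrow> edge list \<Rightarrow> tl_free set" where
  "path_elt_from X a [] = a"
| "path_elt_from X a ((x, i, y) # T) =
     path_elt_from X (a \<otimes>\<^bsub>TL X\<^esub> tlE X i \<otimes>\<^bsub>TL X\<^esub> one_idem X y) T"

text \<open>\<open>E\<^sub>T\<close> for a path \<open>T\<close> starting at the identity.\<close>

definition path_elt :: "hs_pair \<Rightarrow> edge list \<Rightarrow> tl_free set" where
  "path_elt X T = path_elt_from X (one_idem X (empty_elt X)) T"


section \<open>Decorated tangles for type \<open>C\<close>\<close>

text \<open>
  Up to isotopy, a planar tangle without closed loops is determined by its strands, regarded as
  pairs of boundary vertices, and by the set of strands that carry a bead.  \<open>Mid\<close> is only used
  for the vertices that are glued when two tangles are stacked.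
\<close>

datatype vertex = South nat | Mid nat | North nat

record tangle =
  strands :: "vertex set set"
  beaded :: "vertex set set"

definition id_tangle :: "nat \<Rightarrow> tangle" where
  "id_tangle N = \<lparr>strands = {{South j, North j} |j. j \<in> {1..N}}, beaded = {}\<rparr>"

text \<open>Node \<open>1\<close> stands for \<open>1'\<close>: its arcs join the vertices \<open>1\<close> and \<open>2\<close> and carry beads.\<close>

definition gen_tangle :: "nat \<Rightarrow> nat \<Rightarrow> tangle" where
  "gen_tangle N i =
    \<lparr>strands = {{South i, South (i + 1)}, {North i, North (i + 1)}}
        \<union> {{South j, North j} |j. j \<in> {1..N} - {i, i + 1}},
     beaded = (if i = 1 then {{South i, South (i + 1)}, {North i, North (i + 1)}} else {})\<rparr>"

fun to_lower :: "vertex \<Rightarrow> vertex" where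
  "to_lower (North j) = Mid j"
| "to_lower v = v"

fun to_upper :: "vertex \<Rightarrow> vertex" where
  "to_upper (South j) = Mid j"
| "to_upper v = v"

fun outer :: "vertex \<Rightarrow> bool" where
  "outer (Mid j) \<longleftrightarrow> False"
| "outer v \<longleftrightarrow> True"

definition pieces :: "tangle \<Rightarrow> tangle \<Rightarrow> vertex set set" where
  "pieces d d' = (`) to_lower ` strands d \<union> (`) to_upper ` strands d'"

definition beaded_pieces :: "tangle \<Rightarrow> tangle \<Rightarrow> vertex set set" where
  "beaded_pieces d d' = (`) to_lower ` beaded d \<union> (`) to_upper ` beaded d'"

definition joined :: "tangle \<Rightarrow> tangle \<Rightarrow> (vertex \<times> vertex) set" where
  "joined d d' = {(u, v). \<exists>s\<in>pieces d d'. u \<in> s \<and> v \<in> s}\<^sup>*"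

text \<open>
  \<open>d'\<close> is placed above \<open>d\<close>.  A strand of the product is a chain of pieces between two outer
  vertices; it carries a bead iff one of its pieces does.
\<close>

definition stack :: "tangle \<Rightarrow> tangle \<Rightarrow> tangle" where
  "stack d d' =
    \<lparr>strands = {{u, v} |u v. u \<noteq> v \<and> outer u \<and> outer v \<and> (u, v) \<in> joined d d'},
     beaded = {{u, v} |u v. u \<noteq> v \<and> outer u \<and> outer v \<and> (u, v) \<in> joined d d' \<and>
        (\<exists>s\<in>beaded_pieces d d'. \<exists>x\<in>s. (u, x) \<in> joined d d')}\<rparr>"

definition word_tangle :: "nat \<Rightarrow> nat list \<Rightarrow> tangle" where
  "word_tangle N w = foldl (\<lambda>d i. stack d (gen_tangle N i)) (id_tangle N) w"

datatype symbol = Circ | Up | Down  \<comment> \<open>\<open>\<circ>\<close>, \<open>\<and>\<close>, \<open>\<or>\<close>\<close>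

fun flip_symbol :: "symbol \<Rightarrow> symbol" where
  "flip_symbol Up = Down"
| "flip_symbol Down = Up"
| "flip_symbol Circ = Circ"

text \<open>Symbol sequences are functions of the position; only positions \<open>1, \<dots>, n + 1\<close> matter.\<close>

definition empty_seq :: "nat \<Rightarrow> symbol" where
  "empty_seq p = (if p = 1 then Circ else Down)"

definition act_seq :: "(nat \<Rightarrow> symbol) \<Rightarrow> nat \<Rightarrow> nat \<Rightarrow> symbol" where
  "act_seq f i =
    (if i = 1 then f(2 := flip_symbol (f 2)) else f(i := f (i + 1), i + 1 := f i))"

text \<open>
  \<open>act_seq\<close> satisfies the Coxeter relations of type \<open>C\<close> on sequences with \<open>Circ\<close> in position \<open>1\<close> only,
  so the chosen word of \<open>x\<close> is immaterial.
\<close>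

definition seq_of :: "elt \<Rightarrow> nat \<Rightarrow> symbol" where
  "seq_of x = foldl act_seq empty_seq (SOME w. w \<in> x)"

text \<open>The label of a vertex when the identity is on the southern and \<open>x\<close> on the northern edge.\<close>

fun vertex_label :: "elt \<Rightarrow> vertex \<Rightarrow> symbol" where
  "vertex_label x (South j) = empty_seq j"
| "vertex_label x (North j) = seq_of x j"
| "vertex_label x (Mid j) = Circ"

fun points_in :: "elt \<Rightarrow> vertex \<Rightarrow> bool" where
  "points_in x (South j) \<longleftrightarrow> vertex_label x (South j) = Up"
| "points_in x (North j) \<longleftrightarrow> vertex_label x (North j) = Down"
| "points_in x (Mid j) \<longleftrightarrow> False"

definition flip_oriented :: "elt \<Rightarrow> vertex set \<Rightarrow> bool" where
  "flip_oriented x s \<longleftrightarrow>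
    (\<exists>u v. s = {u, v} \<and> u \<noteq> v \<and>
      (if vertex_label x u = Circ \<or> vertex_label x v = Circ
       then vertex_label x u \<noteq> vertex_label x v
       else points_in x u = points_in x v))"


section \<open>Standard basis elements and graded bases\<close>

text \<open>
  Whether \<open>E\<^sub>T\<close> is standard for \<open>T \<in> Path X x w\<close>, where \<open>w\<close> is a reduced word; this only
  involves \<open>x\<close> and \<open>w\<close>.
\<close>

fun standard :: "hs_pair \<Rightarrow> elt \<Rightarrow> nat list \<Rightarrow> bool" where
  "standard (PairB n) x w \<longleftrightarrow> int (cox_len (elt_of (PairB n) w)) - int (cox_len x) \<in> {0, 1}"
| "standard (PairC n) x w \<longleftrightarrow> (\<forall>s\<in>beaded (word_tangle (n + 1) w). flip_oriented x s)"
| "standard _ x w \<longleftrightarrow> True"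

definition NPath :: "hs_pair \<Rightarrow> elt \<Rightarrow> nat list \<Rightarrow> edge list set" where
  "NPath X x w = {T \<in> Path X x w. standard X x w}"

text \<open>
  The graded free \<open>\<int>\<close>-module of graded rank \<open>p\<close>, for \<open>p\<close> with nonnegative coefficients: in degree \<open>d\<close>
  it is free on \<open>(d, 0), (d, 1), \<dots>\<close>, with as many generators as the coefficient of \<open>q\<^sup>d\<close> says.
\<close>

definition graded_gens :: "laurent \<Rightarrow> (int \<times> nat) set" where
  "graded_gens p = {(d, i). int i < Poly_Mapping.lookup p d}"

definition graded_free :: "laurent \<Rightarrow> ((int \<times> nat) \<Rightarrow>\<^sub>0 int) set" where
  "graded_free p = {f. Poly_Mapping.keys f \<subseteq> graded_gens p}"

definition graded_part :: "laurent \<Rightarrow> int \<Rightarrow> ((int \<times> nat) \<Rightarrow>\<^sub>0 int) set" where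
  "graded_part p d = {f \<in> graded_free p. fst ` Poly_Mapping.keys f \<subseteq> {d}}"

definition homogeneous_basis ::
    "laurent \<Rightarrow> 'i set \<Rightarrow> ('i \<Rightarrow> int) \<Rightarrow> ('i \<Rightarrow> ((int \<times> nat) \<Rightarrow>\<^sub>0 int)) \<Rightarrow> bool" where
  "homogeneous_basis p I deg B \<longleftrightarrow>
    inj_on B I \<and> (\<forall>i\<in>I. B i \<in> graded_part p (deg i)) \<and>
    \<not> module.dependent frag_cmul (B ` I) \<and> module.span frag_cmul (B ` I) = graded_free p"

end

theory Submission
  imports Defs "HOL-Library.Function_Algebras"
begin

text \<open>
  The elements of \<open>PW X\<close> are studied through a set of points on which the simple reflections act, with
  a rank that every reflection changes by at most one: minuscule weights in the simply laced types and
  in type \<open>C\<close>, a chain in type \<open>B\<close>.  Coset enumeration (\<open>rword_fixed\<close>,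
  \<open>PW_eq\<close>) identifies the orbit of the base point with \<open>PW X\<close>, the rank with the length, and the
  reduced words of an element with the ascending words of its point.  Ascents of a common point
  commute, and so do its descents; hence all ascending words of a point agree up to commutations
  (\<open>rword_unique\<close>), and the commutation relations of the Temperley-Lieb algebra carry the elements
  \<open>E\<^sub>T\<close> for one reduced word to those for another one (\<open>Path_comm_step\<close>).

  The sum of \<open>q\<^bsup>deg T\<^esup>\<close> over the paths of a word is obtained by applying operators \<open>E\<^sub>i\<close> to the base
  point, one for each letter (\<open>Path_sum\<close>).  The recursion for the Kazhdan-Lusztig polynomials has only
  one solution, because a symmetric Laurent polynomial without terms of degree at most zero vanishes.
  So a family is the family of these polynomials as soon as it is unitriangular with entries in
  \<open>q\<int>[q]\<close> off the diagonal and its span over \<open>\<int>[q + q\<^sup>-\<^sup>1]\<close> contains all path sums (\<open>kl_poly_model\<close>).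

  In the simply laced types the path sums of reduced words form such a family: that of \<open>v\<close> equals
  the product of the factors \<open>1 + q e\<^sup>\<beta>\<close> applied to the point \<open>v\<close>, where \<open>\<beta>\<close> runs through a set of
  pairwise orthogonal positive roots, the cups of \<open>v\<close>.  An ascent \<open>\<alpha>\<^sub>i\<close> is non-orthogonal to at most
  two cups, and in each case applying \<open>E\<^sub>i\<close> gives a product of the same kind (\<open>cups_step\<close>).  The
  vertices of the resulting cube are distinct, so every value is zero or a power of \<open>q\<close>: there is at
  most one path to each endpoint, and the graded modules have rank at most one.

  The types \<open>B\<close> and \<open>C\<close> borrow their polynomials.  On the chain of type \<open>B\<close> the path sums expand in
  the families \<open>t + q (t - 1)\<close> known from projective space, and the condition on the lengths selects
  these two terms.  The points of type \<open>C\<close> are the spin weights of \<open>D\<^sub>n\<^sub>+\<^sub>1\<close>, and the operator at the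
  double bond is the sum of the two operators at the fork; the path sums thus expand in the
  polynomials of type \<open>D\<close>, whose span is stable under the operators (\<open>symspan_canonical\<close>).  That the
  standard elements are exactly those counted by the type \<open>D\<close> polynomial is an induction along the
  word: stacking a generator on a tangle is described explicitly (\<open>stack_glue\<close>), and the strands
  of the tangle control both path sums (\<open>diagram_step\<close>).
\<close>

section \<open>The Coxeter group as a group of words\<close>

lemma cox_rel_lists: "(u, v) \<in> cox_rel S m \<Longrightarrow> u \<in> lists S \<and> v \<in> lists S"
proof (induction rule: cox_rel.induct)
  case (rel i j)
  have "set (concat (replicate (m i j) [i, j])) \<subseteq> S"
    using rel by (auto simp: set_replicate_conv_if split: if_splits)
  then show ?case by (simp add: lists_eq_set)
qed (auto simp: lists_eq_set)

lemma equiv_cox_rel: "equiv (lists S) (cox_rel S m)"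
proof (rule equivI)
  show "cox_rel S m \<subseteq> lists S \<times> lists S" using cox_rel_lists by fast
  show "refl_on (lists S) (cox_rel S m)" by (rule refl_onI) (rule cox_rel.refl)
  show "sym (cox_rel S m)" by (rule symI) (rule cox_rel.sym)
  show "trans (cox_rel S m)" by (rule transI) (rule cox_rel.trans)
qed

lemma cox_rel_append:
  assumes "(u, u') \<in> cox_rel S m" "(v, v') \<in> cox_rel S m"
  shows "(u @ v, u' @ v') \<in> cox_rel S m"
proof -
  have l: "u \<in> lists S" "u' \<in> lists S" "v \<in> lists S" "v' \<in> lists S"
    using assms cox_rel_lists by blast+
  have "([] @ u @ v, [] @ u' @ v) \<in> cox_rel S m" "(u' @ v @ [], u' @ v' @ []) \<in> cox_rel S m"
    by (intro cox_rel.cong assms l lists.Nil)+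
  then show ?thesis using cox_rel.trans[of "u @ v" "u' @ v" S m "u' @ v'"] by simp
qed

lemma cox_rel_parity: "(u, v) \<in> cox_rel S m \<Longrightarrow> even (length u) \<longleftrightarrow> even (length v)"
proof (induction rule: cox_rel.induct)
  case (rel i j)
  have "length (concat (replicate n [i, j])) = 2 * n" for n by (induction n) auto
  then show ?case by simp
qed auto

lemma cmat_self [simp]: "cmat X i i = 1"
  by (simp add: cmat_def)

lemma cox_rel_cancel:
  assumes "i \<in> nodes X" shows "([i, i], []) \<in> cox_rel (nodes X) (cmat X)"
  using cox_rel.rel[OF assms assms, of "cmat X"] by simp

lemma elt_of_eq_iff:
  assumes "u \<in> lists (nodes X)" "v \<in> lists (nodes X)"
  shows "elt_of X u = elt_of X v \<longleftrightarrow> (u, v) \<in> cox_rel (nodes X) (cmat X)"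
  unfolding elt_of_def by (rule eq_equiv_class_iff[OF equiv_cox_rel assms])

lemma mem_elt_of: "w \<in> elt_of X u \<longleftrightarrow> (u, w) \<in> cox_rel (nodes X) (cmat X)"
  by (simp add: elt_of_def)

lemma carrier_WG: "carrier (WG X) = elt_of X ` lists (nodes X)"
  by (auto simp: WG_def cox_group_def quotient_def elt_of_def)

lemma elt_of_in_carrier [simp, intro]: "w \<in> lists (nodes X) \<Longrightarrow> elt_of X w \<in> carrier (WG X)"
  by (simp add: carrier_WG)

lemma one_WG: "\<one>\<^bsub>WG X\<^esub> = elt_of X []"
  by (simp add: WG_def cox_group_def elt_of_def)

lemma mult_WG:
  assumes "u \<in> lists (nodes X)" "v \<in> lists (nodes X)"
  shows "elt_of X u \<otimes>\<^bsub>WG X\<^esub> elt_of X v = elt_of X (u @ v)"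
proof -
  let ?r = "cox_rel (nodes X) (cmat X)"
  have "?r `` {u' @ v'} = ?r `` {u @ v}" if "(u, u') \<in> ?r" "(v, v') \<in> ?r" for u' v'
    using equiv_class_eq[OF equiv_cox_rel cox_rel_append[OF that]] by simp
  then have "(\<Union>u'\<in>?r `` {u}. \<Union>v'\<in>?r `` {v}. ?r `` {u' @ v'})
      = (\<Union>u'\<in>?r `` {u}. \<Union>v'\<in>?r `` {v}. ?r `` {u @ v})"
    by (intro SUP_cong[OF HOL.refl]) (simp add: Image_singleton_iff)
  also have "\<dots> = ?r `` {u @ v}"
    using assms by (auto intro: cox_rel.refl)
  finally show ?thesis
    unfolding WG_def cox_group_def elt_of_def by simp
qed

lemma rev_cancel:
  assumes "w \<in> lists (nodes X)"
  shows "(rev w @ w, []) \<in> cox_rel (nodes X) (cmat X)"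
  using assms
proof (induction w)
  case (Cons i w)
  have "(rev w @ [i, i] @ w, rev w @ [] @ w) \<in> cox_rel (nodes X) (cmat X)"
    by (rule cox_rel.cong[OF cox_rel_cancel]) (use Cons in \<open>simp_all add: lists_eq_set\<close>)
  moreover have "(rev w @ w, []) \<in> cox_rel (nodes X) (cmat X)" using Cons by simp
  ultimately have "(rev w @ [i, i] @ w, []) \<in> cox_rel (nodes X) (cmat X)"
    using cox_rel.trans[of "rev w @ [i, i] @ w" "rev w @ w"] by simp
  then show ?case by simp
qed (auto intro: cox_rel.refl)

lemma group_WG: "group (WG X)"
proof (rule groupI)
  fix x y z
  assume "x \<in> carrier (WG X)" "y \<in> carrier (WG X)" "z \<in> carrier (WG X)"
  then obtain u v w where *: "u \<in> lists (nodes X)" "v \<in> lists (nodes X)" "w \<in> lists (nodes X)"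
    "x = elt_of X u" "y = elt_of X v" "z = elt_of X w"
    by (auto simp: carrier_WG)
  then show "x \<otimes>\<^bsub>WG X\<^esub> y \<in> carrier (WG X)" by (simp add: mult_WG)
  show "x \<otimes>\<^bsub>WG X\<^esub> y \<otimes>\<^bsub>WG X\<^esub> z = x \<otimes>\<^bsub>WG X\<^esub> (y \<otimes>\<^bsub>WG X\<^esub> z)" using * by (simp add: mult_WG)
  show "\<one>\<^bsub>WG X\<^esub> \<otimes>\<^bsub>WG X\<^esub> x = x" using * by (simp add: mult_WG one_WG)
  have "elt_of X (rev u) \<otimes>\<^bsub>WG X\<^esub> x = \<one>\<^bsub>WG X\<^esub>"
    using * rev_cancel[of u X] by (simp add: mult_WG one_WG elt_of_eq_iff lists_eq_set)
  then show "\<exists>y\<in>carrier (WG X). y \<otimes>\<^bsub>WG X\<^esub> x = \<one>\<^bsub>WG X\<^esub>"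
    using * by (intro bexI[of _ "elt_of X (rev u)"]) (auto simp: lists_eq_set)
qed (auto simp: one_WG)

lemma inv_WG:
  assumes "w \<in> lists (nodes X)"
  shows "inv\<^bsub>WG X\<^esub> (elt_of X w) = elt_of X (rev w)"
proof (rule group.inv_equality[OF group_WG])
  show "elt_of X (rev w) \<otimes>\<^bsub>WG X\<^esub> elt_of X w = \<one>\<^bsub>WG X\<^esub>"
    using assms rev_cancel[of w X] by (simp add: mult_WG one_WG elt_of_eq_iff lists_eq_set)
qed (use assms in \<open>auto simp: lists_eq_set\<close>)

lemma rmul_elt_of:
  assumes "w \<in> lists (nodes X)" "i \<in> nodes X"
  shows "rmul X (elt_of X w) i = elt_of X (w @ [i])"
  using assms by (simp add: rmul_def gen_def mult_WG)

lemma cox_len_le: "w \<in> x \<Longrightarrow> cox_len x \<le> length w"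
  unfolding cox_len_def by (rule Least_le) auto

lemma cox_len_attained: "w \<in> x \<Longrightarrow> \<exists>u\<in>x. length u = cox_len x"
  unfolding cox_len_def by (rule LeastI_ex) auto

lemma self_mem_elt_of: "w \<in> lists (nodes X) \<Longrightarrow> w \<in> elt_of X w"
  by (simp add: mem_elt_of cox_rel.refl)

lemma bruhat_less_len: "bruhat_less X u v \<Longrightarrow> cox_len u < cox_len v"
  unfolding bruhat_less_def by (induction rule: trancl_induct) auto

lemma bruhat_less_trans: "bruhat_less X u v \<Longrightarrow> bruhat_less X v w \<Longrightarrow> bruhat_less X u w"
  unfolding bruhat_less_def by (rule trancl_trans)

lemma gen_reflection: "i \<in> nodes X \<Longrightarrow> gen X i \<in> reflections X"
proof -
  interpret group "WG X" by (rule group_WG)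
  assume i: "i \<in> nodes X"
  then have "gen X i = \<one>\<^bsub>WG X\<^esub> \<otimes>\<^bsub>WG X\<^esub> gen X i \<otimes>\<^bsub>WG X\<^esub> inv\<^bsub>WG X\<^esub> \<one>\<^bsub>WG X\<^esub>"
    by (simp add: gen_def)
  then show ?thesis unfolding reflections_def using i by blast
qed

lemma bruhat_less_rmul:
  assumes "x \<in> carrier (WG X)" "i \<in> nodes X" "cox_len x < cox_len (rmul X x i)"
  shows "bruhat_less X x (rmul X x i)"
  unfolding bruhat_less_def
  by (rule r_into_trancl) (use assms gen_reflection[of i X] in \<open>auto simp: rmul_def\<close>)

section \<open>Graded models of the minimal coset representatives\<close>

lemma cox_rel_move_right:
  assumes "(a @ b, []) \<in> cox_rel (nodes X) (cmat X)" "a \<in> lists (nodes X)" "b \<in> lists (nodes X)"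
  shows "(a, rev b) \<in> cox_rel (nodes X) (cmat X)"
proof -
  have "(b @ rev b, []) \<in> cox_rel (nodes X) (cmat X)"
    using rev_cancel[of "rev b" X] assms(3) by (simp add: lists_eq_set)
  then have "(a @ [], a @ b @ rev b) \<in> cox_rel (nodes X) (cmat X)"
    using assms(2) by (intro cox_rel_append cox_rel.refl) (auto intro: cox_rel.sym)
  moreover have "((a @ b) @ rev b, [] @ rev b) \<in> cox_rel (nodes X) (cmat X)"
    using assms by (intro cox_rel_append cox_rel.refl) (auto simp: lists_eq_set)
  ultimately show ?thesis
    using cox_rel.trans[of a "a @ b @ rev b" "nodes X" "cmat X" "rev b"] by simp
qed

lemma braid_word:
  assumes "i \<in> nodes X" "j \<in> nodes X"
  shows "cmat X i j = 2 \<Longrightarrow> ([i, j], [j, i]) \<in> cox_rel (nodes X) (cmat X)"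
    and "cmat X i j = 3 \<Longrightarrow> ([i, j, i], [j, i, j]) \<in> cox_rel (nodes X) (cmat X)"
    and "cmat X i j = 4 \<Longrightarrow> ([i, j, i, j], [j, i, j, i]) \<in> cox_rel (nodes X) (cmat X)"
  using cox_rel.rel[OF assms, of "cmat X"] assms
    cox_rel_move_right[of "[i, j]" "[i, j]" X] cox_rel_move_right[of "[i, j, i]" "[j, i, j]" X]
    cox_rel_move_right[of "[i, j, i, j]" "[i, j, i, j]" X]
  by (simp_all add: eval_nat_numeral)

lemma cmat_sym: "cmat X i j = cmat X j i"
  by (simp add: cmat_def insert_commute)

lemma cmat_cases: "i \<noteq> j \<Longrightarrow> cmat X i j = 2 \<or> cmat X i j = 3 \<or> cmat X i j = 4"
  by (simp add: cmat_def)

definition comm_step :: "hs_pair \<Rightarrow> nat list \<Rightarrow> nat list \<Rightarrow> bool" where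
  "comm_step X w w' \<longleftrightarrow> (\<exists>a b i j. w = a @ [i, j] @ b \<and> w' = a @ [j, i] @ b \<and>
     w \<in> lists (nodes X) \<and> cmat X i j = 2)"

lemma comm_step_sym: "comm_step X w w' \<Longrightarrow> comm_step X w' w"
  unfolding comm_step_def by (force simp: cmat_sym lists_eq_set)

lemma comm_steps_append:
  assumes "(comm_step X)\<^sup>*\<^sup>* w w'" "v \<in> lists (nodes X)"
  shows "(comm_step X)\<^sup>*\<^sup>* (w @ v) (w' @ v)"
  using assms(1)
proof (induction rule: rtranclp_induct)
  case (step y z)
  then have "comm_step X (y @ v) (z @ v)"
    using assms(2) unfolding comm_step_def by (force simp: lists_eq_set)
  then show ?case using step.IH by (rule rtranclp.rtrancl_into_rtrancl[rotated])
qed auto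

lemma comm_steps_cox_rel:
  assumes "(comm_step X)\<^sup>*\<^sup>* w w'" "w \<in> lists (nodes X)"
  shows "(w, w') \<in> cox_rel (nodes X) (cmat X)"
  using assms(1)
proof (induction rule: rtranclp_induct)
  case (step y z)
  then obtain a b i j where *: "y = a @ [i, j] @ b" "z = a @ [j, i] @ b" "y \<in> lists (nodes X)" "cmat X i j = 2"
    unfolding comm_step_def by blast
  then have "(y, z) \<in> cox_rel (nodes X) (cmat X)"
    by (auto simp del: append.simps intro!: cox_rel.cong braid_word)
  then show ?case using step.IH by (blast intro: cox_rel.trans)
qed (use assms(2) in \<open>auto intro: cox_rel.refl\<close>)

text \<open>
  The points \<open>Om\<close> play the role of the cosets of \<open>P\<close>, and \<open>rk\<close> that of the length of the minimal
  representatives.  The assumptions on pairs of reflections describe the rank two orbits that occur: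
  a point with two ascents or two descents only occurs for commuting reflections, and at a
  double bond \<open>act_four\<close> excludes orbits of two points, leaving single points and chains of four.
\<close>

locale cox_model =
  fixes X :: hs_pair and act :: "nat \<Rightarrow> 'a \<Rightarrow> 'a" and rk :: "'a \<Rightarrow> real"
    and Om :: "'a set" and base :: 'a and bound :: real
  assumes omitted_node: "omitted X \<in> nodes X"
    and base_Om: "base \<in> Om" and rk_base: "rk base = 0"
    and act_Om: "v \<in> Om \<Longrightarrow> i \<in> nodes X \<Longrightarrow> act i v \<in> Om"
    and act_act: "v \<in> Om \<Longrightarrow> i \<in> nodes X \<Longrightarrow> act i (act i v) = v"
    and act_braid: "v \<in> Om \<Longrightarrow> i \<in> nodes X \<Longrightarrow> j \<in> nodes X \<Longrightarrow> i \<noteq> j \<Longrightarrow>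
      ((\<lambda>v. act j (act i v)) ^^ cmat X i j) v = v"
    and rk_act: "v \<in> Om \<Longrightarrow> i \<in> nodes X \<Longrightarrow> act i v \<noteq> v \<Longrightarrow>
      rk (act i v) = rk v + 1 \<or> rk (act i v) = rk v - 1"
    and act_base: "i \<in> nodes X \<Longrightarrow> i \<noteq> omitted X \<Longrightarrow> act i base = base"
    and rk_omitted: "rk (act (omitted X) base) = 1"
    and asc_asc: "v \<in> Om \<Longrightarrow> i \<in> nodes X \<Longrightarrow> j \<in> nodes X \<Longrightarrow> i \<noteq> j \<Longrightarrow>
      rk v < rk (act i v) \<Longrightarrow> rk v < rk (act j v) \<Longrightarrow> cmat X i j = 2"
    and desc_desc: "v \<in> Om \<Longrightarrow> i \<in> nodes X \<Longrightarrow> j \<in> nodes X \<Longrightarrow> i \<noteq> j \<Longrightarrow>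
      rk (act i v) < rk v \<Longrightarrow> rk (act j v) < rk v \<Longrightarrow> cmat X i j = 2"
    and rk_commute: "v \<in> Om \<Longrightarrow> i \<in> nodes X \<Longrightarrow> j \<in> nodes X \<Longrightarrow> cmat X i j = 2 \<Longrightarrow>
      rk (act j (act i v)) - rk (act i v) = rk (act j v) - rk v"
    and act_four: "v \<in> Om \<Longrightarrow> i \<in> nodes X \<Longrightarrow> j \<in> nodes X \<Longrightarrow> cmat X i j = 4 \<Longrightarrow>
      act i v = v \<Longrightarrow> act j v \<noteq> v \<Longrightarrow> act i (act j v) \<noteq> act j v"
    and rk_bound: "v \<in> Om \<Longrightarrow> rk v \<le> bound"
begin

abbreviation cox_eq (infix "\<approx>" 50) where
  "u \<approx> w \<equiv> (u, w) \<in> cox_rel (nodes X) (cmat X)"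

lemma cox_eq_trans [trans]: "u \<approx> v \<Longrightarrow> v \<approx> w \<Longrightarrow> u \<approx> w"
  by (rule cox_rel.trans)

abbreviation run :: "'a \<Rightarrow> nat list \<Rightarrow> 'a" where
  "run \<equiv> foldl (\<lambda>v i. act i v)"

lemma run_Om: "v \<in> Om \<Longrightarrow> w \<in> lists (nodes X) \<Longrightarrow> run v w \<in> Om"
  by (induction w arbitrary: v) (auto simp: act_Om)

lemma run_cox_rel: "u \<approx> w \<Longrightarrow> v \<in> Om \<Longrightarrow> run v u = run v w"
proof (induction arbitrary: v rule: cox_rel.induct)
  case (cong u w x y)
  then show ?case by (simp add: run_Om)
next
  case (rel i j)
  have *: "run v (concat (replicate n [i, j])) = ((\<lambda>v. act j (act i v)) ^^ n) v" for n v
    by (induction n arbitrary: v) (simp_all add: funpow_swap1 del: funpow.simps(2) add: funpow_Suc_right)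
  show ?case
  proof (cases "i = j")
    case True
    then show ?thesis using rel by (simp add: act_act)
  next
    case False
    then show ?thesis using rel by (simp add: * act_braid)
  qed
qed auto

lemma act_commute:
  assumes "v \<in> Om" "i \<in> nodes X" "j \<in> nodes X" "cmat X i j = 2"
  shows "act i (act j v) = act j (act i v)"
  using run_cox_rel[OF braid_word(1)[OF assms(3,2)] assms(1)] assms(4) by (simp add: cmat_sym)

lemma act_eqD: "act i v = u \<Longrightarrow> v \<in> Om \<Longrightarrow> i \<in> nodes X \<Longrightarrow> v = act i u"
  by (auto simp: act_act)

lemma rk_eq_iff:
  assumes "v \<in> Om" "i \<in> nodes X"
  shows "rk (act i v) = rk v \<longleftrightarrow> act i v = v"
  using rk_act[OF assms] by fastforce

lemma rk_less_iff:
  assumes "v \<in> Om" "i \<in> nodes X"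
  shows "rk v < rk (act i v) \<longleftrightarrow> rk (act i v) = rk v + 1"
    and "rk (act i v) < rk v \<longleftrightarrow> rk (act i v) = rk v - 1"
  using rk_act[OF assms] rk_eq_iff[OF assms] by fastforce+

lemma moved_cases:
  assumes "v \<in> Om" "i \<in> nodes X" "act i v \<noteq> v"
  shows "rk v < rk (act i v) \<or> rk (act i v) < rk v"
  using rk_act[OF assms] by linarith

text \<open>
  The ascending words of a point; they turn out to be the reduced words of a representative.
\<close>

inductive rword :: "nat list \<Rightarrow> 'a \<Rightarrow> bool" where
  rword_Nil: "rword [] base"
| rword_snoc: "rword w v \<Longrightarrow> i \<in> nodes X \<Longrightarrow> rk v < rk (act i v) \<Longrightarrow> rword (w @ [i]) (act i v)"

definition orb :: "'a set" where
  "orb = {v. \<exists>w. rword w v}"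

lemma rword_props:
  assumes "rword w v"
  shows "v \<in> Om" "w \<in> lists (nodes X)" "run base w = v" "rk v = real (length w)" "v \<in> orb"
proof -
  show "v \<in> orb" using assms by (auto simp: orb_def)
  have "v \<in> Om \<and> w \<in> lists (nodes X) \<and> run base w = v \<and> rk v = real (length w)"
    using assms
  proof (induction rule: rword.induct)
    case (rword_snoc w v i)
    then show ?case using rk_less_iff(1)[of v i] act_Om[of v i] by auto
  qed (auto simp: base_Om rk_base)
  then show "v \<in> Om" "w \<in> lists (nodes X)" "run base w = v" "rk v = real (length w)" by auto
qed

lemma orb_Om: "v \<in> orb \<Longrightarrow> v \<in> Om"
  by (auto simp: orb_def dest: rword_props)

lemma base_orb: "base \<in> orb"
  by (auto simp: orb_def intro: rword_Nil)

lemma rword_snocD: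
  assumes "rword (w @ [i]) v"
  shows "rword w (act i v)" "i \<in> nodes X" "rk (act i v) < rk v" "rk v = rk (act i v) + 1"
  using assms by (auto elim!: rword.cases[of "w @ [i]"] simp: act_act rword_props rk_less_iff)

lemma rword_Nil_iff: "rword [] v \<longleftrightarrow> v = base"
  using rword_Nil rword.cases[of "[]" v] by blast

text \<open>
  Two descents of a point commute, so a descent different from the last letter of an ascending word
  can be pushed through that letter.
\<close>

lemma rword_descent:
  "rword w v \<Longrightarrow> i \<in> nodes X \<Longrightarrow> rk (act i v) < rk v \<Longrightarrow> \<exists>u. rword (u @ [i]) v"
proof (induction "length w" arbitrary: w v rule: less_induct)
  case less
  show ?case
  proof (cases w rule: rev_cases)
    case Nil
    then have "v = base" using less.prems by (simp add: rword_Nil_iff)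
    then show ?thesis using less.prems act_base rk_omitted rk_base by force
  next
    case (snoc u j)
    note u = rword_snocD[OF less.prems(1)[unfolded snoc]]
    note v = rword_props[OF less.prems(1)]
    show ?thesis
    proof (cases "i = j")
      case True
      then show ?thesis using less.prems snoc by blast
    next
      case False
      have c: "cmat X j i = 2" using desc_desc[of v j i] False u v less.prems by simp
      have "rk (act i (act j v)) < rk (act j v)"
        using rk_commute[of v j i] u v less.prems c by simp
      then obtain x where x: "rword (x @ [i]) (act j v)"
        using less.hyps[of u "act j v"] u snoc less.prems by auto
      have "rk (act j (act i v)) < rk (act i v)"
        using rk_commute[of v i j] u v less.prems c by (simp add: cmat_sym)
      moreover have "act i (act j v) = act j (act i v)" using act_commute[of v i j] u v less.prems c by (simp add: cmat_sym)
      moreover have "act j (act j (act i v)) = act i v" using act_act u v less.prems act_Om by simp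
      ultimately have "rword (x @ [j]) (act i v)"
        using rword_snoc[OF rword_snocD(1)[OF x], of j] u by simp
      then have "rword ((x @ [j]) @ [i]) (act i (act i v))"
        using less.prems v by (intro rword_snoc) (simp_all add: act_act)
      then have "rword ((x @ [j]) @ [i]) v" using less.prems(2) v(1) act_act[of v i] by simp
      then show ?thesis by blast
    qed
  qed
qed

lemma act_orb: "v \<in> orb \<Longrightarrow> i \<in> nodes X \<Longrightarrow> act i v \<in> orb"
proof -
  assume "v \<in> orb" and i: "i \<in> nodes X"
  then obtain w where w: "rword w v" by (auto simp: orb_def)
  consider "act i v = v" | "rk v < rk (act i v)" | "rk (act i v) < rk v"
    using moved_cases[of v i] rword_props[OF w] i by blast
  then show ?thesis
  proof cases
    case 3
    then obtain u where "rword (u @ [i]) v" using rword_descent w i by blast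
    then show ?thesis using rword_snocD(1) rword_props(5) by blast
  next
    case 2
    then show ?thesis using rword_snoc[OF w i] rword_props(5) by blast
  qed (use \<open>v \<in> orb\<close> in simp)
qed

lemma finite_orb: "finite orb"
proof (rule finite_subset)
  show "orb \<subseteq> run base ` {w. set w \<subseteq> nodes X \<and> length w \<le> nat \<lfloor>bound\<rfloor>}"
  proof
    fix v assume "v \<in> orb"
    then obtain w where "rword w v" by (auto simp: orb_def)
    note w = rword_props[OF this]
    then have "real (length w) \<le> bound" using rk_bound by metis
    then have "length w \<le> nat \<lfloor>bound\<rfloor>" by (simp add: le_nat_floor)
    with w show "v \<in> run base ` {w. set w \<subseteq> nodes X \<and> length w \<le> nat \<lfloor>bound\<rfloor>}"
      by (auto simp: lists_eq_set)
  qed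
  show "finite (run base ` {w. set w \<subseteq> nodes X \<and> length w \<le> nat \<lfloor>bound\<rfloor>})"
    by (intro finite_imageI finite_lists_length_le) (simp add: nodes_def)
qed

text \<open>
  The representatives are fully commutative: the ascending words of a point form one class under
  commutations, by the diamond of two commuting descents.
\<close>

lemma rword_unique:
  "rword w v \<Longrightarrow> rword w' v \<Longrightarrow> (comm_step X)\<^sup>*\<^sup>* w w'"
proof (induction "length w" arbitrary: w w' v rule: less_induct)
  case less
  have len: "length w = length w'"
    using rword_props(4)[OF less.prems(1)] rword_props(4)[OF less.prems(2)] by simp
  show ?case
  proof (cases w rule: rev_cases)
    case Nil
    then show ?thesis using len by simp
  next
    case w: (snoc u i)
    then obtain u' j where w': "w' = u' @ [j]" using len by (cases w' rule: rev_cases) auto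
    note u = rword_snocD[OF less.prems(1)[unfolded w]]
    note u' = rword_snocD[OF less.prems(2)[unfolded w']]
    note v = rword_props[OF less.prems(1)]
    show ?thesis
    proof (cases "i = j")
      case True
      then show ?thesis using less.hyps[of u "act i v" u'] u u' w w' comm_steps_append[of X u u' "[i]"] by simp
    next
      case False
      have c: "cmat X i j = 2" using desc_desc[of v i j] False u u' v by simp
      have "rk (act j (act i v)) < rk (act i v)" using rk_commute[of v i j] u u' v c by simp
      then obtain x where x: "rword (x @ [j]) (act i v)" using rword_descent u u' by blast
      have ij: "act i (act j v) = act j (act i v)" using act_commute u u' v c by simp
      have "rk (act i (act j v)) < rk (act j v)" using rk_commute[of v j i] u u' v c by (simp add: cmat_sym)
      then have x': "rword (x @ [i]) (act j v)"
        using rword_snoc[OF rword_snocD(1)[OF x], of i] u v u' ij act_act[of "act j v" i] act_Om by simp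
      have "(comm_step X)\<^sup>*\<^sup>* u (x @ [j])" using less.hyps[of u "act i v" "x @ [j]"] u x w by simp
      then have 1: "(comm_step X)\<^sup>*\<^sup>* w ((x @ [j]) @ [i])" unfolding w using u by (intro comm_steps_append) auto
      have "(comm_step X)\<^sup>*\<^sup>* (x @ [i]) u'"
        using less.hyps[of "x @ [i]" "act j v" u'] u' x' w w' len rword_props(4)[OF x'] rword_props(4)[OF u'(1)] by simp
      then have 2: "(comm_step X)\<^sup>*\<^sup>* ((x @ [i]) @ [j]) w'" unfolding w' using u' by (intro comm_steps_append) auto
      have "comm_step X (x @ [j, i] @ []) (x @ [i, j] @ [])"
        unfolding comm_step_def using rword_props(2)[OF x] u u' c by (fastforce simp: cmat_sym)
      then have "comm_step X ((x @ [j]) @ [i]) ((x @ [i]) @ [j])" by simp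
      with 1 2 show ?thesis by (meson rtranclp.rtrancl_into_rtrancl rtranclp_trans)
    qed
  qed
qed

lemma rword_cox_eq: "rword w v \<Longrightarrow> rword w' v \<Longrightarrow> w \<approx> w'"
  using comm_steps_cox_rel rword_unique rword_props(2) by blast

lemma cox_eq_app:
  "u \<approx> u' \<Longrightarrow> v \<in> lists (nodes X) \<Longrightarrow> u @ v \<approx> u' @ v"
  "u \<approx> u' \<Longrightarrow> v \<in> lists (nodes X) \<Longrightarrow> v @ u \<approx> v @ u'"
  by (auto intro: cox_rel_append cox_rel.refl)

text \<open>
  Coset enumeration: a simple reflection fixing the point of an ascending word \<open>w\<close> can be moved to
  the front of \<open>w\<close>, where it becomes an element of \<open>P\<close>.  The cases are the orbits of rank two.
\<close>

lemma rword_fixed: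
  "rword w v \<Longrightarrow> i \<in> nodes X \<Longrightarrow> act i v = v \<Longrightarrow>
    \<exists>p\<in>lists (nodes X - {omitted X}). w @ [i] \<approx> p @ w"
proof (induction "length w" arbitrary: w v i rule: less_induct)
  case less
  note v = rword_props[OF less.prems(1)]
  note i = less.prems(2)
  have lists_sub: "p \<in> lists (nodes X)" if "p \<in> lists (nodes X - {omitted X})" for p
    using that by (auto simp: lists_eq_set)
  show ?case
  proof (cases w rule: rev_cases)
    case Nil
    then have "v = base" using less.prems by (simp add: rword_Nil_iff)
    then have "i \<noteq> omitted X" using less.prems rk_omitted rk_base by auto
    then show ?thesis using Nil i by (intro bexI[of _ "[i]"]) (auto intro: cox_rel.refl)
  next
    case (snoc u j)
    let ?x = "act j v"
    note u = rword_snocD[OF less.prems(1)[unfolded snoc]]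
    have j: "j \<in> nodes X" by (rule u)
    have x: "?x \<in> Om" using v j act_Om by simp
    have jx: "act j ?x = v" using v j act_act by simp
    have ij: "i \<noteq> j" using u less.prems by auto
    have ul: "u \<in> lists (nodes X)" using rword_props(2)[OF u(1)] .
    consider (two) "cmat X i j = 2" | (three) "cmat X i j = 3" | (four) "cmat X i j = 4"
      using cmat_cases[OF ij, of X] by blast
    then show ?thesis
    proof cases
      case two
      have "rk (act i ?x) = rk ?x"
        using rk_commute[of v j i] two v i j less.prems by (simp add: cmat_sym)
      then have "act i ?x = ?x" using rk_eq_iff x i by simp
      then obtain p where p: "p \<in> lists (nodes X - {omitted X})" "u @ [i] \<approx> p @ u"
        using less.hyps[of u ?x i] snoc u i by auto
      have "w @ [i] \<approx> u @ [i, j]"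
        using cox_eq_app(2)[OF braid_word(1)[OF j i] ul] two snoc by (simp add: cmat_sym)
      also have "u @ [i, j] \<approx> p @ w"
        using cox_eq_app(1)[OF p(2), of "[j]"] j snoc by simp
      finally show ?thesis using p by blast
    next
      case three
      let ?t = "act i ?x"
      \<comment> \<open>the orbit is a chain below \<open>v\<close>, with descents \<open>j\<close> and then \<open>i\<close> to a point fixed by \<open>j\<close>; so \<open>w\<close> may end in \<open>i\<close>, \<open>j\<close>\<close>
      have br: "act j (act i (act j (act i (act j (act i v))))) = v"
        using act_braid[OF v(1) i j ij] three by (simp add: eval_nat_numeral)
      have "?t \<noteq> ?x"
      proof
        assume "?t = ?x"
        then have "?x = v" using br less.prems jx by simp
        then show False using u(3) by simp
      qed
      moreover have "\<not> rk ?x < rk ?t"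
        using asc_asc[of ?x i j] x i j ij jx u three by auto
      ultimately have tx: "rk ?t < rk ?x" using moved_cases x i by blast
      then obtain y where y: "rword (y @ [i]) ?x" using rword_descent u i by blast
      have t: "?t \<in> Om" using x i act_Om by simp
      have "act j (act i (act j ?t)) = v" using br less.prems by simp
      then have "act i (act j ?t) = ?x" using act_eqD[of j] i j t act_Om by blast
      then have "act j ?t = ?t" using act_eqD[of i] i j t act_Om by blast
      then obtain p where p: "p \<in> lists (nodes X - {omitted X})" "y @ [j] \<approx> p @ y"
        using less.hyps[of y ?t j] rword_snocD(1)[OF y] j snoc
          rword_props(4)[OF y] rword_props(4)[OF u(1)] by auto
      have yl: "y \<in> lists (nodes X)" using rword_props(2)[OF y] by simp
      have wy: "w \<approx> y @ [i, j]"
        using cox_eq_app(1)[OF rword_cox_eq[OF u(1) y], of "[j]"] j snoc by simp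
      have "w @ [i] \<approx> y @ [i, j, i]" using cox_eq_app(1)[OF wy, of "[i]"] i by simp
      also have "y @ [i, j, i] \<approx> y @ [j, i, j]" by (rule cox_eq_app(2)[OF braid_word(2)[OF i j three] yl])
      also have "y @ [j, i, j] \<approx> p @ y @ [i, j]" using cox_eq_app(1)[OF p(2), of "[i, j]"] i j by simp
      also have "p @ y @ [i, j] \<approx> p @ w" using cox_eq_app(2)[OF cox_rel.sym[OF wy]] lists_sub[OF p(1)] by simp
      finally show ?thesis using p by blast
    next
      case four
      let ?t = "act i ?x"
      let ?s = "act j ?t"
      \<comment> \<open>the orbit is a chain below \<open>v\<close>, with descents \<open>j\<close>, \<open>i\<close>, \<open>j\<close> to a point fixed by \<open>i\<close>\<close>
      have br: "act j (act i (act j (act i (act j (act i (act j (act i v))))))) = v"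
        using act_braid[OF v(1) i j ij] four by (simp add: eval_nat_numeral)
      have "?t \<noteq> ?x" using act_four[OF x i j four] jx less.prems(3) u(3) by (metis order_less_irrefl)
      moreover have "\<not> rk ?x < rk ?t"
        using asc_asc[of ?x i j] x i j ij jx u four by auto
      ultimately have tx: "rk ?t < rk ?x" using moved_cases x i by blast
      then obtain y where y: "rword (y @ [i]) ?x" using rword_descent u i by blast
      have t: "?t \<in> Om" using x i act_Om by simp
      have it: "act i ?t = ?x" using x i act_act by simp
      have "?s \<noteq> ?t"
      proof
        assume "?s = ?t"
        then have "?x = v" using br less.prems jx it by simp
        then show False using u(3) by simp
      qed
      moreover have "\<not> rk ?t < rk ?s"
        using asc_asc[of ?t i j] t i j ij it tx four by auto
      ultimately have st: "rk ?s < rk ?t" using moved_cases t j by blast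
      then obtain z where z: "rword (z @ [j]) ?t" using rword_descent rword_snocD(1)[OF y] j by blast
      have s: "?s \<in> Om" using t j act_Om by simp
      have "act j (act i (act j (act i ?s))) = v" using br less.prems by simp
      then have "act i (act j (act i ?s)) = ?x" using act_eqD[of j] i j s act_Om by blast
      then have "act j (act i ?s) = ?t" using act_eqD[of i] i j s act_Om by blast
      then have "act i ?s = ?s" using act_eqD[of j] i j s act_Om by blast
      then obtain p where p: "p \<in> lists (nodes X - {omitted X})" "z @ [i] \<approx> p @ z"
        using less.hyps[of z ?s i] rword_snocD(1)[OF z] i snoc
          rword_props(4)[OF y] rword_props(4)[OF z] rword_props(4)[OF rword_snocD(1)[OF y]]
          rword_props(4)[OF u(1)] by auto
      have zl: "z \<in> lists (nodes X)" using rword_props(2)[OF z] by simp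
      have "w \<approx> y @ [i, j]"
        using cox_eq_app(1)[OF rword_cox_eq[OF u(1) y], of "[j]"] j snoc by simp
      also have "y @ [i, j] \<approx> (z @ [j]) @ [i, j]"
        by (rule cox_eq_app(1)[OF rword_cox_eq[OF rword_snocD(1)[OF y] z]]) (use i j in simp)
      finally have wz: "w \<approx> z @ [j, i, j]" by simp
      have "w @ [i] \<approx> z @ [j, i, j, i]" using cox_eq_app(1)[OF wz, of "[i]"] i by simp
      also have "z @ [j, i, j, i] \<approx> z @ [i, j, i, j]"
        using cox_eq_app(2)[OF braid_word(3)[OF j i] zl] four by (simp add: cmat_sym)
      also have "z @ [i, j, i, j] \<approx> p @ z @ [j, i, j]" using cox_eq_app(1)[OF p(2), of "[j, i, j]"] i j by simp
      also have "p @ z @ [j, i, j] \<approx> p @ w" using cox_eq_app(2)[OF cox_rel.sym[OF wz]] lists_sub[OF p(1)] by simp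
      finally show ?thesis using p by blast
    qed
  qed
qed

end

lemma parabolic_words: "parabolic X = elt_of X ` lists (nodes X - {omitted X})"
proof (intro equalityI subsetI)
  fix x assume "x \<in> parabolic X"
  then show "x \<in> elt_of X ` lists (nodes X - {omitted X})"
    unfolding parabolic_def
  proof (induction rule: generate.induct)
    case one
    show ?case by (rule image_eqI[where x = "[]"]) (auto simp: one_WG)
  next
    case (incl h)
    then show ?case by (auto simp: gen_def)
  next
    case (inv h)
    then show ?case by (auto simp: gen_def inv_WG)
  next
    case (eng h1 h2)
    then obtain u v where *: "u \<in> lists (nodes X - {omitted X})" "v \<in> lists (nodes X - {omitted X})"
      "h1 = elt_of X u" "h2 = elt_of X v" by blast
    then have "h1 \<otimes>\<^bsub>WG X\<^esub> h2 = elt_of X (u @ v)"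
      by (auto simp: lists_eq_set intro!: mult_WG)
    then show ?case using * by (auto simp: lists_eq_set)
  qed
next
  fix x assume "x \<in> elt_of X ` lists (nodes X - {omitted X})"
  then obtain p where p: "p \<in> lists (nodes X - {omitted X})" "x = elt_of X p" by blast
  from p(1) have "elt_of X p \<in> parabolic X"
  proof (induction p)
    case Nil
    show ?case unfolding parabolic_def by (metis one_WG generate.one)
  next
    case (Cons i p)
    then have "elt_of X (i # p) = gen X i \<otimes>\<^bsub>WG X\<^esub> elt_of X p"
      using mult_WG[of "[i]" X p] by (auto simp: lists_eq_set gen_def)
    then show ?case
      using Cons unfolding parabolic_def by (auto intro!: generate.eng[OF generate.incl])
  qed
  then show "x \<in> parabolic X" using p by simp
qed

context cox_model
begin

definition phi :: "'a \<Rightarrow> elt" where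
  "phi v = elt_of X (SOME w. rword w v)"

lemma phi_rword: "rword w v \<Longrightarrow> elt_of X w = phi v"
  unfolding phi_def
  using someI[of "\<lambda>w. rword w v" w] rword_cox_eq rword_props(2) elt_of_eq_iff by metis

lemma mem_phi:
  assumes "v \<in> orb" "w \<in> phi v"
  shows "w \<in> lists (nodes X)" "run base w = v" "elt_of X w = phi v"
proof -
  obtain u where u: "rword u v" using assms by (auto simp: orb_def)
  then have uw: "u \<approx> w" using assms phi_rword[OF u] by (metis mem_elt_of)
  then show wl: "w \<in> lists (nodes X)" by (meson cox_rel_lists)
  show "run base w = v" using run_cox_rel[OF uw base_Om] rword_props[OF u] by simp
  show "elt_of X w = phi v" using uw wl rword_props(2)[OF u] phi_rword[OF u] by (metis elt_of_eq_iff)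
qed

lemma phi_nonempty: "v \<in> orb \<Longrightarrow> \<exists>w. w \<in> phi v"
  by (auto simp: orb_def) (metis phi_rword rword_props(2) self_mem_elt_of)

lemma phi_inj: "u \<in> orb \<Longrightarrow> v \<in> orb \<Longrightarrow> phi u = phi v \<longleftrightarrow> u = v"
  by (metis mem_phi(2) phi_nonempty)

lemma phi_base: "phi base = empty_elt X"
  using phi_rword[OF rword_Nil] by (simp add: one_WG)

lemma phi_carrier: "v \<in> orb \<Longrightarrow> phi v \<in> carrier (WG X)"
  by (auto simp: orb_def) (metis phi_rword rword_props(2) elt_of_in_carrier)

lemma rk_act_le: "v \<in> Om \<Longrightarrow> i \<in> nodes X \<Longrightarrow> rk (act i v) \<le> rk v + 1"
  using rk_act[of v i] by (cases "act i v = v") auto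

lemma rk_run_le: "w \<in> lists (nodes X) \<Longrightarrow> rk (run base w) \<le> real (length w)"
proof (induction w rule: rev_induct)
  case (snoc i w)
  then show ?case using rk_act_le[OF run_Om[OF base_Om], of w i] by (auto simp: lists_eq_set)
qed (simp add: rk_base)

lemma rword_if_geodesic:
  "w \<in> lists (nodes X) \<Longrightarrow> rk (run base w) = real (length w) \<Longrightarrow> rword w (run base w)"
proof (induction w rule: rev_induct)
  case (snoc i w)
  then have *: "w \<in> lists (nodes X)" "i \<in> nodes X" by (auto simp: lists_eq_set)
  have "rk (run base w) = real (length w)"
    using rk_act_le[OF run_Om[OF base_Om *(1)] *(2)] rk_run_le[OF *(1)] snoc.prems by simp
  then have "rword w (run base w)" using snoc.IH * by simp
  then show ?case using rword_snoc[of w "run base w" i] * snoc.prems \<open>rk (run base w) = _\<close> by simp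
qed (simp add: rword_Nil)

lemma rk_le_length: "w \<in> x \<Longrightarrow> v \<in> orb \<Longrightarrow> x = phi v \<Longrightarrow> rk v \<le> real (length w)"
  using rk_run_le mem_phi by metis

lemma cox_len_phi:
  assumes "v \<in> orb" shows "real (cox_len (phi v)) = rk v"
proof -
  obtain w where w: "rword w v" using assms by (auto simp: orb_def)
  have "w \<in> phi v" using phi_rword[OF w] rword_props(2)[OF w] self_mem_elt_of by metis
  then have "real (cox_len (phi v)) \<le> rk v" using cox_len_le[of w "phi v"] rword_props(4)[OF w] by simp
  moreover obtain u where "u \<in> phi v" "length u = cox_len (phi v)"
    using cox_len_attained[OF \<open>w \<in> phi v\<close>] by blast
  ultimately show ?thesis using rk_le_length[of u "phi v" v] assms by simp
qed

lemma run_parabolic: "p \<in> lists (nodes X - {omitted X}) \<Longrightarrow> run base p = base"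
  by (induction p) (auto simp: act_base)

lemma word_coset:
  "w \<in> lists (nodes X) \<Longrightarrow>
    \<exists>p\<in>lists (nodes X - {omitted X}). \<exists>u. rword u (run base w) \<and> w \<approx> p @ u"
proof (induction w rule: rev_induct)
  case Nil
  then show ?case using rword_Nil by (intro bexI[of _ "[]"] exI[of _ "[]"]) (auto intro: cox_rel.refl)
next
  case (snoc i w)
  let ?x = "run base w"
  have wi: "w \<in> lists (nodes X)" "i \<in> nodes X" using snoc.prems by (auto simp: lists_eq_set)
  obtain p u where p: "p \<in> lists (nodes X - {omitted X})" and u: "rword u ?x" and wpu: "w \<approx> p @ u"
    using snoc.IH wi by blast
  have pl: "p \<in> lists (nodes X)" using p by (auto simp: lists_eq_set)
  have x: "?x \<in> Om" using rword_props(1)[OF u] .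
  have wi': "w @ [i] \<approx> p @ u @ [i]" using cox_eq_app(1)[OF wpu, of "[i]"] wi by simp
  consider "act i ?x = ?x" | "rk ?x < rk (act i ?x)" | "rk (act i ?x) < rk ?x"
    using moved_cases[OF x wi(2)] by blast
  then show ?case
  proof cases
    case 1
    then obtain p' where p': "p' \<in> lists (nodes X - {omitted X})" "u @ [i] \<approx> p' @ u"
      using rword_fixed[OF u wi(2)] by blast
    have "w @ [i] \<approx> (p @ p') @ u"
      using cox_rel.trans[OF wi' cox_eq_app(2)[OF p'(2) pl]] by simp
    moreover have "p @ p' \<in> lists (nodes X - {omitted X})" using p p' by simp
    moreover have "rword u (run base (w @ [i]))" using 1 u by simp
    ultimately show ?thesis by blast
  next
    case 2
    then show ?thesis using rword_snoc[OF u wi(2)] wi' p by auto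
  next
    case 3
    then obtain y where y: "rword (y @ [i]) ?x" using rword_descent u wi by blast
    have yl: "y \<in> lists (nodes X)" using rword_props(2)[OF y] by simp
    have "p @ u @ [i] \<approx> p @ (y @ [i]) @ [i]"
      using cox_eq_app(2)[OF cox_eq_app(1)[OF rword_cox_eq[OF u y], of "[i]"] pl] wi by simp
    also have "p @ (y @ [i]) @ [i] \<approx> p @ y @ []"
      using cox_eq_app(2)[OF cox_eq_app(2)[OF cox_rel_cancel[OF wi(2)] yl] pl] by simp
    finally have "w @ [i] \<approx> p @ y" using cox_eq_trans[OF wi'] by simp
    then show ?thesis using rword_snocD(1)[OF y] p by auto
  qed
qed

text \<open>
  Each coset of \<open>P\<close> has exactly one element whose length is the rank of its point.
\<close>

lemma PW_eq: "PW X = phi ` orb"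
proof (intro equalityI subsetI)
  fix x assume x: "x \<in> PW X"
  then have "x \<in> carrier (WG X)" by (simp add: PW_def)
  then obtain w where w: "w \<in> lists (nodes X)" "x = elt_of X w" by (auto simp: carrier_WG)
  let ?v = "run base w"
  obtain p u where p: "p \<in> lists (nodes X - {omitted X})" and u: "rword u ?v" and wpu: "w \<approx> p @ u"
    using word_coset[OF w(1)] by blast
  have pl: "p \<in> lists (nodes X)" and pr: "rev p \<in> lists (nodes X)" using p by (auto simp: lists_eq_set)
  note ul = rword_props(2)[OF u]
  have "x = elt_of X (p @ u)" using wpu w pl ul by (auto simp: elt_of_eq_iff)
  then have "elt_of X (rev p) \<otimes>\<^bsub>WG X\<^esub> x = elt_of X (rev p @ p @ u)"
    using pl pr ul by (simp add: mult_WG)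
  also have "\<dots> = elt_of X u"
    using cox_eq_app(1)[OF rev_cancel[OF pl] ul] pl pr ul by (simp add: elt_of_eq_iff)
  finally have "elt_of X u = elt_of X (rev p) \<otimes>\<^bsub>WG X\<^esub> x" by (rule HOL.sym)
  moreover have "rev p \<in> lists (nodes X - {omitted X})" using p by (auto simp: lists_eq_set)
  ultimately have "elt_of X u \<in> parabolic X #>\<^bsub>WG X\<^esub> x"
    unfolding r_coset_def parabolic_words by blast
  then have "cox_len x \<le> cox_len (elt_of X u)" using x by (simp add: PW_def)
  also have "\<dots> \<le> length u" using cox_len_le self_mem_elt_of ul by blast
  finally have le: "cox_len x \<le> length u" .
  obtain w' where w': "w' \<in> x" "length w' = cox_len x"
    using cox_len_attained[of w x] self_mem_elt_of w by blast
  then have ww': "w \<approx> w'" using w by (simp add: mem_elt_of)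
  then have w'l: "w' \<in> lists (nodes X)" and v': "run base w' = ?v"
    using cox_rel_lists run_cox_rel[OF ww' base_Om] by auto
  have "rk ?v = real (length w')"
    using rk_run_le[OF w'l] v' le w' rword_props(4)[OF u] by simp
  then have "rword w' ?v" using rword_if_geodesic[OF w'l] v' by simp
  then have "elt_of X w' = phi ?v" "?v \<in> orb" using phi_rword rword_props by auto
  moreover have "x = elt_of X w'" using ww' w w'l by (simp add: elt_of_eq_iff)
  ultimately show "x \<in> phi ` orb" by blast
next
  fix x assume "x \<in> phi ` orb"
  then obtain v u where v: "v \<in> orb" "x = phi v" and u: "rword u v" by (auto simp: orb_def)
  note ul = rword_props(2)[OF u]
  have "cox_len x \<le> cox_len y" if "y \<in> parabolic X #>\<^bsub>WG X\<^esub> x" for y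
  proof -
    obtain p where p: "p \<in> lists (nodes X - {omitted X})" "y = elt_of X p \<otimes>\<^bsub>WG X\<^esub> x"
      using \<open>y \<in> _\<close> by (auto simp: r_coset_def parabolic_words)
    have pl: "p \<in> lists (nodes X)" using p by (auto simp: lists_eq_set)
    have y: "y = elt_of X (p @ u)" using p pl ul v phi_rword[OF u] by (simp add: mult_WG[symmetric])
    obtain w where w: "w \<in> y" "length w = cox_len y"
      using cox_len_attained[of "p @ u" y] self_mem_elt_of[of "p @ u" X] y pl ul by auto
    have puw: "p @ u \<approx> w" using w y by (simp add: mem_elt_of)
    then have "run base w = v"
      using run_cox_rel[OF puw base_Om] run_parabolic[OF p(1)] rword_props(3)[OF u] by simp
    then have "rk v \<le> real (length w)" using rk_run_le[of w] cox_rel_lists[OF puw] by simp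
    then show ?thesis using w(2) cox_len_phi[OF v(1)] v(2) by simp
  qed
  then show "x \<in> PW X" using v phi_carrier by (simp add: PW_def)
qed

lemma phi_PW: "v \<in> orb \<Longrightarrow> phi v \<in> PW X"
  by (simp add: PW_eq)

lemma rmul_phi:
  assumes "v \<in> orb" "i \<in> nodes X" "act i v \<noteq> v"
  shows "rmul X (phi v) i = phi (act i v)"
proof -
  obtain w where w: "rword w v" using assms by (auto simp: orb_def)
  note wl = rword_props(2)[OF w]
  have r: "rmul X (phi v) i = elt_of X (w @ [i])"
    using rmul_elt_of[OF wl assms(2)] phi_rword[OF w] by simp
  show ?thesis
  proof (cases "rk v < rk (act i v)")
    case True
    then show ?thesis using phi_rword[OF rword_snoc[OF w assms(2)]] r by simp
  next
    case False
    then obtain y where y: "rword (y @ [i]) v"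
      using rword_descent[OF w assms(2)] moved_cases[of v i] rword_props(1)[OF w] assms by blast
    have yl: "y \<in> lists (nodes X)" using rword_props(2)[OF y] by simp
    have "w @ [i] \<approx> y @ [i, i]" using cox_eq_app(1)[OF rword_cox_eq[OF w y], of "[i]"] assms by simp
    also have "y @ [i, i] \<approx> y" using cox_eq_app(2)[OF cox_rel_cancel[OF assms(2)] yl] by simp
    finally have "elt_of X (w @ [i]) = elt_of X y" using wl yl assms by (simp add: elt_of_eq_iff)
    then show ?thesis using r phi_rword[OF rword_snocD(1)[OF y]] by simp
  qed
qed

text \<open>
  If \<open>i\<close> fixes \<open>v\<close>, then \<open>rmul X (phi v) i\<close> lies in the coset of \<open>phi v\<close>, so being minimal it would
  have to equal \<open>phi v\<close>; but all relations preserve the parity of the length.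
\<close>

lemma rmul_phi_PW:
  assumes "v \<in> orb" "i \<in> nodes X"
  shows "rmul X (phi v) i \<in> PW X \<longleftrightarrow> act i v \<noteq> v"
proof
  assume "rmul X (phi v) i \<in> PW X"
  then obtain u where u: "u \<in> orb" "rmul X (phi v) i = phi u" by (auto simp: PW_eq)
  obtain w where w: "rword w v" using assms by (auto simp: orb_def)
  note wl = rword_props(2)[OF w]
  have r: "phi u = elt_of X (w @ [i])"
    using rmul_elt_of[OF wl assms(2)] phi_rword[OF w] u by simp
  then have "w @ [i] \<in> phi u" using self_mem_elt_of[of "w @ [i]" X] wl assms by simp
  then have "run base (w @ [i]) = u" by (rule mem_phi(2)[OF u(1)])
  then have "u = act i v" using rword_props(3)[OF w] by simp
  show "act i v \<noteq> v"
  proof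
    assume "act i v = v"
    then have "elt_of X (w @ [i]) = elt_of X w" using r phi_rword[OF w] \<open>u = act i v\<close> by simp
    then have "w @ [i] \<approx> w" using wl assms by (simp add: elt_of_eq_iff)
    then show False using cox_rel_parity by fastforce
  qed
next
  assume "act i v \<noteq> v"
  then show "rmul X (phi v) i \<in> PW X" using rmul_phi assms act_orb phi_PW by simp
qed

lemma reduced_word_iff:
  assumes "v \<in> orb"
  shows "reduced_word X (phi v) w \<longleftrightarrow> rword w v"
proof
  assume w: "reduced_word X (phi v) w"
  then have wl: "w \<in> lists (nodes X)" and "elt_of X w = phi v" and len: "length w = cox_len (phi v)"
    by (auto simp: reduced_word_def)
  then have "w \<in> phi v" using self_mem_elt_of by blast
  then have "run base w = v" using mem_phi assms by blast
  then show "rword w v" using rword_if_geodesic[OF wl] cox_len_phi[OF assms] len by simp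
next
  assume "rword w v"
  then show "reduced_word X (phi v) w"
    using phi_rword rword_props[of w v] cox_len_phi[OF assms] by (auto simp: reduced_word_def)
qed

lemma cox_len_phi_less:
  "u \<in> orb \<Longrightarrow> v \<in> orb \<Longrightarrow> cox_len (phi u) < cox_len (phi v) \<longleftrightarrow> rk u < rk v"
  using cox_len_phi[of u] cox_len_phi[of v] by linarith

lemma bruhat_less_phi:
  assumes "v \<in> orb" "i \<in> nodes X" "act i v \<noteq> v"
  shows "bruhat_less X (phi v) (rmul X (phi v) i) \<longleftrightarrow> rk v < rk (act i v)"
proof
  assume "bruhat_less X (phi v) (rmul X (phi v) i)"
  from bruhat_less_len[OF this] show "rk v < rk (act i v)"
    using assms by (simp add: rmul_phi cox_len_phi_less act_orb)
next
  assume "rk v < rk (act i v)"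
  then show "bruhat_less X (phi v) (rmul X (phi v) i)"
    using assms by (intro bruhat_less_rmul phi_carrier) (simp_all add: rmul_phi cox_len_phi_less act_orb)
qed

text \<open>
  The weak order suffices to control supports; it is contained in the Bruhat order.
\<close>

inductive wle :: "'a \<Rightarrow> 'a \<Rightarrow> bool" where
  wle_refl: "v \<in> orb \<Longrightarrow> wle v v"
| wle_step: "v \<in> orb \<Longrightarrow> i \<in> nodes X \<Longrightarrow> rk v < rk (act i v) \<Longrightarrow> wle (act i v) u \<Longrightarrow> wle v u"

lemma wle_orb: "wle u v \<Longrightarrow> u \<in> orb \<and> v \<in> orb"
  by (induction rule: wle.induct) auto

lemma wle_trans: "wle u v \<Longrightarrow> wle v x \<Longrightarrow> wle u x"
  by (induction rule: wle.induct) (auto intro: wle_step)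

lemma wle_one: "v \<in> orb \<Longrightarrow> i \<in> nodes X \<Longrightarrow> rk v < rk (act i v) \<Longrightarrow> wle v (act i v)"
  by (rule wle_step) (auto intro: wle_refl act_orb)

lemma wle_rk: "wle u v \<Longrightarrow> rk u \<le> rk v \<and> (rk u = rk v \<longrightarrow> u = v)"
  by (induction rule: wle.induct) auto

lemma wle_bruhat: "wle u v \<Longrightarrow> u = v \<or> bruhat_less X (phi u) (phi v)"
proof (induction rule: wle.induct)
  case (wle_step v i u)
  have "act i v \<noteq> v" using wle_step by auto
  then have "bruhat_less X (phi v) (phi (act i v))"
    using bruhat_less_phi[of v i] wle_step rmul_phi[of v i] by simp
  then show ?case using wle_step bruhat_less_trans by metis
qed auto

text \<open>
  The lifting property, for the weak order: since two ascents of a point commute, an ascent of the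
  smaller point can be carried along the chain.
\<close>

lemma wle_lift:
  "wle u v \<Longrightarrow> i \<in> nodes X \<Longrightarrow> rk u < rk (act i u) \<Longrightarrow> rk v < rk (act i v) \<Longrightarrow> wle (act i u) (act i v)"
proof (induction rule: wle.induct)
  case (wle_step u j v)
  show ?case
  proof (cases "i = j")
    case True
    then show ?thesis using wle_step wle_orb wle_one wle_trans by metis
  next
    case False
    have u: "u \<in> Om" using wle_step orb_Om by blast
    have c: "cmat X i j = 2" using asc_asc[of u i j] wle_step u False by simp
    have "rk (act j u) < rk (act i (act j u))" using rk_commute[of u j i] u wle_step c by (simp add: cmat_sym)
    then have "wle (act i (act j u)) (act i v)" using wle_step by simp
    then have "wle (act j (act i u)) (act i v)" using act_commute[of u i j] u wle_step c by simp
    moreover have "rk (act i u) < rk (act j (act i u))" using rk_commute[of u i j] u wle_step c by simp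
    ultimately show ?thesis using wle.wle_step[of "act i u" j] wle_step act_orb by blast
  qed
qed (auto intro: wle_refl act_orb)

end

section \<open>Sums over paths\<close>

lemma qpow_mult: "qpow a * qpow b = qpow (a + b)"
  by (simp add: qpow_def mult_single)

lemma qpow_0: "qpow 0 = 1"
  by (simp add: qpow_def)

lemma lookup_sum_qpow:
  "finite A \<Longrightarrow> Poly_Mapping.lookup (\<Sum>T\<in>A. qpow (d T)) k = int (card {T\<in>A. d T = k})"
  by (simp add: lookup_sum qpow_def lookup_single when_def sum.If_cases)
    (rule arg_cong[where f = card], auto)

lemma sum_qpow_eq_0:
  assumes "finite A" "(\<Sum>T\<in>A. qpow (d T)) = 0" shows "A = {}"
proof -
  have "int (card {T\<in>A. d T = k}) = 0" for k
    using lookup_sum_qpow[OF assms(1), of d k] assms(2) by simp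
  then show ?thesis using assms(1) by (auto simp: card_eq_0_iff)
qed

lemma sum_qpow_eq_qpow:
  assumes "finite A" "(\<Sum>T\<in>A. qpow (d T)) = qpow e" shows "\<exists>T. A = {T} \<and> d T = e"
proof -
  have *: "int (card {T\<in>A. d T = k}) = (if k = e then 1 else 0)" for k
    using lookup_sum_qpow[OF assms(1), of d k] assms(2) by (auto simp: qpow_def lookup_single when_def)
  then have "card {T\<in>A. d T = e} = 1" by (metis of_nat_eq_1_iff)
  then obtain T where T: "{T\<in>A. d T = e} = {T}" by (auto simp: card_1_singleton_iff)
  have "d S = e" if "S \<in> A" for S
    using *[of "d S"] that assms(1) by (auto simp: card_eq_0_iff split: if_splits)
  with T show ?thesis by blast
qed

lemma cas_snoc:
  "pre_digraph.cas G u (p @ [e]) v \<longleftrightarrow> pre_digraph.cas G u p (tail G e) \<and> head G e = v"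
  by (induction p arbitrary: u) (auto simp: pre_digraph.cas.simps)

lemma Path_Nil: "empty_elt X \<in> PW X \<Longrightarrow> Path X x [] = (if x = empty_elt X then {[]} else {})"
  by (auto simp: Path_def path_weight_def pre_digraph.awalk_def pre_digraph.cas.simps path_graph_def)

lemma Path_snoc:
  "Path X x (w @ [i]) = {T @ [(y, i, x)] |T y. T \<in> Path X y w \<and>
     y \<in> PW X \<and> i \<in> nodes X \<and> rmul X y i \<in> PW X \<and> x \<in> {y, rmul X y i}}" (is "?L = ?R")
proof (intro equalityI subsetI)
  fix T assume T: "T \<in> ?L"
  then have "map (\<lambda>(x, i, y). i) T = w @ [i]" by (simp add: Path_def path_weight_def)
  then obtain T' e where "T = T' @ [e]" by (cases T rule: rev_cases) auto
  then show "T \<in> ?R" using T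
    by (cases e) (auto simp: Path_def path_weight_def pre_digraph.awalk_def path_graph_def cas_snoc)
next
  fix T assume "T \<in> ?R"
  then show "T \<in> ?L"
    by (auto simp: Path_def path_weight_def pre_digraph.awalk_def path_graph_def cas_snoc)
qed

lemma path_deg_snoc: "path_deg X (T @ [e]) = path_deg X T + edge_deg X e"
  by (simp add: path_deg_def)

context cox_model
begin

lemma Path_phi_snoc:
  assumes "v \<in> orb" "i \<in> nodes X"
  shows "Path X (phi v) (w @ [i]) = (if act i v = v then {} else
     (\<lambda>T. T @ [(phi v, i, phi v)]) ` Path X (phi v) w \<union>
     (\<lambda>T. T @ [(phi (act i v), i, phi v)]) ` Path X (phi (act i v)) w)" (is "_ = ?R")
proof (intro equalityI subsetI)
  fix S assume "S \<in> Path X (phi v) (w @ [i])"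
  then obtain T y where T: "S = T @ [(y, i, phi v)]" "T \<in> Path X y w" "y \<in> PW X" "rmul X y i \<in> PW X"
    "phi v = y \<or> phi v = rmul X y i" by (auto simp: Path_snoc)
  then obtain u where u: "u \<in> orb" "y = phi u" by (auto simp: PW_eq)
  then have ui: "act i u \<noteq> u" "rmul X y i = phi (act i u)" using T rmul_phi_PW rmul_phi assms by auto
  then have "v = u \<or> v = act i u" using T u assms phi_inj act_orb by metis
  then show "S \<in> ?R"
  proof
    assume "v = act i u"
    then have "act i v = u" using u assms orb_Om act_act by simp
    then show ?thesis using T u ui \<open>v = act i u\<close> by auto
  qed (use T u ui in auto)
next
  fix S assume S: "S \<in> ?R"
  then have ne: "act i v \<noteq> v" by (auto split: if_splits)
  have "act i (act i v) = v" using assms orb_Om act_act by simp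
  then have "rmul X (phi v) i \<in> PW X" "rmul X (phi (act i v)) i = phi v"
    using ne assms rmul_phi_PW[of v i] rmul_phi[of "act i v" i] act_orb[of v i] by auto
  then show "S \<in> Path X (phi v) (w @ [i])"
    using S assms ne act_orb phi_PW by (auto simp: Path_snoc)
qed

text \<open>
  The weight of the loop labelled \<open>i\<close> at a point.
\<close>

definition updown :: "nat \<Rightarrow> 'a \<Rightarrow> laurent" where
  "updown i v = (if rk v < rk (act i v) then qpow 1 else qpow (- 1))"

text \<open>
  Functions on points stand for formal sums of points, and \<open>opE i\<close> is the right action of \<open>E\<^sub>i\<close> on the
  anti-spherical module, seen in degrees only: the value at \<open>v\<close> collects the loop at \<open>v\<close> and the edge
  from the other point of its orbit.
\<close>

definition opE :: "nat \<Rightarrow> ('a \<Rightarrow> laurent) \<Rightarrow> 'a \<Rightarrow> laurent" where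
  "opE i f v = (if v \<in> orb \<and> act i v \<noteq> v then updown i v * f v + f (act i v) else 0)"

definition word_sum :: "nat list \<Rightarrow> 'a \<Rightarrow> laurent" where
  "word_sum w = foldl (\<lambda>f i. opE i f) (\<lambda>x. if x = base then 1 else 0) w"

lemma word_sum_snoc: "word_sum (w @ [i]) = opE i (word_sum w)"
  by (simp add: word_sum_def)

lemma word_sum_Nil: "word_sum [] x = (if x = base then 1 else 0)"
  by (simp add: word_sum_def)

lemma Path_sum:
  "w \<in> lists (nodes X) \<Longrightarrow> v \<in> orb \<Longrightarrow>
    finite (Path X (phi v) w) \<and> (\<Sum>T\<in>Path X (phi v) w. qpow (path_deg X T)) = word_sum w v"
proof (induction w arbitrary: v rule: rev_induct)
  case Nil
  have "empty_elt X \<in> PW X" using phi_PW[OF base_orb] phi_base by simp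
  then show ?case using Nil phi_inj[OF Nil(2) base_orb] phi_base
    by (auto simp: Path_Nil word_sum_Nil path_deg_def qpow_0)
next
  case (snoc i w)
  have w: "w \<in> lists (nodes X)" "i \<in> nodes X" using snoc.prems by (auto simp: lists_eq_set)
  let ?u = "act i v"
  let ?f = "\<lambda>T. T @ [(phi v, i, phi v)]" and ?g = "\<lambda>T. T @ [(phi ?u, i, phi v)]"
  show ?case
  proof (cases "?u = v")
    case True
    then show ?thesis using Path_phi_snoc[OF snoc.prems(2) w(2)] by (simp add: word_sum_snoc opE_def)
  next
    case False
    have u: "?u \<in> orb" using snoc.prems w act_orb by simp
    have ne: "phi ?u \<noteq> phi v" using False phi_inj u snoc.prems by simp
    note IHv = snoc.IH[OF w(1) snoc.prems(2)] and IHu = snoc.IH[OF w(1) u]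
    have P: "Path X (phi v) (w @ [i]) = ?f ` Path X (phi v) w \<union> ?g ` Path X (phi ?u) w"
      using Path_phi_snoc[OF snoc.prems(2) w(2)] False by simp
    have disj: "?f ` Path X (phi v) w \<inter> ?g ` Path X (phi ?u) w = {}" using ne by auto
    have dv: "qpow (path_deg X (?f T)) = updown i v * qpow (path_deg X T)" for T
      using bruhat_less_phi[OF snoc.prems(2) w(2) False]
      by (simp add: path_deg_snoc updown_def qpow_mult add.commute)
    have du: "qpow (path_deg X (?g T)) = qpow (path_deg X T)" for T
      using ne by (simp add: path_deg_snoc)
    have "(\<Sum>T\<in>Path X (phi v) (w @ [i]). qpow (path_deg X T)) =
      (\<Sum>T\<in>Path X (phi v) w. qpow (path_deg X (?f T))) + (\<Sum>T\<in>Path X (phi ?u) w. qpow (path_deg X (?g T)))"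
      unfolding P using IHv IHu disj
      by (subst sum.union_disjoint) (auto simp: sum.reindex inj_on_def)
    also have "\<dots> = updown i v * word_sum w v + word_sum w ?u"
      using IHv IHu by (simp only: dv du sum_distrib_left[symmetric])
    also have "\<dots> = word_sum (w @ [i]) v" using False snoc.prems by (simp add: word_sum_snoc opE_def)
    finally show ?thesis using P IHv IHu by simp
  qed
qed

lemma opE_commute:
  assumes "i \<in> nodes X" "j \<in> nodes X" "cmat X i j = 2"
  shows "opE i (opE j f) = opE j (opE i f)"
proof
  fix v
  show "opE i (opE j f) v = opE j (opE i f) v"
  proof (cases "v \<in> orb")
    case True
    then have v: "v \<in> Om" "act i v \<in> Om" "act j v \<in> Om" "act i v \<in> orb" "act j v \<in> orb"
      using orb_Om act_Om act_orb assms by auto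
    have r: "rk (act j (act i v)) - rk (act i v) = rk (act j v) - rk v"
      "rk (act i (act j v)) - rk (act j v) = rk (act i v) - rk v"
      using rk_commute[of v i j] rk_commute[of v j i] v assms by (simp_all add: cmat_sym)
    have m: "act j (act i v) = act i v \<longleftrightarrow> act j v = v" "act i (act j v) = act j v \<longleftrightarrow> act i v = v"
      using r rk_eq_iff v assms by (smt (verit))+
    have d: "updown j (act i v) = updown j v" "updown i (act j v) = updown i v"
      using r by (auto simp: updown_def)
    have c: "act i (act j v) = act j (act i v)" by (rule act_commute) (use v assms in simp_all)
    show ?thesis
      using v m d c True by (simp add: opE_def algebra_simps)
  qed (simp add: opE_def)
qed

lemma word_sum_comm_steps: "(comm_step X)\<^sup>*\<^sup>* w w' \<Longrightarrow> word_sum w = word_sum w'"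
proof (induction rule: rtranclp_induct)
  case (step y z)
  then obtain a b i j where *: "y = a @ [i, j] @ b" "z = a @ [j, i] @ b" "i \<in> nodes X" "j \<in> nodes X" "cmat X i j = 2"
    unfolding comm_step_def by auto
  then have "word_sum y = word_sum z" using opE_commute[of i j] by (simp add: word_sum_def)
  then show ?case using step by simp
qed simp

text \<open>
  The subword property, for the weak order: a path can leave out ascents, and a descent of a smaller
  point, or its ascent by \<open>wle_lift\<close>, stays below \<open>act i v\<close>.
\<close>

lemma word_sum_support: "rword w v \<Longrightarrow> word_sum w x \<noteq> 0 \<Longrightarrow> wle x v"
proof (induction arbitrary: x rule: rword.induct)
  case rword_Nil
  then show ?case by (auto simp: word_sum_Nil base_orb intro: wle_refl split: if_splits)
next
  case (rword_snoc w v i)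
  have v: "v \<in> orb" using rword_snoc rword_props by blast
  have up: "wle v (act i v)" using wle_one v rword_snoc by blast
  have x: "x \<in> orb" "act i x \<noteq> x" "word_sum w x \<noteq> 0 \<or> word_sum w (act i x) \<noteq> 0"
    using rword_snoc.prems by (auto simp: word_sum_snoc opE_def split: if_splits)
  have xx: "act i (act i x) = x" using x orb_Om act_act rword_snoc by simp
  from x(3) show ?case
  proof
    assume "word_sum w x \<noteq> 0"
    then show ?thesis using rword_snoc up wle_trans by blast
  next
    assume "word_sum w (act i x) \<noteq> 0"
    then have le: "wle (act i x) v" using rword_snoc by blast
    consider "rk x < rk (act i x)" | "rk (act i x) < rk x"
      using moved_cases[of x i] x orb_Om rword_snoc by blast
    then show ?thesis
    proof cases
      case 1
      then show ?thesis using wle_one[of x i] x rword_snoc le up wle_trans by blast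
    next
      case 2
      then show ?thesis using wle_lift[OF le, of i] rword_snoc xx by simp
    qed
  qed
qed

lemma word_sum_above: "rword w v \<Longrightarrow> rk v \<le> rk x \<Longrightarrow> x \<noteq> v \<Longrightarrow> word_sum w x = 0"
  using word_sum_support[of w v x] wle_rk[of x v] by fastforce

lemma word_sum_top: "rword w v \<Longrightarrow> word_sum w v = 1"
proof (induction rule: rword.induct)
  case (rword_snoc w v i)
  have v: "v \<in> orb" "v \<in> Om" using rword_snoc rword_props by auto
  have "word_sum w (act i v) = 0" using word_sum_above[of w v "act i v"] rword_snoc by fastforce
  then show ?case using rword_snoc v act_orb act_act by (auto simp: word_sum_snoc opE_def)
qed (simp add: word_sum_Nil)

end

section \<open>Kazhdan-Lusztig polynomials\<close>

lemma lookup_qpow_mult: "Poly_Mapping.lookup (qpow e * f) d = Poly_Mapping.lookup f (d - e)"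
proof (induction f rule: update_induct)
  case (update f a b)
  have "Poly_Mapping.update a b f = f + Poly_Mapping.single a b"
    using update by (intro poly_mapping_eqI) (auto simp: lookup_update lookup_add lookup_single when_def in_keys_iff)
  then show ?case
    using update by (auto simp: distrib_left lookup_add qpow_def mult_single lookup_single when_def)
qed simp

abbreviation qbar :: laurent where
  "qbar \<equiv> qpow 1 + qpow (- 1)"

lemma sym_laurent_cases:
  assumes "p \<in> sym_laurent" obtains c where "p = poly (map_poly of_int c) qbar"
  using assms by (auto simp: sym_laurent_def)

lemma sym_laurentI: "poly (map_poly of_int c) qbar \<in> sym_laurent"
  by (auto simp: sym_laurent_def)

lemma map_poly_of_int_add:
  "map_poly of_int (p + q) = (map_poly of_int p + map_poly of_int q :: laurent poly)"
  by (rule poly_eqI) (simp add: coeff_map_poly)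

lemma map_poly_of_int_mult:
  "map_poly of_int (p * q) = (map_poly of_int p * map_poly of_int q :: laurent poly)"
  by (induction p) (simp_all add: map_poly_of_int_add map_poly_smult map_poly_pCons)

lemma sym_laurent_add: "p \<in> sym_laurent \<Longrightarrow> r \<in> sym_laurent \<Longrightarrow> p + r \<in> sym_laurent"
  by (metis sym_laurent_cases sym_laurentI map_poly_of_int_add poly_add)

lemma sym_laurent_mult: "p \<in> sym_laurent \<Longrightarrow> r \<in> sym_laurent \<Longrightarrow> p * r \<in> sym_laurent"
  by (metis sym_laurent_cases sym_laurentI map_poly_of_int_mult poly_mult)

lemma sym_laurent_of_int: "of_int a \<in> sym_laurent"
  using sym_laurentI[of "[:a:]"] by (simp add: map_poly_pCons)

lemma sym_laurent_0: "0 \<in> sym_laurent" and sym_laurent_1: "1 \<in> sym_laurent"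
  using sym_laurent_of_int[of 0] sym_laurent_of_int[of 1] by simp_all

lemma sym_laurent_qbar: "qbar \<in> sym_laurent"
  using sym_laurentI[of "[:0, 1:]"] by (simp add: map_poly_pCons)

lemma sym_laurent_diff: "p \<in> sym_laurent \<Longrightarrow> r \<in> sym_laurent \<Longrightarrow> p - r \<in> sym_laurent"
  using sym_laurent_add[of p "of_int (- 1) * r"] sym_laurent_mult[OF sym_laurent_of_int[of "- 1"], of r]
  by simp

lemma sym_laurent_symmetric:
  "p \<in> sym_laurent \<Longrightarrow> Poly_Mapping.lookup p (- d) = Poly_Mapping.lookup p d"
proof -
  have "Poly_Mapping.lookup (poly (map_poly of_int c) qbar) (- d) =
    Poly_Mapping.lookup (poly (map_poly of_int c) qbar :: laurent) d" for c :: "int poly"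
  proof (induction c arbitrary: d)
    case (pCons a c)
    have "Poly_Mapping.lookup (poly (map_poly of_int c) qbar) (- d + 1) =
        Poly_Mapping.lookup (poly (map_poly of_int c) qbar :: laurent) (d - 1)"
      "Poly_Mapping.lookup (poly (map_poly of_int c) qbar) (- d - 1) =
        Poly_Mapping.lookup (poly (map_poly of_int c) qbar :: laurent) (d + 1)"
      using pCons.IH[of "d - 1"] pCons.IH[of "d + 1"] by simp_all
    then show ?case
      by (simp add: map_poly_pCons lookup_add distrib_right lookup_qpow_mult lookup_of_int when_def)
  qed simp
  then show "p \<in> sym_laurent \<Longrightarrow> Poly_Mapping.lookup p (- d) = Poly_Mapping.lookup p d"
    by (auto elim: sym_laurent_cases)
qed

text \<open>
  The uniqueness of Kazhdan-Lusztig polynomials rests on this: the coefficients of \<open>q\<^sup>d\<close> and \<open>q\<^sup>-\<^sup>d\<close>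
  agree, and one of them belongs to a degree at most zero.
\<close>

lemma sym_q_ideal:
  assumes "p \<in> sym_laurent" "p \<in> q_ideal" shows "p = 0"
proof (rule poly_mapping_eqI)
  fix d
  have *: "Poly_Mapping.lookup p e = 0" if "e < 1" for e
    using assms(2) that by (force simp: q_ideal_def in_keys_iff)
  show "Poly_Mapping.lookup p d = Poly_Mapping.lookup 0 d"
    using *[of d] *[of "- d"] sym_laurent_symmetric[OF assms(1), of d] by (cases "d < 1") auto
qed

lemma q_ideal_diff: "p \<in> q_ideal \<Longrightarrow> r \<in> q_ideal \<Longrightarrow> p - r \<in> q_ideal"
  using keys_diff[of p r] by (auto simp: q_ideal_def)

lemma ex_reduced_word:
  assumes "y \<in> carrier (WG X)" shows "\<exists>w. reduced_word X y w"
proof -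
  obtain u where u: "u \<in> lists (nodes X)" "y = elt_of X u" using assms by (auto simp: carrier_WG)
  then obtain w where w: "w \<in> y" "length w = cox_len y"
    using cox_len_attained[of u y] self_mem_elt_of by blast
  then have uw: "(u, w) \<in> cox_rel (nodes X) (cmat X)" using u by (simp add: mem_elt_of)
  then have "w \<in> lists (nodes X)" using cox_rel_lists by blast
  moreover have "elt_of X w = y" using uw u calculation by (simp add: elt_of_eq_iff cox_rel.sym)
  ultimately show ?thesis using w by (auto simp: reduced_word_def)
qed

lemma PW_carrier: "x \<in> PW X \<Longrightarrow> x \<in> carrier (WG X)"
  by (simp add: PW_def)

text \<open>
  By induction on the difference of the lengths, two solutions have the same right-hand side, hence
  their difference is both symmetric and in \<open>q\<int>[q]\<close>.
\<close>

lemma kl_recursion_unique: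
  assumes "kl_recursion X n b" "kl_recursion X n' b'"
  shows "x \<in> PW X \<Longrightarrow> y \<in> PW X \<Longrightarrow> reduced_word X y w \<Longrightarrow> n x y = n' x y \<and> b x w = b' x w"
proof (induction "cox_len y - cox_len x" arbitrary: x y w rule: less_induct)
  case less
  note r = assms(1)[unfolded kl_recursion_def, rule_format, OF less.prems]
    assms(2)[unfolded kl_recursion_def, rule_format, OF less.prems]
  show ?case
  proof (cases "x = y")
    case True
    then show ?thesis using r by simp
  next
    case False
    have "n x z * b z w = n' x z * b' z w"
      if z: "z \<in> PW X" "bruhat_less X x z" "bruhat_less X z y" for z
    proof -
      have l: "cox_len x < cox_len z" "cox_len z < cox_len y" using z bruhat_less_len by auto
      obtain u where u: "reduced_word X z u" using ex_reduced_word[OF PW_carrier[OF z(1)]] by blast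
      have "n x z = n' x z" using less.hyps[of z x u] z l u less.prems by simp
      moreover have "b z w = b' z w" using less.hyps[of y z w] z l less.prems by simp
      ultimately show ?thesis by simp
    qed
    then have "(\<Sum>z | z \<in> PW X \<and> bruhat_less X x z \<and> bruhat_less X z y. n x z * b z w) =
      (\<Sum>z | z \<in> PW X \<and> bruhat_less X x z \<and> bruhat_less X z y. n' x z * b' z w)"
      by (intro sum.cong) auto
    then have eq: "b x w + n x y = b' x w + n' x y" using r False by simp
    have "b x w - b' x w = n' x y - n x y" using eq by (simp add: algebra_simps)
    moreover have "b x w - b' x w \<in> sym_laurent" "n' x y - n x y \<in> q_ideal"
      using r False sym_laurent_diff q_ideal_diff by auto
    ultimately have "b x w - b' x w = 0" using sym_q_ideal[of "b x w - b' x w"] by metis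
    then show ?thesis using eq by simp
  qed
qed

lemma kl_poly_eqI:
  assumes "kl_recursion X n b" "\<And>x y. x \<notin> PW X \<or> y \<notin> PW X \<Longrightarrow> n x y = 0"
  shows "kl_poly X = n"
  unfolding kl_poly_def
proof (rule the_equality)
  show "(\<exists>b. kl_recursion X n b) \<and> (\<forall>x y. x \<notin> PW X \<or> y \<notin> PW X \<longrightarrow> n x y = 0)" using assms by blast
next
  fix n' assume n': "(\<exists>b. kl_recursion X n' b) \<and> (\<forall>x y. x \<notin> PW X \<or> y \<notin> PW X \<longrightarrow> n' x y = 0)"
  show "n' = n"
  proof (intro ext)
    fix x y
    show "n' x y = n x y"
    proof (cases "x \<in> PW X \<and> y \<in> PW X")
      case True
      then obtain w where "reduced_word X y w" using ex_reduced_word PW_carrier by blast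
      then show ?thesis using n' True kl_recursion_unique[OF _ assms(1)] by blast
    qed (use n' assms in auto)
  qed
qed

context cox_model
begin

text \<open>
  A family \<open>g\<close> that is unitriangular with off-diagonal entries in \<open>q\<int>[q]\<close>, and in which the sums over
  paths expand with coefficients in \<open>\<int>[q + q\<^sup>-\<^sup>1]\<close>, solves the defining recursion, which has only one
  solution.  Maximality in the weak order shows that the expansion of an ascending word of \<open>v\<close> only
  involves points below \<open>v\<close>.
\<close>

lemma kl_poly_model:
  fixes g :: "'a \<Rightarrow> 'a \<Rightarrow> laurent"
  assumes g_diag: "\<And>v. v \<in> orb \<Longrightarrow> g v v = 1"
    and g_q: "\<And>v x. v \<in> orb \<Longrightarrow> x \<in> orb \<Longrightarrow> x \<noteq> v \<Longrightarrow> g v x \<in> q_ideal"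
    and g_supp: "\<And>v x. v \<in> orb \<Longrightarrow> x \<in> orb \<Longrightarrow> g v x \<noteq> 0 \<Longrightarrow> wle x v"
    and expand: "\<And>w v. rword w v \<Longrightarrow>
      \<exists>c. (\<forall>z\<in>orb. c z \<in> sym_laurent) \<and> (\<forall>x\<in>orb. word_sum w x = (\<Sum>z\<in>orb. c z * g z x))"
    and xv: "x0 \<in> orb" "v0 \<in> orb"
  shows "kl_poly X (phi x0) (phi v0) = g v0 x0"
proof -
  define pt where "pt = the_inv_into orb phi"
  have inj: "inj_on phi orb" by (auto simp: inj_on_def phi_inj)
  have pt: "pt (phi v) = v" if "v \<in> orb" for v
    unfolding pt_def by (rule the_inv_into_f_f[OF inj that])
  define c where "c w = (SOME c. (\<forall>z\<in>orb. c z \<in> sym_laurent) \<and> (\<forall>x\<in>orb. word_sum w x = (\<Sum>z\<in>orb. c z * g z x)))" for w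
  have c: "(\<forall>z\<in>orb. c w z \<in> sym_laurent) \<and> (\<forall>x\<in>orb. word_sum w x = (\<Sum>z\<in>orb. c w z * g z x))" if "rword w v" for w v
    unfolding c_def using someI_ex[OF expand[OF that]] .
  \<comment> \<open>at a maximal point outside the weak interval below \<open>v\<close> only one term of the expansion survives\<close>
  have c_supp: "wle z v" if w: "rword w v" and z: "z \<in> orb" "c w z \<noteq> 0" for w v z
  proof (rule ccontr)
    assume "\<not> wle z v"
    let ?A = "{z\<in>orb. c w z \<noteq> 0 \<and> \<not> wle z v}"
    have A: "finite ?A" "?A \<noteq> {}" using finite_orb z \<open>\<not> wle z v\<close> by auto
    obtain y where y: "y \<in> ?A" and max: "Max (rk ` ?A) = rk y" by (rule obtains_MAX[OF A, of rk])
    have "c w u * g u y = 0" if u: "u \<in> orb" "u \<noteq> y" for u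
    proof (rule ccontr)
      assume "c w u * g u y \<noteq> 0"
      then have ne: "c w u \<noteq> 0" "g u y \<noteq> 0" by auto
      then have yu: "wle y u" using g_supp y u by blast
      then have "\<not> wle u v" using y wle_trans by blast
      then have "rk u \<le> rk y" using Max_ge[of "rk ` ?A" "rk u"] A(1) max u ne by auto
      then show False using wle_rk[OF yu] u by auto
    qed
    then have "(\<Sum>u\<in>orb. c w u * g u y) = (\<Sum>u\<in>{y}. c w u * g u y)"
      using y finite_orb by (intro sum.mono_neutral_right) auto
    then have "word_sum w y = c w y" using c[OF w] y g_diag by simp
    then show False using word_sum_support[OF w, of y] y by auto
  qed
  have c_top: "c w v = 1" if w: "rword w v" for w v
  proof -
    have v: "v \<in> orb" using w rword_props by blast
    have "c w u * g u v = 0" if u: "u \<in> orb" "u \<noteq> v" for u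
    proof (rule ccontr)
      assume "c w u * g u v \<noteq> 0"
      then have "wle u v" "wle v u" using c_supp[OF w] g_supp u v by auto
      then show False using wle_rk[of u v] wle_rk[of v u] u by linarith
    qed
    then have "(\<Sum>u\<in>orb. c w u * g u v) = (\<Sum>u\<in>{v}. c w u * g u v)"
      using v finite_orb by (intro sum.mono_neutral_right) auto
    then show ?thesis using c[OF w] v g_diag word_sum_top[OF w] by simp
  qed
  define n where "n a b = (if a \<in> PW X \<and> b \<in> PW X then g (pt b) (pt a) else 0)" for a b
  define b where "b a w = c w (pt a)" for a w
  have "kl_recursion X n b"
    unfolding kl_recursion_def
  proof (intro ballI allI impI)
    fix a d w assume "a \<in> PW X" "d \<in> PW X" and red: "reduced_word X d w"
    then obtain x v where xv: "x \<in> orb" "a = phi x" "v \<in> orb" "d = phi v" by (auto simp: PW_eq)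
    then have w: "rword w v" using red reduced_word_iff by simp
    note cw = c[OF w]
    have n: "n (phi x) (phi y) = g y x" if "x \<in> orb" "y \<in> orb" for x y
      using that by (simp add: n_def phi_PW pt)
    have b: "b (phi x) w = c w x" if "x \<in> orb" for x using that by (simp add: b_def pt)
    show "if a = d then n a d = 1 \<and> b a w = 1
       else b a w \<in> sym_laurent \<and> n a d \<in> q_ideal \<and>
         b a w + n a d = (\<Sum>T\<in>Path X a w. qpow (path_deg X T)) -
           (\<Sum>z | z \<in> PW X \<and> bruhat_less X a z \<and> bruhat_less X z d. n a z * b z w)"
    proof (cases "x = v")
      case True
      then show ?thesis using xv n b g_diag c_top[OF w] by simp
    next
      case False
      then have ad: "a \<noteq> d" using xv phi_inj by simp
      let ?Z = "{z\<in>orb. bruhat_less X (phi x) (phi z) \<and> bruhat_less X (phi z) (phi v)}"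
      have xvZ: "x \<notin> ?Z" "v \<notin> ?Z" using bruhat_less_len by blast+
      have "c w z * g z x = 0" if z: "z \<in> orb" "z \<notin> insert x (insert v ?Z)" for z
      proof (rule ccontr)
        assume "c w z * g z x \<noteq> 0"
        then have "wle z v" "wle x z" using c_supp[OF w] g_supp z xv by auto
        then show False using wle_bruhat z by blast
      qed
      then have "(\<Sum>z\<in>orb. c w z * g z x) = (\<Sum>z\<in>insert x (insert v ?Z). c w z * g z x)"
        using xv finite_orb by (intro sum.mono_neutral_right) auto
      also have "\<dots> = c w x * g x x + (c w v * g v x + (\<Sum>z\<in>?Z. c w z * g z x))"
        using xvZ False finite_orb by simp
      also have "\<dots> = c w x + (g v x + (\<Sum>z\<in>?Z. g z x * c w z))"
        using g_diag xv c_top[OF w] by (simp add: mult.commute)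
      finally have F: "word_sum w x = c w x + (g v x + (\<Sum>z\<in>?Z. g z x * c w z))" using cw xv by simp
      have "{z. z \<in> PW X \<and> bruhat_less X a z \<and> bruhat_less X z d} = phi ` ?Z"
        using xv by (auto simp: PW_eq)
      moreover have "inj_on phi ?Z" using inj by (rule inj_on_subset) auto
      ultimately have "(\<Sum>z | z \<in> PW X \<and> bruhat_less X a z \<and> bruhat_less X z d. n a z * b z w) =
         (\<Sum>z\<in>?Z. n a (phi z) * b (phi z) w)" by (simp add: sum.reindex)
      also have "\<dots> = (\<Sum>z\<in>?Z. g z x * c w z)" using xv n b by (intro sum.cong) auto
      finally have S: "(\<Sum>z | z \<in> PW X \<and> bruhat_less X a z \<and> bruhat_less X z d. n a z * b z w) =
         (\<Sum>z\<in>?Z. g z x * c w z)" .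
      have P: "(\<Sum>T\<in>Path X a w. qpow (path_deg X T)) = word_sum w x"
        using Path_sum[of w x] rword_props(2)[OF w] xv by simp
      show ?thesis using ad S P F cw xv n b g_q False by simp
    qed
  qed
  then have "kl_poly X = n" by (rule kl_poly_eqI) (auto simp: n_def)
  then show ?thesis using xv by (simp add: n_def phi_PW pt)
qed

end

section \<open>Graded bases of rank at most one\<close>

text \<open>
  The claim for a single pair, with the reduced words \<open>rw\<close>; the families of pairs are treated
  separately.
\<close>

definition standard_bases :: "hs_pair \<Rightarrow> (elt \<Rightarrow> nat list) \<Rightarrow> bool" where
  "standard_bases X rw \<longleftrightarrow> (\<forall>x\<in>PW X. \<forall>y\<in>PW X.
    (\<exists>B. homogeneous_basis (kl_poly X x y) (NPath X x (rw y)) (path_deg X)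
           (\<lambda>T. B (path_elt X T))) \<and>
    kl_poly X x y = (\<Sum>T\<in>NPath X x (rw y). qpow (path_deg X T)) \<and>
    (\<forall>w. reduced_word X y w \<longrightarrow>
      path_elt X ` NPath X x w = path_elt X ` NPath X x (rw y)))"

lemma module_frag: "module (frag_cmul :: int \<Rightarrow> ('a \<Rightarrow>\<^sub>0 int) \<Rightarrow> _)"
  by unfold_locales (simp_all add: frag_cmul_distrib frag_cmul_distrib2)

lemma graded_gens_qpow: "graded_gens (qpow d) = {(d, 0)}"
  by (auto simp: graded_gens_def qpow_def lookup_single when_def split: if_splits)

lemma homogeneous_basis_single:
  "homogeneous_basis (qpow (deg T)) {T} deg (\<lambda>_. Poly_Mapping.single (deg T, 0) 1)"
proof -
  interpret module "frag_cmul :: int \<Rightarrow> ((int \<times> nat) \<Rightarrow>\<^sub>0 int) \<Rightarrow> _" by (rule module_frag)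
  let ?e = "Poly_Mapping.single (deg T, 0 :: nat) (1 :: int)"
  have e: "frag_cmul k ?e = Poly_Mapping.single (deg T, 0) k" for k
    by (rule poly_mapping_eqI) (simp add: lookup_single when_def)
  have "\<not> dependent {?e}"
  proof
    assume "dependent {?e}"
    then obtain t u where t: "t \<subseteq> {?e}" "(\<Sum>v\<in>t. frag_cmul (u v) v) = 0" "\<exists>v\<in>t. u v \<noteq> (0 :: int)"
      by (auto simp: dependent_explicit)
    then have "t = {?e}" by blast
    then have "Poly_Mapping.single (deg T, 0 :: nat) (u ?e) = 0" "u ?e \<noteq> 0" using t e by auto
    then show False by (metis lookup_single_eq lookup_zero)
  qed
  moreover have "span {?e} = graded_free (qpow (deg T))"
  proof (intro equalityI subsetI)
    fix f assume "f \<in> span {?e}"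
    then show "f \<in> graded_free (qpow (deg T))"
      by (auto simp: span_singleton graded_free_def graded_gens_qpow e in_keys_iff lookup_single when_def split: if_splits)
  next
    fix f assume f: "f \<in> graded_free (qpow (deg T))"
    have "f = frag_cmul (Poly_Mapping.lookup f (deg T, 0)) ?e"
      unfolding e
    proof (rule poly_mapping_eqI)
      fix k
      show "Poly_Mapping.lookup f k = Poly_Mapping.lookup (Poly_Mapping.single (deg T, 0) (Poly_Mapping.lookup f (deg T, 0))) k"
        using f by (cases "k = (deg T, 0)")
          (auto simp: graded_free_def graded_gens_qpow lookup_single when_def in_keys_iff)
    qed
    then show "f \<in> span {?e}" by (auto simp: span_singleton)
  qed
  moreover have "?e \<in> graded_part (qpow (deg T)) (deg T)"
    by (auto simp: graded_part_def graded_free_def graded_gens_qpow)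
  ultimately show ?thesis by (simp add: homogeneous_basis_def)
qed

lemma homogeneous_basis_empty: "homogeneous_basis 0 {} deg B"
proof -
  interpret module "frag_cmul :: int \<Rightarrow> ((int \<times> nat) \<Rightarrow>\<^sub>0 int) \<Rightarrow> _" by (rule module_frag)
  have "graded_gens 0 = {}" by (auto simp: graded_gens_def)
  then have "graded_free 0 = {0}" by (auto simp: graded_free_def)
  then show ?thesis by (simp add: homogeneous_basis_def independent_empty span_empty)
qed

section \<open>Commutations in the oriented Temperley-Lieb algebra\<close>

lemma mem_free_algebra:
  "f \<in> carrier (free_algebra X) \<longleftrightarrow> (\<forall>w\<in>Poly_Mapping.keys f. set (letters w) \<subseteq> tl_gens X)"
  by (simp add: free_algebra_def)

lemma free_algebra_simps:
  "f \<otimes>\<^bsub>free_algebra X\<^esub> g = f * g" "f \<oplus>\<^bsub>free_algebra X\<^esub> g = f + g"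
  "\<one>\<^bsub>free_algebra X\<^esub> = 1" "\<zero>\<^bsub>free_algebra X\<^esub> = 0"
  by (simp_all add: free_algebra_def)

lemma free_algebra_closed:
  "f \<in> carrier (free_algebra X) \<Longrightarrow> g \<in> carrier (free_algebra X) \<Longrightarrow> f + g \<in> carrier (free_algebra X)"
  "f \<in> carrier (free_algebra X) \<Longrightarrow> g \<in> carrier (free_algebra X) \<Longrightarrow> f - g \<in> carrier (free_algebra X)"
  "f \<in> carrier (free_algebra X) \<Longrightarrow> - f \<in> carrier (free_algebra X)"
  "0 \<in> carrier (free_algebra X)"
  using keys_add[of f g] keys_diff[of f g] by (auto simp: mem_free_algebra)

lemma free_algebra_mult_closed:
  assumes "f \<in> carrier (free_algebra X)" "g \<in> carrier (free_algebra X)"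
  shows "f * g \<in> carrier (free_algebra X)"
  unfolding mem_free_algebra
proof
  fix w assume "w \<in> Poly_Mapping.keys (f * g)"
  then obtain a b where "w = a + b" "a \<in> Poly_Mapping.keys f" "b \<in> Poly_Mapping.keys g"
    using keys_mult[of f g] by auto
  then show "set (letters w) \<subseteq> tl_gens X"
    using assms by (auto simp: mem_free_algebra plus_tl_word_def)
qed

lemma one_eq_mon: "1 = mon []"
  unfolding mon_def zero_tl_word_def[symmetric] by simp

lemma mon_closed: "set gs \<subseteq> tl_gens X \<Longrightarrow> mon gs \<in> carrier (free_algebra X)"
  by (auto simp: mem_free_algebra mon_def split: if_splits)

lemma mon_mult: "mon gs * mon hs = mon (gs @ hs)"
  by (simp add: mon_def mult_single plus_tl_word_def)

lemma sum_closed: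
  "(\<And>x. x \<in> A \<Longrightarrow> f x \<in> carrier (free_algebra X)) \<Longrightarrow> sum f A \<in> carrier (free_algebra X)"
  by (induction A rule: infinite_finite_induct) (auto intro: free_algebra_closed)

lemma one_closed: "1 \<in> carrier (free_algebra X)"
  unfolding one_eq_mon by (rule mon_closed) simp

lemma ring_free_algebra: "ring (free_algebra X)"
proof (rule ringI)
  show "abelian_group (free_algebra X)"
  proof (rule abelian_groupI)
    fix f assume "f \<in> carrier (free_algebra X)"
    then show "\<exists>g\<in>carrier (free_algebra X). g \<oplus>\<^bsub>free_algebra X\<^esub> f = \<zero>\<^bsub>free_algebra X\<^esub>"
      by (intro bexI[of _ "- f"]) (auto simp: free_algebra_simps intro: free_algebra_closed)
  qed (auto simp: free_algebra_simps algebra_simps intro: free_algebra_closed)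
  show "monoid (free_algebra X)"
    by (rule monoidI)
      (auto simp: free_algebra_simps mult.assoc intro: free_algebra_mult_closed one_closed)
qed (auto simp: free_algebra_simps algebra_simps)

lemma tl_gens_simps [simp]: "IGen x \<in> tl_gens X \<longleftrightarrow> x \<in> PW X" "EGen i \<in> tl_gens X \<longleftrightarrow> i \<in> nodes X"
  by (auto simp: tl_gens_def)

lemma scal_closed: "f \<in> carrier (free_algebra X) \<Longrightarrow> scal c f \<in> carrier (free_algebra X)"
  unfolding scal_def
  by (intro free_algebra_mult_closed) (auto simp: mem_free_algebra zero_tl_word_def split: if_splits)

lemma tl_rels_closed:
  "tl_rels_idem X \<union> tl_rels_quad X \<union> tl_rels_braid X \<subseteq> carrier (free_algebra X)"
proof -
  have "tl_rels_idem X \<subseteq> carrier (free_algebra X)"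
    unfolding tl_rels_idem_def one_eq_mon
    by (auto intro!: free_algebra_closed sum_closed mon_closed)
  moreover have "tl_rels_quad X \<subseteq> carrier (free_algebra X)"
    unfolding tl_rels_quad_def
    by (auto intro!: free_algebra_closed scal_closed mon_closed)
  moreover have "tl_rels_braid X \<subseteq> carrier (free_algebra X)"
    unfolding tl_rels_braid_def
    by (auto intro!: free_algebra_closed mon_closed)
  ultimately show ?thesis by blast
qed

lemma tl_ideal: "ideal (tl_ideal X) (free_algebra X)"
  unfolding tl_ideal_def by (rule ring.genideal_ideal[OF ring_free_algebra tl_rels_closed])

lemma tl_rels_in_ideal: "tl_rels_idem X \<union> tl_rels_quad X \<union> tl_rels_braid X \<subseteq> tl_ideal X"
  unfolding tl_ideal_def by (rule ring.genideal_self[OF ring_free_algebra tl_rels_closed])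

lemma tl_ideal_closed:
  "f \<in> tl_ideal X \<Longrightarrow> g \<in> tl_ideal X \<Longrightarrow> f + g \<in> tl_ideal X"
  "f \<in> tl_ideal X \<Longrightarrow> g \<in> carrier (free_algebra X) \<Longrightarrow> g * f \<in> tl_ideal X"
  "f \<in> tl_ideal X \<Longrightarrow> g \<in> carrier (free_algebra X) \<Longrightarrow> f * g \<in> tl_ideal X"
  "0 \<in> tl_ideal X"
  using additive_subgroup.a_closed[OF ideal.axioms(1)[OF tl_ideal], of f X g]
    ideal.I_l_closed[OF tl_ideal, of f X g] ideal.I_r_closed[OF tl_ideal, of f X g]
    additive_subgroup.zero_closed[OF ideal.axioms(1)[OF tl_ideal], of X]
  by (simp_all add: free_algebra_simps)

lemma tl_class_eqI:
  assumes "f \<in> carrier (free_algebra X)" "g \<in> carrier (free_algebra X)" "f - g \<in> tl_ideal X"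
  shows "tl_class X f = tl_class X g"
proof -
  interpret ring "free_algebra X" by (rule ring_free_algebra)
  have "\<ominus>\<^bsub>free_algebra X\<^esub> g = - g"
    using assms by (intro minus_equality) (auto simp: free_algebra_simps intro: free_algebra_closed)
  then have "f \<ominus>\<^bsub>free_algebra X\<^esub> g = f - g" by (simp add: a_minus_def free_algebra_simps)
  then show ?thesis
    unfolding tl_class_def using quotient_eq_iff_same_a_r_cos[OF tl_ideal assms(1,2)] assms(3) by simp
qed

lemma tl_class_mult:
  assumes "f \<in> carrier (free_algebra X)" "g \<in> carrier (free_algebra X)"
  shows "tl_class X f \<otimes>\<^bsub>TL X\<^esub> tl_class X g = tl_class X (f * g)"
  using ring_hom_mult[OF ideal.rcos_ring_hom[OF tl_ideal] assms]
  by (simp add: TL_def tl_class_def free_algebra_simps)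

lemma tl_class_middle:
  assumes "tl_class X (mon u) = tl_class X (mon v)"
    and "set a \<subseteq> tl_gens X" "set b \<subseteq> tl_gens X" "set u \<subseteq> tl_gens X" "set v \<subseteq> tl_gens X"
  shows "tl_class X (mon (a @ u @ b)) = tl_class X (mon (a @ v @ b))"
proof -
  have "tl_class X (mon (a @ x @ b)) = tl_class X (mon a) \<otimes>\<^bsub>TL X\<^esub> tl_class X (mon x) \<otimes>\<^bsub>TL X\<^esub> tl_class X (mon b)"
    if "set x \<subseteq> tl_gens X" for x
    using that assms by (simp add: tl_class_mult mon_closed mon_mult)
  then show ?thesis using assms by simp
qed

text \<open>
  The factors of \<open>E\<^sub>T\<close> after the idempotent at the start of the path.
\<close>

definition path_letters :: "edge list \<Rightarrow> tl_gen list" where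
  "path_letters T = concat (map (\<lambda>(x, i, y). [EGen i, IGen y]) T)"

lemma path_letters_simps:
  "path_letters [] = []"
  "path_letters ((x, i, y) # T) = EGen i # IGen y # path_letters T"
  "path_letters (S @ T) = path_letters S @ path_letters T"
  by (simp_all add: path_letters_def)

lemma path_elt_from_mon:
  assumes "set gs \<subseteq> tl_gens X" "set T \<subseteq> arcs (path_graph X)"
  shows "path_elt_from X (tl_class X (mon gs)) T = tl_class X (mon (gs @ path_letters T))"
  using assms
proof (induction T arbitrary: gs)
  case (Cons e T)
  obtain x i y where e: "e = (x, i, y)" by (cases e)
  then have *: "i \<in> nodes X" "y \<in> PW X" using Cons.prems by (auto simp: path_graph_def)
  then have "tl_class X (mon gs) \<otimes>\<^bsub>TL X\<^esub> tlE X i \<otimes>\<^bsub>TL X\<^esub> one_idem X y = tl_class X (mon (gs @ [EGen i, IGen y]))"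
    using Cons.prems by (simp add: tlE_def one_idem_def tl_class_mult mon_closed mon_mult)
  then show ?case using Cons.IH[of "gs @ [EGen i, IGen y]"] Cons.prems * e by (simp add: path_letters_def)
qed (simp add: path_letters_def)

lemma path_letters_closed: "set T \<subseteq> arcs (path_graph X) \<Longrightarrow> set (path_letters T) \<subseteq> tl_gens X"
  by (fastforce simp: path_letters_def path_graph_def)

lemma cas_append:
  "pre_digraph.cas G u (p @ r) v \<longleftrightarrow> (\<exists>m. pre_digraph.cas G u p m \<and> pre_digraph.cas G m r v)"
  by (induction p arbitrary: u) (auto simp: pre_digraph.cas.simps)

text \<open>
  If only one intermediate vertex contributes, the idempotents between two generators may be
  inserted or removed, since they sum up to the unit.
\<close>

lemma tl_class_insert:
  assumes "finite (PW X)" "x \<in> PW X" "y \<in> PW X" "z \<in> PW X" "i \<in> nodes X" "j \<in> nodes X"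
    and uniq: "\<And>y'. y' \<in> PW X \<Longrightarrow> y' \<noteq> y \<Longrightarrow> y' \<notin> {x, rmul X x i} \<or> z \<notin> {y', rmul X y' j}"
  shows "tl_class X (mon [IGen x, EGen i, EGen j, IGen z]) =
    tl_class X (mon [IGen x, EGen i, IGen y, EGen j, IGen z])"
proof (rule tl_class_eqI)
  let ?f = "\<lambda>y. mon [IGen x, EGen i, IGen y, EGen j, IGen z]"
  let ?S = "(\<Sum>y\<in>PW X. mon [IGen y]) - 1"
  have zero: "?f y' \<in> tl_ideal X" if y': "y' \<in> PW X" "y' \<noteq> y" for y'
  proof -
    from uniq[OF y'] show ?thesis
    proof
      assume "y' \<notin> {x, rmul X x i}"
      then have "mon [IGen x, EGen i, IGen y'] \<in> tl_ideal X"
        using tl_rels_in_ideal[of X] assms y' unfolding tl_rels_idem_def by blast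
      then have "mon [IGen x, EGen i, IGen y'] * mon [EGen j, IGen z] \<in> tl_ideal X"
        by (rule tl_ideal_closed(3)) (simp add: mon_closed assms)
      then show ?thesis by (simp add: mon_mult)
    next
      assume "z \<notin> {y', rmul X y' j}"
      then have "mon [IGen y', EGen j, IGen z] \<in> tl_ideal X"
        using tl_rels_in_ideal[of X] assms y' unfolding tl_rels_idem_def by blast
      then have "mon [IGen x, EGen i] * mon [IGen y', EGen j, IGen z] \<in> tl_ideal X"
        by (rule tl_ideal_closed(2)) (simp add: mon_closed assms)
      then show ?thesis by (simp add: mon_mult)
    qed
  qed
  have rest: "sum ?f B \<in> tl_ideal X" if "B \<subseteq> PW X - {y}" for B
    using that by (induction B rule: infinite_finite_induct) (auto intro: tl_ideal_closed zero)
  have "?S \<in> tl_ideal X"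
    using tl_rels_in_ideal[of X] unfolding tl_rels_idem_def by blast
  then have "mon [IGen x, EGen i] * ?S * mon [EGen j, IGen z] \<in> tl_ideal X"
    by (intro tl_ideal_closed mon_closed) (use assms in auto)
  moreover have "mon [IGen x, EGen i] * ?S * mon [EGen j, IGen z]
      = sum ?f (PW X) - mon [IGen x, EGen i, EGen j, IGen z]"
    by (simp add: right_diff_distrib left_diff_distrib sum_distrib_left sum_distrib_right mon_mult)
  ultimately have "sum ?f (PW X) - mon [IGen x, EGen i, EGen j, IGen z] \<in> tl_ideal X" by simp
  then have "mon [] * (sum ?f (PW X) - mon [IGen x, EGen i, EGen j, IGen z]) * (- 1) \<in> tl_ideal X"
    by (intro tl_ideal_closed free_algebra_closed mon_closed) (auto simp: one_eq_mon intro: mon_closed)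
  then have "(mon [IGen x, EGen i, EGen j, IGen z] - sum ?f (PW X)) + sum ?f (PW X - {y}) \<in> tl_ideal X"
    by (intro tl_ideal_closed rest) (auto simp flip: one_eq_mon)
  moreover have "sum ?f (PW X) = ?f y + sum ?f (PW X - {y})"
    by (rule sum.remove) (use assms in simp_all)
  ultimately show "mon [IGen x, EGen i, EGen j, IGen z] - ?f y \<in> tl_ideal X" by simp
qed (use assms in \<open>auto intro!: mon_closed\<close>)

lemma tl_class_commute:
  assumes "i \<in> nodes X" "j \<in> nodes X" "cmat X i j = 2" "x \<in> PW X" "z \<in> PW X"
  shows "tl_class X (mon [IGen x, EGen i, EGen j, IGen z]) = tl_class X (mon [IGen x, EGen j, EGen i, IGen z])"
proof -
  have "mon [EGen i, EGen j] - mon [EGen j, EGen i] \<in> tl_ideal X"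
    using tl_rels_in_ideal[of X] assms unfolding tl_rels_braid_def by blast
  then have "tl_class X (mon [EGen i, EGen j]) = tl_class X (mon [EGen j, EGen i])"
    using assms by (intro tl_class_eqI mon_closed) auto
  from tl_class_middle[OF this, of "[IGen x]" "[IGen z]"] show ?thesis using assms by simp
qed

context cox_model
begin

lemma finite_PW: "finite (PW X)"
  using finite_orb PW_eq by simp

lemma arc_iff:
  assumes "u \<in> orb" "v \<in> orb" "i \<in> nodes X"
  shows "(phi u, i, phi v) \<in> arcs (path_graph X) \<longleftrightarrow> act i u \<noteq> u \<and> (v = u \<or> v = act i u)"
  using assms rmul_phi_PW[of u i] rmul_phi[of u i] phi_inj act_orb[of u i] phi_PW
  by (auto simp: path_graph_def)

lemma arcE:
  assumes "(x, i, y) \<in> arcs (path_graph X)"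
  obtains u v where "x = phi u" "y = phi v" "u \<in> orb" "v \<in> orb" "i \<in> nodes X"
proof -
  have "x \<in> PW X" "y \<in> PW X" "i \<in> nodes X" using assms by (auto simp: path_graph_def)
  then show ?thesis using that by (auto simp: PW_eq)
qed

text \<open>
  The orbit of a point under two commuting reflections is a product: neither reflection affects
  whether the other one moves the point, and they never agree on it.
\<close>

lemma commuting_moves:
  assumes "v \<in> orb" "i \<in> nodes X" "j \<in> nodes X" "cmat X i j = 2"
  shows "act j (act i v) = act i v \<longleftrightarrow> act j v = v"
    and "act i v \<noteq> v \<Longrightarrow> act i v \<noteq> act j v"
proof -
  have v: "v \<in> Om" "act i v \<in> Om" using assms orb_Om act_Om by auto
  note r = rk_commute[OF v(1) assms(2,3,4)]
  show "act j (act i v) = act i v \<longleftrightarrow> act j v = v"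
    using r rk_eq_iff[of v j] rk_eq_iff[of "act i v" j] v assms by auto
  show "act i v \<noteq> act j v" if "act i v \<noteq> v"
  proof
    assume e: "act i v = act j v"
    then have "act j (act i v) = v" using v assms act_act by simp
    then have "rk (act i v) = rk v" using r e by simp
    then show False using that rk_eq_iff v assms by simp
  qed
qed

text \<open>
  Under two commuting reflections the endpoints of a path of two edges determine its middle vertex.
  This is the uniqueness needed to drop the idempotent there by \<open>tl_class_insert\<close>.
\<close>

lemma contributing_vertex:
  assumes "a \<in> orb" "b \<in> orb" "c \<in> orb" "i \<in> nodes X" "j \<in> nodes X" "cmat X i j = 2"
    and "act i a \<noteq> a" "b = a \<or> b = act i a" "act j b \<noteq> b" "c = b \<or> c = act j b"
    and y': "y' \<noteq> phi b"
  shows "y' \<notin> {phi a, rmul X (phi a) i} \<or> phi c \<notin> {y', rmul X y' j}"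
proof (rule ccontr)
  have aa: "act i (act i a) = a" using assms orb_Om act_act by simp
  assume *: "\<not> ?thesis"
  then have "y' = phi a \<or> y' = phi (act i a)" using rmul_phi assms by auto
  then have b': "y' = phi (act i b)" using assms aa by auto
  have ib: "act i b \<noteq> b" using assms(7,8) aa by auto
  have bo: "act i b \<in> orb" using assms act_orb by simp
  have jb: "act j (act i b) \<noteq> act i b" using commuting_moves(1) assms by simp
  have "rmul X y' j = phi (act j (act i b))" unfolding b' using rmul_phi bo jb assms by simp
  moreover have "act j (act i b) \<in> orb" using act_orb bo assms by simp
  ultimately have "c = act i b \<or> c = act j (act i b)" using * b' phi_inj bo assms(3) by auto
  moreover have "act i b \<noteq> act j b" using commuting_moves(2)[of b i j] ib assms by simp
  moreover have "act j (act j b) = b" "act j (act j (act i b)) = act i b" using assms bo orb_Om act_act by auto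
  ultimately show False using assms(10) ib by metis
qed

text \<open>
  Around the exchanged letters, drop the idempotent of the middle vertex, commute \<open>E\<^sub>i\<close> with \<open>E\<^sub>j\<close>, and
  insert the idempotent of the opposite vertex of the square.
\<close>

lemma Path_comm_step:
  assumes "comm_step X w w'" "T \<in> Path X x w"
  shows "\<exists>T'\<in>Path X x w'. path_elt X T' = path_elt X T"
proof -
  obtain u t i j where w: "w = u @ [i, j] @ t" "w' = u @ [j, i] @ t" "cmat X i j = 2" and ij: "i \<in> nodes X" "j \<in> nodes X"
    using assms(1) unfolding comm_step_def by auto
  have T: "set T \<subseteq> arcs (path_graph X)" "pre_digraph.cas (path_graph X) (empty_elt X) T x"
    "empty_elt X \<in> PW X" "path_weight T = w"
    using assms(2) by (auto simp: Path_def pre_digraph.awalk_def path_graph_def)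
  obtain T1 e1 e2 T2 where T': "T = T1 @ [e1, e2] @ T2" "path_weight T1 = u" "path_weight T2 = t"
      "path_weight [e1] = [i]" "path_weight [e2] = [j]"
    using T(4) unfolding w path_weight_def by (auto simp: map_eq_append_conv map_eq_Cons_conv)
  then obtain p y where e1: "e1 = (p, i, y)" by (cases e1) (auto simp: path_weight_def)
  obtain y2 z where e2: "e2 = (y2, j, z)" using T' by (cases e2) (auto simp: path_weight_def)
  have cas: "pre_digraph.cas (path_graph X) (empty_elt X) T1 p" "y2 = y" "pre_digraph.cas (path_graph X) z T2 x"
    using T(2) by (auto simp: T' e1 e2 cas_append pre_digraph.cas.simps path_graph_def)
  have arcs: "(p, i, y) \<in> arcs (path_graph X)" "(y, j, z) \<in> arcs (path_graph X)"
    using T(1) T' e1 e2 cas by auto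
  obtain a b where ab: "p = phi a" "y = phi b" "a \<in> orb" "b \<in> orb" using arcE[OF arcs(1)] by metis
  obtain c where c: "z = phi c" "c \<in> orb" using arcE[OF arcs(2)] by metis
  have m: "act i a \<noteq> a" "b = a \<or> b = act i a" "act j b \<noteq> b" "c = b \<or> c = act j b"
    using arcs arc_iff[OF ab(3,4) ij(1)] arc_iff[OF ab(4) c(2) ij(2)] ab(1,2) c(1) by blast+
  have c': "cmat X j i = 2" using w by (simp add: cmat_sym)
  have ja: "act j a \<noteq> a" using m commuting_moves(1)[of a i j] ab ij w by auto
  have com: "act i (act j a) = act j (act i a)" using act_commute[of a i j] ab orb_Om ij w by simp
  define b2 where "b2 = (if c = b then a else act j a)"
  have b2: "b2 \<in> orb" "b2 = a \<or> b2 = act j a" using ab act_orb ij by (auto simp: b2_def)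
  have ib2: "act i b2 \<noteq> b2" using m commuting_moves(1)[of a j i] ab ij c' by (auto simp: b2_def)
  have cb2: "c = b2 \<or> c = act i b2" using m com by (auto simp: b2_def)
  have arcs': "(p, j, phi b2) \<in> arcs (path_graph X)" "(phi b2, i, z) \<in> arcs (path_graph X)"
    using ab c b2 ij ja ib2 cb2 by (auto simp: arc_iff)
  have PWs: "p \<in> PW X" "y \<in> PW X" "z \<in> PW X" "phi b2 \<in> PW X" using ab c b2 phi_PW by auto
  have "tl_class X (mon [IGen p, EGen i, IGen y, EGen j, IGen z]) = tl_class X (mon [IGen p, EGen i, EGen j, IGen z])"
    using contributing_vertex[of a b c i j] ab c ij w m
    by (intro tl_class_insert[symmetric] finite_PW PWs ij) auto
  also have "\<dots> = tl_class X (mon [IGen p, EGen j, EGen i, IGen z])"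
    by (intro tl_class_commute PWs ij w)
  also have "\<dots> = tl_class X (mon [IGen p, EGen j, IGen (phi b2), EGen i, IGen z])"
    using contributing_vertex[of a b2 c j i] ab c ij c' b2 ja ib2 cb2
    by (intro tl_class_insert finite_PW PWs ij) auto
  finally have eq: "tl_class X (mon [IGen p, EGen i, IGen y, EGen j, IGen z]) =
    tl_class X (mon [IGen p, EGen j, IGen (phi b2), EGen i, IGen z])" .
  let ?T' = "T1 @ [(p, j, phi b2), (phi b2, i, z)] @ T2"
  have set': "set ?T' \<subseteq> arcs (path_graph X)" using T(1) T' arcs' by auto
  have "?T' \<in> Path X x w'"
    using set' T(3) cas T' w
    by (auto simp: Path_def pre_digraph.awalk_def cas_append pre_digraph.cas.simps path_graph_def path_weight_def)
  moreover have "path_elt X ?T' = path_elt X T"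
  proof -
    \<comment> \<open>the letter of the vertex \<open>p\<close> is the last one before the exchanged pair\<close>
    have "\<exists>gs. IGen (empty_elt X) # path_letters T1 = gs @ [IGen p] \<and> set gs \<subseteq> tl_gens X"
    proof (cases T1 rule: rev_cases)
      case Nil
      then show ?thesis using cas by (auto simp: path_letters_def pre_digraph.cas.simps)
    next
      case (snoc S e)
      obtain r k s where e: "e = (r, k, s)" by (cases e)
      then have "s = p" using cas(1) snoc by (auto simp: cas_snoc path_graph_def)
      moreover have "k \<in> nodes X" using T(1) T' snoc e by (auto simp: path_graph_def)
      moreover have "set (path_letters S) \<subseteq> tl_gens X" using T(1) T' snoc by (intro path_letters_closed) auto
      ultimately show ?thesis using snoc e T(3)
        by (intro exI[of _ "IGen (empty_elt X) # path_letters S @ [EGen k]"]) (auto simp: path_letters_def)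
    qed
    then obtain gs where gs: "IGen (empty_elt X) # path_letters T1 = gs @ [IGen p]" "set gs \<subseteq> tl_gens X" by blast
    have gs': "IGen (empty_elt X) # path_letters T1 @ r = gs @ IGen p # r" for r
      using gs(1) by (metis append.assoc append_Cons append_Nil)
    have T2: "set (path_letters T2) \<subseteq> tl_gens X" using T(1) T' by (intro path_letters_closed) auto
    have "path_elt X S = tl_class X (mon (IGen (empty_elt X) # path_letters S))" if "set S \<subseteq> arcs (path_graph X)" for S
      using path_elt_from_mon[of "[IGen (empty_elt X)]" X S] that T(3) by (simp add: path_elt_def one_idem_def)
    then have "path_elt X T = tl_class X (mon (gs @ [IGen p, EGen i, IGen y, EGen j, IGen z] @ path_letters T2))"
      "path_elt X ?T' = tl_class X (mon (gs @ [IGen p, EGen j, IGen (phi b2), EGen i, IGen z] @ path_letters T2))"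
      using T(1) set' T' e1 e2 by (simp_all add: path_letters_simps gs')
    then show ?thesis
      using tl_class_middle[OF eq gs(2) T2] PWs ij by simp
  qed
  ultimately show ?thesis by blast
qed

lemma Path_elt_comm_step:
  assumes "comm_step X w w'"
  shows "path_elt X ` Path X x w \<subseteq> path_elt X ` Path X x w'"
proof (rule image_subsetI)
  fix T assume "T \<in> Path X x w"
  then obtain T' where "T' \<in> Path X x w'" "path_elt X T' = path_elt X T"
    using Path_comm_step[OF assms] by blast
  then show "path_elt X T \<in> path_elt X ` Path X x w'" using imageI[of T' _ "path_elt X"] by simp
qed

lemma Path_elt_comm_steps:
  assumes "(comm_step X)\<^sup>*\<^sup>* w w'"
  shows "path_elt X ` Path X x w = path_elt X ` Path X x w'"
  using assms
proof (induction rule: rtranclp_induct)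
  case (step y z)
  have "path_elt X ` Path X x y = path_elt X ` Path X x z"
    by (rule equalityI[OF Path_elt_comm_step[OF step(2)] Path_elt_comm_step[OF comm_step_sym[OF step(2)]]])
  then show ?case using step by simp
qed simp

text \<open>
  Everything is reduced to sums over paths: a monomial value forces exactly one path, a vanishing
  one none, so that both claims about standard elements follow from the one for the polynomials.
\<close>

lemma standard_bases_if_monomial:
  fixes g :: "'a \<Rightarrow> 'a \<Rightarrow> laurent"
  assumes kl: "\<And>x v. x \<in> orb \<Longrightarrow> v \<in> orb \<Longrightarrow> kl_poly X (phi x) (phi v) = g v x"
    and mono: "\<And>x v. x \<in> orb \<Longrightarrow> v \<in> orb \<Longrightarrow> g v x = 0 \<or> (\<exists>d. g v x = qpow d)"
    and std: "\<And>w v x. rword w v \<Longrightarrow> x \<in> orb \<Longrightarrow> (if standard X (phi x) w then word_sum w x else 0) = g v x"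
    and rw: "\<And>y. y \<in> PW X \<Longrightarrow> reduced_word X y (rw y)"
  shows "standard_bases X rw"
  unfolding standard_bases_def
proof (intro ballI)
  fix x y assume "x \<in> PW X" "y \<in> PW X"
  then obtain u v where uv: "u \<in> orb" "x = phi u" "v \<in> orb" "y = phi v" by (auto simp: PW_eq)
  have sum_eq: "(\<Sum>T\<in>NPath X x w. qpow (path_deg X T)) = g v u" and fin: "finite (NPath X x w)"
    if w: "rword w v" for w
    using std[OF w uv(1)] Path_sum[OF rword_props(2)[OF w] uv(1)] uv(2) by (auto simp: NPath_def split: if_splits)
  have w0: "rword (rw y) v" using rw[OF \<open>y \<in> PW X\<close>] reduced_word_iff uv by simp
  have kl': "kl_poly X x y = g v u" using kl uv by simp
  have NP: "NPath X x w = (if g v u = 0 then {} else Path X x w)" if w: "rword w v" for w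
  proof (cases "g v u = 0")
    case True
    then show ?thesis using sum_qpow_eq_0[OF fin[OF w], of "path_deg X"] sum_eq[OF w] by simp
  next
    case False
    then have "standard X x w" using std[OF w uv(1)] uv(2) by (auto split: if_splits)
    then show ?thesis using False by (simp add: NPath_def)
  qed
  have "\<exists>B. homogeneous_basis (kl_poly X x y) (NPath X x (rw y)) (path_deg X) (\<lambda>T. B (path_elt X T))"
  proof (cases "g v u = 0")
    case True
    then show ?thesis using NP[OF w0] kl' by (simp add: homogeneous_basis_empty)
  next
    case False
    then obtain d where "g v u = qpow d" using mono uv by blast
    then obtain T where T: "NPath X x (rw y) = {T}" "path_deg X T = d"
      using sum_qpow_eq_qpow[OF fin[OF w0], of "path_deg X" d] sum_eq[OF w0] by auto
    then show ?thesis
      using homogeneous_basis_single[of "path_deg X" T] kl' \<open>g v u = qpow d\<close>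
      by (intro exI[of _ "\<lambda>_. Poly_Mapping.single (d, 0) 1"]) simp
  qed
  moreover have "path_elt X ` NPath X x w = path_elt X ` NPath X x (rw y)" if "reduced_word X y w" for w
  proof -
    have w: "rword w v" using that reduced_word_iff uv by simp
    show ?thesis using NP[OF w] NP[OF w0] Path_elt_comm_steps[OF rword_unique[OF w w0], of x] by simp
  qed
  ultimately show "(\<exists>B. homogeneous_basis (kl_poly X x y) (NPath X x (rw y)) (path_deg X)
           (\<lambda>T. B (path_elt X T))) \<and>
    kl_poly X x y = (\<Sum>T\<in>NPath X x (rw y). qpow (path_deg X T)) \<and>
    (\<forall>w. reduced_word X y w \<longrightarrow>
      path_elt X ` NPath X x w = path_elt X ` NPath X x (rw y))"
    using sum_eq[OF w0] kl' by simp
qed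

end

section \<open>Minuscule weights of simply laced root systems\<close>

text \<open>
  The coefficient of the point \<open>x\<close> in the product of the factors \<open>1 + q e\<^sup>b\<close>, for \<open>b\<close> in the list, applied
  to the point \<open>v\<close>.  The points of this cube are collected in \<open>cube_points\<close>.
\<close>

fun cube_sum :: "('v::ab_group_add) list \<Rightarrow> 'v \<Rightarrow> 'v \<Rightarrow> laurent" where
  "cube_sum [] v x = (if x = v then 1 else 0)"
| "cube_sum (b # bs) v x = cube_sum bs v x + qpow 1 * cube_sum bs (v + b) x"

fun cube_points :: "('v::ab_group_add) list \<Rightarrow> 'v \<Rightarrow> 'v set" where
  "cube_points [] v = {v}"
| "cube_points (b # bs) v = cube_points bs v \<union> cube_points bs (v + b)"

lemma cube_sum_move: "cube_sum (xs @ b # ys) v = cube_sum (b # xs @ ys) v"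
  by (induction xs arbitrary: v) (auto simp: fun_eq_iff algebra_simps)

lemma cube_points_move: "cube_points (xs @ b # ys) v = cube_points (b # xs @ ys) v"
  by (induction xs arbitrary: v) (auto simp: algebra_simps)

lemma cube_sum_partition: "cube_sum bs v = cube_sum (filter P bs @ filter (\<lambda>b. \<not> P b) bs) v"
proof (induction bs arbitrary: v)
  case (Cons b bs)
  have "cube_sum (b # bs) v = cube_sum (b # filter P bs @ filter (\<lambda>b. \<not> P b) bs) v"
    by (rule ext) (simp flip: Cons.IH)
  then show ?case by (simp only: filter.simps append_Cons cube_sum_move if_True if_False split: if_split) simp
qed simp

lemma cube_points_partition: "cube_points bs v = cube_points (filter P bs @ filter (\<lambda>b. \<not> P b) bs) v"
proof (induction bs arbitrary: v)
  case (Cons b bs)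
  have "cube_points (b # bs) v = cube_points (b # filter P bs @ filter (\<lambda>b. \<not> P b) bs) v"
    by (simp flip: Cons.IH)
  then show ?case by (simp only: filter.simps append_Cons cube_points_move if_True if_False split: if_split) simp
qed simp

lemma cube_points_base: "v \<in> cube_points bs v"
  by (induction bs arbitrary: v) auto

lemma cube_points_one: "b \<in> set bs \<Longrightarrow> v + b \<in> cube_points bs v"
  by (induction bs arbitrary: v) (auto simp: cube_points_base)

lemma cube_sum_support: "cube_sum bs v x \<noteq> 0 \<Longrightarrow> x \<in> cube_points bs v"
proof (induction bs arbitrary: v)
  case (Cons b bs)
  then show ?case by (cases "cube_sum bs (v + b) x = 0") auto
qed (simp split: if_splits)

lemma sorted_wrt_sym:
  assumes "sorted_wrt R bs" "b \<in> set bs" "c \<in> set bs" "b \<noteq> c" "\<And>x y. R x y \<Longrightarrow> R y x"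
  shows "R b c"
  using assms by (induction bs) auto

lemma qpow_q_ideal: "d > 0 \<Longrightarrow> qpow d \<in> q_ideal"
  by (simp add: q_ideal_def qpow_def)

lemma zero_q_ideal: "0 \<in> q_ideal"
  by (simp add: q_ideal_def)

context cox_model
begin

lemma opE_linear: "opE i (\<lambda>x. f x + c * g x) = (\<lambda>x. opE i f x + c * opE i g x)"
  by (auto simp: opE_def algebra_simps)

lemma opE_point:
  assumes "v \<in> orb" "i \<in> nodes X"
  shows "opE i (\<lambda>x. if x = v then 1 else 0) =
    (\<lambda>x. if act i v = v then 0 else (if x = act i v then 1 else 0) + updown i v * (if x = v then 1 else 0))"
proof
  fix x
  have *: "x = act i v \<longleftrightarrow> act i x = v \<and> x \<in> orb" if "x \<in> orb \<or> x = act i v"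
    using that assms orb_Om act_act act_orb by metis
  show "opE i (\<lambda>x. if x = v then 1 else 0) x =
    (if act i v = v then 0 else (if x = act i v then 1 else 0) + updown i v * (if x = v then 1 else 0))"
    using * assms act_orb act_act orb_Om by (auto simp: opE_def)
qed

end

definition minuscule_act :: "('v \<Rightarrow> 'v \<Rightarrow> real) \<Rightarrow> (nat \<Rightarrow> 'v::ab_group_add) \<Rightarrow> nat \<Rightarrow> 'v \<Rightarrow> 'v" where
  "minuscule_act ip \<alpha> i v =
    (if ip v (\<alpha> i) = 1 then v - \<alpha> i else if ip v (\<alpha> i) = - 1 then v + \<alpha> i else v)"

text \<open>
  The set \<open>Om\<close> is stable under the reflections and all its weights are minuscule; \<open>ht\<close> extends the
  height of roots to the ambient space.  The form may be degenerate, since it is realised on functions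
  of which only finitely many coordinates matter; its null vectors have height zero.
\<close>

locale minuscule =
  fixes X :: hs_pair and ip :: "'v::ab_group_add \<Rightarrow> 'v \<Rightarrow> real" and ht :: "'v \<Rightarrow> real"
    and \<alpha> :: "nat \<Rightarrow> 'v" and Om :: "'v set" and base :: 'v and bound :: real
  assumes omitted_node: "omitted X \<in> nodes X"
    and no_double: "double_bonds X = {}"
    and ip_add_left: "ip (x + y) z = ip x z + ip y z"
    and ip_sym: "ip x y = ip y x"
    and ht_add: "ht (x + y) = ht x + ht y"
    and ht_null: "ip x x = 0 \<Longrightarrow> ht x = 0"
    and ip_root: "i \<in> nodes X \<Longrightarrow> j \<in> nodes X \<Longrightarrow>
      ip (\<alpha> i) (\<alpha> j) = (if i = j then 2 else if cmat X i j = 3 then - 1 else 0)"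
    and ht_root: "i \<in> nodes X \<Longrightarrow> ht (\<alpha> i) = 1"
    and base_Om: "base \<in> Om"
    and ip_base: "i \<in> nodes X \<Longrightarrow> ip base (\<alpha> i) = (if i = omitted X then 1 else 0)"
    and minuscule: "v \<in> Om \<Longrightarrow> i \<in> nodes X \<Longrightarrow> ip v (\<alpha> i) \<in> {- 1, 0, 1}"
    and Om_minus: "v \<in> Om \<Longrightarrow> i \<in> nodes X \<Longrightarrow> ip v (\<alpha> i) = 1 \<Longrightarrow> v - \<alpha> i \<in> Om"
    and Om_plus: "v \<in> Om \<Longrightarrow> i \<in> nodes X \<Longrightarrow> ip v (\<alpha> i) = - 1 \<Longrightarrow> v + \<alpha> i \<in> Om"
    and ht_bound: "v \<in> Om \<Longrightarrow> ht (base - v) \<le> bound"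
begin

abbreviation act :: "nat \<Rightarrow> 'v \<Rightarrow> 'v" where
  "act \<equiv> minuscule_act ip \<alpha>"

definition rk :: "'v \<Rightarrow> real" where
  "rk v = ht (base - v)"

lemma ip_add_right: "ip x (y + z) = ip x y + ip x z"
  using ip_add_left ip_sym by metis

lemma ip_diff_left: "ip (x - y) z = ip x z - ip y z"
  using ip_add_left[of "x - y" y z] by simp

lemma ip_diff_right: "ip x (y - z) = ip x y - ip x z"
  using ip_diff_left ip_sym by metis

lemma ht_diff: "ht (x - y) = ht x - ht y"
  using ht_add[of "x - y" y] by simp

lemmas ip_simps = ip_add_left ip_add_right ip_diff_left ip_diff_right

lemma ip_zero: "ip 0 x = 0"
  using ip_diff_left[of x x x] by (metis cancel_comm_monoid_add_class.diff_cancel ip_diff_left)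

lemma root_nonzero: "i \<in> nodes X \<Longrightarrow> \<alpha> i \<noteq> 0"
  using ip_root[of i i] ip_zero by force

lemma cmat_two_three: "i \<noteq> j \<Longrightarrow> cmat X i j = 2 \<or> cmat X i j = 3"
  using no_double by (simp add: cmat_def)

lemma ip_cases:
  assumes "v \<in> Om" "i \<in> nodes X"
  obtains "ip v (\<alpha> i) = - 1" | "ip v (\<alpha> i) = 0" | "ip v (\<alpha> i) = 1"
  using minuscule[OF assms] by blast

lemma act_in_Om: "v \<in> Om \<Longrightarrow> i \<in> nodes X \<Longrightarrow> act i v \<in> Om"
  by (auto simp: minuscule_act_def Om_minus Om_plus)

lemma ip_act:
  "v \<in> Om \<Longrightarrow> i \<in> nodes X \<Longrightarrow> ip (act i v) x = ip v x - ip v (\<alpha> i) * ip (\<alpha> i) x"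
  by (erule (1) ip_cases) (auto simp: minuscule_act_def ip_simps)

lemma rk_act_eq: "v \<in> Om \<Longrightarrow> i \<in> nodes X \<Longrightarrow> rk (act i v) = rk v + ip v (\<alpha> i)"
  by (erule (1) ip_cases) (auto simp: rk_def minuscule_act_def ht_add ht_diff ht_root)

lemma act_fixed_iff: "v \<in> Om \<Longrightarrow> i \<in> nodes X \<Longrightarrow> act i v = v \<longleftrightarrow> ip v (\<alpha> i) = 0"
  by (erule (1) ip_cases) (auto simp: minuscule_act_def root_nonzero)

lemma act_act_id: "v \<in> Om \<Longrightarrow> i \<in> nodes X \<Longrightarrow> act i (act i v) = v"
  by (erule (1) ip_cases) (auto simp: minuscule_act_def ip_simps ip_root)

text \<open>
  At a single bond, reflecting at \<open>\<alpha>\<^sub>i\<close> would otherwise produce a weight with inner product \<open>2\<close> or \<open>-2\<close>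
  with \<open>\<alpha>\<^sub>j\<close>.
\<close>

lemma not_equal_signs:
  assumes "v \<in> Om" "i \<in> nodes X" "j \<in> nodes X" "cmat X i j = 3"
  shows "\<not> (ip v (\<alpha> i) = 1 \<and> ip v (\<alpha> j) = 1)" "\<not> (ip v (\<alpha> i) = - 1 \<and> ip v (\<alpha> j) = - 1)"
proof -
  have "i \<noteq> j" using assms(4) by auto
  then show "\<not> (ip v (\<alpha> i) = 1 \<and> ip v (\<alpha> j) = 1)" "\<not> (ip v (\<alpha> i) = - 1 \<and> ip v (\<alpha> j) = - 1)"
    using minuscule[OF act_in_Om[OF assms(1,2)] assms(3)] ip_act[OF assms(1,2), of "\<alpha> j"] ip_root assms by auto
qed

lemma braid_act:
  assumes v: "v \<in> Om" and i: "i \<in> nodes X" and j: "j \<in> nodes X" and "i \<noteq> j"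
  shows "((\<lambda>v. act j (act i v)) ^^ cmat X i j) v = v"
proof (cases "cmat X i j = 2")
  case True
  then have "ip (\<alpha> i) (\<alpha> j) = 0" "ip (\<alpha> j) (\<alpha> i) = 0" using ip_root i j assms by (simp_all add: cmat_sym)
  then show ?thesis
    using True v i j ip_root[of i i] ip_root[of j j]
    by (rule_tac ip_cases[OF v i]; rule_tac ip_cases[OF v j])
      (simp_all add: eval_nat_numeral minuscule_act_def ip_simps)
next
  case False
  then have three: "cmat X i j = 3" using cmat_two_three assms by blast
  then have r: "ip (\<alpha> i) (\<alpha> j) = - 1" "ip (\<alpha> j) (\<alpha> i) = - 1" using ip_root i j assms by (simp_all add: cmat_sym)
  show ?thesis
    using r three v i j ip_root[of i i] ip_root[of j j] not_equal_signs[OF v i j three]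
    by (rule_tac ip_cases[OF v i]; rule_tac ip_cases[OF v j])
      (simp_all add: eval_nat_numeral minuscule_act_def ip_simps)
qed

sublocale cox_model X act rk Om base bound
proof
  show "omitted X \<in> nodes X" by (rule omitted_node)
  show "base \<in> Om" by (rule base_Om)
  show "rk base = 0" using ht_diff[of base base] by (simp add: rk_def)
  fix v assume v: "v \<in> Om"
  show "rk v \<le> bound" unfolding rk_def by (rule ht_bound[OF v])
  fix i assume i: "i \<in> nodes X"
  show "act i v \<in> Om" by (rule act_in_Om[OF v i])
  show "act i (act i v) = v" by (rule act_act_id[OF v i])
  show "rk (act i v) = rk v + 1 \<or> rk (act i v) = rk v - 1" if "act i v \<noteq> v"
    using that rk_act_eq[OF v i] act_fixed_iff[OF v i] minuscule[OF v i] by auto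
  fix j assume j: "j \<in> nodes X"
  show "((\<lambda>v. act j (act i v)) ^^ cmat X i j) v = v" if "i \<noteq> j" by (rule braid_act[OF v i j that])
  show "cmat X i j = 2" if "i \<noteq> j" "rk v < rk (act i v)" "rk v < rk (act j v)"
    using that rk_act_eq[OF v i] rk_act_eq[OF v j] not_equal_signs[OF v i j] cmat_two_three[of i j]
    by (rule_tac ip_cases[OF v i]; rule_tac ip_cases[OF v j]) auto
  show "cmat X i j = 2" if "i \<noteq> j" "rk (act i v) < rk v" "rk (act j v) < rk v"
    using that rk_act_eq[OF v i] rk_act_eq[OF v j] not_equal_signs[OF v i j] cmat_two_three[of i j]
    by (rule_tac ip_cases[OF v i]; rule_tac ip_cases[OF v j]) auto
  show "rk (act j (act i v)) - rk (act i v) = rk (act j v) - rk v" if "cmat X i j = 2"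
    using that rk_act_eq[OF v j] rk_act_eq[OF act_in_Om[OF v i] j] ip_act[OF v i, of "\<alpha> j"] ip_root[OF i j]
    by auto
  show "act i (act j v) \<noteq> act j v" if "cmat X i j = 4"
    using that cmat_two_three[of i j] by (cases "i = j") auto
next
  fix i assume "i \<in> nodes X" "i \<noteq> omitted X"
  then show "act i base = base" using act_fixed_iff[OF base_Om] ip_base by simp
next
  show "rk (act (omitted X) base) = 1"
    using rk_act_eq[OF base_Om omitted_node] ip_base[OF omitted_node] ht_diff[of base base]
    by (simp add: rk_def[of base])
qed

lemma asc_iff: "v \<in> Om \<Longrightarrow> i \<in> nodes X \<Longrightarrow> rk v < rk (act i v) \<longleftrightarrow> ip v (\<alpha> i) = 1"
  using rk_act_eq[of v i] minuscule[of v i] by auto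

lemma desc_iff: "v \<in> Om \<Longrightarrow> i \<in> nodes X \<Longrightarrow> rk (act i v) < rk v \<longleftrightarrow> ip v (\<alpha> i) = - 1"
  using rk_act_eq[of v i] minuscule[of v i] by auto

lemma act_cases:
  "v \<in> Om \<Longrightarrow> i \<in> nodes X \<Longrightarrow> ip v (\<alpha> i) = 1 \<Longrightarrow> act i v = v - \<alpha> i"
  "v \<in> Om \<Longrightarrow> i \<in> nodes X \<Longrightarrow> ip v (\<alpha> i) = - 1 \<Longrightarrow> act i v = v + \<alpha> i"
  by (simp_all add: minuscule_act_def)

text \<open>
  If \<open>\<alpha>\<^sub>i\<close> is orthogonal to all edges of a cube, it has the same inner product with all of its points,
  and \<open>E\<^sub>i\<close> acts on the cube as on its base point.
\<close>

lemma opE_cube_sum: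
  assumes "i \<in> nodes X"
  shows "cube_points bs v \<subseteq> orb \<Longrightarrow> \<forall>b\<in>set bs. ip b (\<alpha> i) = 0 \<Longrightarrow> ip v (\<alpha> i) = 1 \<Longrightarrow>
      opE i (cube_sum bs v) = (\<lambda>x. cube_sum bs (v - \<alpha> i) x + qpow 1 * cube_sum bs v x)" (is "_ \<Longrightarrow> _ \<Longrightarrow> _ \<Longrightarrow> ?A bs v")
    and "cube_points bs v \<subseteq> orb \<Longrightarrow> \<forall>b\<in>set bs. ip b (\<alpha> i) = 0 \<Longrightarrow> ip v (\<alpha> i) = - 1 \<Longrightarrow>
      opE i (cube_sum bs v) = (\<lambda>x. cube_sum bs (v + \<alpha> i) x + qpow (- 1) * cube_sum bs v x)" (is "_ \<Longrightarrow> _ \<Longrightarrow> _ \<Longrightarrow> ?B bs v")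
    and "cube_points bs v \<subseteq> orb \<Longrightarrow> \<forall>b\<in>set bs. ip b (\<alpha> i) = 0 \<Longrightarrow> ip v (\<alpha> i) = 0 \<Longrightarrow>
      opE i (cube_sum bs v) = (\<lambda>x. 0)" (is "_ \<Longrightarrow> _ \<Longrightarrow> _ \<Longrightarrow> ?C bs v")
proof -
  have pt: "cube_sum [] u = (\<lambda>x. if x = u then 1 else 0)" for u :: 'v by auto
  have cons: "cube_sum (b # bs) u = (\<lambda>x. cube_sum bs u x + qpow 1 * cube_sum bs (u + b) x)" for b u :: 'v and bs by auto
  show "cube_points bs v \<subseteq> orb \<Longrightarrow> \<forall>b\<in>set bs. ip b (\<alpha> i) = 0 \<Longrightarrow> ip v (\<alpha> i) = 1 \<Longrightarrow> ?A bs v"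
  proof (induction bs arbitrary: v)
    case Nil
    then show ?case
      using opE_point[of v i] assms orb_Om[of v] asc_iff[of v i] act_cases[of v i] root_nonzero[of i]
      unfolding pt by (auto simp: updown_def)
  next
    case (Cons b bs)
    then have "?A bs v" "?A bs (v + b)" by (auto simp: ip_simps)
    then show ?case unfolding cons opE_linear by (simp add: algebra_simps)
  qed
  show "cube_points bs v \<subseteq> orb \<Longrightarrow> \<forall>b\<in>set bs. ip b (\<alpha> i) = 0 \<Longrightarrow> ip v (\<alpha> i) = - 1 \<Longrightarrow> ?B bs v"
  proof (induction bs arbitrary: v)
    case Nil
    then show ?case
      using opE_point[of v i] assms orb_Om[of v] asc_iff[of v i] act_cases[of v i] root_nonzero[of i]
      unfolding pt by (auto simp: updown_def)
  next
    case (Cons b bs)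
    then have "?B bs v" "?B bs (v + b)" by (auto simp: ip_simps)
    then show ?case unfolding cons opE_linear by (simp add: algebra_simps)
  qed
  show "cube_points bs v \<subseteq> orb \<Longrightarrow> \<forall>b\<in>set bs. ip b (\<alpha> i) = 0 \<Longrightarrow> ip v (\<alpha> i) = 0 \<Longrightarrow> ?C bs v"
  proof (induction bs arbitrary: v)
    case Nil
    then show ?case
      using opE_point[of v i] assms orb_Om[of v] act_fixed_iff[of v i]
      unfolding pt by auto
  next
    case (Cons b bs)
    then have "?C bs v" "?C bs (v + b)" by (auto simp: ip_simps)
    then show ?case unfolding cons opE_linear by simp
  qed
qed

lemma cube_points_shift:
  assumes "i \<in> nodes X"
  shows "cube_points bs v \<subseteq> orb \<Longrightarrow> \<forall>b\<in>set bs. ip b (\<alpha> i) = 0 \<Longrightarrow> ip v (\<alpha> i) = 1 \<Longrightarrow>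
      cube_points bs (v - \<alpha> i) \<subseteq> orb"
    and "cube_points bs v \<subseteq> orb \<Longrightarrow> \<forall>b\<in>set bs. ip b (\<alpha> i) = 0 \<Longrightarrow> ip v (\<alpha> i) = - 1 \<Longrightarrow>
      cube_points bs (v + \<alpha> i) \<subseteq> orb"
proof -
  show "cube_points bs v \<subseteq> orb \<Longrightarrow> \<forall>b\<in>set bs. ip b (\<alpha> i) = 0 \<Longrightarrow> ip v (\<alpha> i) = 1 \<Longrightarrow>
      cube_points bs (v - \<alpha> i) \<subseteq> orb"
  proof (induction bs arbitrary: v)
    case Nil
    then show ?case using act_orb[of v i] act_cases(1)[of v i] orb_Om assms by simp
  next
    case (Cons b bs)
    from Cons.prems have "cube_points bs (v - \<alpha> i) \<subseteq> orb" "cube_points bs ((v + b) - \<alpha> i) \<subseteq> orb"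
      using Cons.IH by (auto simp: ip_simps)
    then show ?case by (simp add: algebra_simps)
  qed
  show "cube_points bs v \<subseteq> orb \<Longrightarrow> \<forall>b\<in>set bs. ip b (\<alpha> i) = 0 \<Longrightarrow> ip v (\<alpha> i) = - 1 \<Longrightarrow>
      cube_points bs (v + \<alpha> i) \<subseteq> orb"
  proof (induction bs arbitrary: v)
    case Nil
    then show ?case using act_orb[of v i] act_cases(2)[of v i] orb_Om assms by simp
  next
    case (Cons b bs)
    from Cons.prems have "cube_points bs (v + \<alpha> i) \<subseteq> orb" "cube_points bs ((v + b) + \<alpha> i) \<subseteq> orb"
      using Cons.IH by (auto simp: ip_simps)
    then show ?case by (simp add: algebra_simps)
  qed
qed

text \<open>
  Adding a cup to \<open>v\<close> reflects \<open>v\<close> at a positive root and lowers its rank.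
\<close>

definition cups :: "'v list \<Rightarrow> 'v \<Rightarrow> bool" where
  "cups bs v \<longleftrightarrow> cube_points bs v \<subseteq> orb \<and> sorted_wrt (\<lambda>b c. ip b c = 0) bs \<and>
    (\<forall>b\<in>set bs. ip b b = 2 \<and> ip v b = - 1 \<and> 0 < ht b)"

text \<open>
  All points of the cube of \<open>v\<close> are minuscule, so at an ascent \<open>i\<close> at most two cups fail to be
  orthogonal to \<open>\<alpha>\<^sub>i\<close>, and these have inner product \<open>-1\<close> with it.  None of them: a new cup \<open>\<alpha>\<^sub>i\<close> appears.
  One: \<open>\<alpha>\<^sub>i\<close> replaces it, since \<open>E\<^sub>i\<close> annihilates the opposite face.  Two, \<open>b\<close> and \<open>c\<close>: the faces at
  \<open>v + b\<close> and \<open>v + c\<close> are annihilated, and the other two combine to the cups \<open>\<alpha>\<^sub>i\<close> and \<open>b + c + \<alpha>\<^sub>i\<close>.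
\<close>

lemma cups_step:
  assumes cups: "cups bs v" and i: "i \<in> nodes X" and up: "ip v (\<alpha> i) = 1"
  shows "\<exists>bs'. cups bs' (v - \<alpha> i) \<and> opE i (cube_sum bs v) = cube_sum bs' (v - \<alpha> i)"
proof -
  define ds where "ds = filter (\<lambda>b. ip b (\<alpha> i) = - 1) bs"
  define cs where "cs = filter (\<lambda>b. ip b (\<alpha> i) \<noteq> - 1) bs"
  have K: "cube_sum bs v = cube_sum (ds @ cs) v" and P: "cube_points bs v = cube_points (ds @ cs) v"
    unfolding ds_def cs_def by (rule cube_sum_partition cube_points_partition)+
  have orb: "cube_points (ds @ cs) v \<subseteq> orb" using cups P by (simp add: cups_def)
  have props: "ip b b = 2" "ip v b = - 1" "0 < ht b" if "b \<in> set bs" for b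
    using cups that by (auto simp: cups_def)
  have small: "ip x (\<alpha> i) \<in> {- 1, 0, 1}" if "x \<in> cube_points bs v" for x
    using that P orb orb_Om minuscule i by blast
  have zero_or: "ip b (\<alpha> i) = 0 \<or> ip b (\<alpha> i) = - 1" if b: "b \<in> set bs" for b
  proof -
    \<comment> \<open>the only root with inner product \<open>- 2\<close> is \<open>- \<alpha> i\<close>, which is not positive\<close>
    have "ip b (\<alpha> i) \<noteq> - 2"
    proof
      assume "ip b (\<alpha> i) = - 2"
      then have "ip (b + \<alpha> i) (b + \<alpha> i) = 0"
        using props[OF b] ip_root[OF i i] ip_sym[of "\<alpha> i" b] by (simp add: ip_simps)
      then have "ht (b + \<alpha> i) = 0" by (rule ht_null)
      then show False using props[OF b] ht_root[OF i] by (simp add: ht_add)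
    qed
    moreover have "ip v (\<alpha> i) + ip b (\<alpha> i) \<in> {- 1, 0, 1}"
      using small[OF cube_points_one[OF b]] by (simp add: ip_simps)
    ultimately show ?thesis using up by auto
  qed
  have cs0: "\<forall>b\<in>set cs. ip b (\<alpha> i) = 0" using zero_or by (auto simp: cs_def)
  have ds1: "\<forall>b\<in>set ds. ip b (\<alpha> i) = - 1" by (auto simp: ds_def)
  have sub: "set ds \<subseteq> set bs" "set cs \<subseteq> set bs" by (auto simp: ds_def cs_def)
  have srt: "sorted_wrt (\<lambda>b c. ip b c = 0) bs" using cups by (simp add: cups_def)
  then have srt': "sorted_wrt (\<lambda>b c. ip b c = 0) ds" "sorted_wrt (\<lambda>b c. ip b c = 0) cs"
    by (simp_all add: ds_def cs_def sorted_wrt_filter)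
  have cross: "ip b c = 0" if "b \<in> set ds" "c \<in> set cs" for b c
  proof (rule sorted_wrt_sym[OF srt])
    show "b \<noteq> c" using that cs0 ds1 by force
  qed (use that sub ip_sym in auto)
  have rr: "ip (\<alpha> i) (\<alpha> i) = 2" using ip_root[OF i i] by simp
  have cs0': "\<forall>b\<in>set cs. ip (\<alpha> i) b = 0" and ds1': "\<forall>b\<in>set ds. ip (\<alpha> i) b = - 1"
    using cs0 ds1 ip_sym by metis+
  have new: "cups (\<alpha> i # cs) (v - \<alpha> i)" if "cube_points cs v \<subseteq> orb"
    using that cube_points_shift(1)[OF i that cs0 up] srt' cs0 cs0' props sub(2) rr ht_root[OF i] up
    by (auto simp: cups_def ip_simps)
  consider (none) "ds = []" | (one) b where "ds = [b]" | (two) b c where "ds = [b, c]"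
    | (more) b c d r where "ds = b # c # d # r"
    by (metis list.exhaust)
  then show ?thesis
  proof cases
    case none
    then have "opE i (cube_sum bs v) = cube_sum (\<alpha> i # cs) (v - \<alpha> i)"
      using opE_cube_sum(1)[OF i _ cs0 up] orb by (auto simp: K fun_eq_iff)
    then show ?thesis using new orb none by auto
  next
    case one
    have cs1: "cube_points cs v \<subseteq> orb" "cube_points cs (v + b) \<subseteq> orb" using orb one by auto
    have "ip (v + b) (\<alpha> i) = 0" using up ds1 one by (simp add: ip_simps)
    then have z: "opE i (cube_sum cs (v + b)) = (\<lambda>x. 0)" using opE_cube_sum(3)[OF i cs1(2) cs0] by simp
    have "cube_sum bs v = (\<lambda>x. cube_sum cs v x + qpow 1 * cube_sum cs (v + b) x)" using one by (auto simp: K)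
    then have "opE i (cube_sum bs v) = (\<lambda>x. opE i (cube_sum cs v) x + qpow 1 * opE i (cube_sum cs (v + b)) x)"
      by (simp only: opE_linear)
    then have "opE i (cube_sum bs v) = cube_sum (\<alpha> i # cs) (v - \<alpha> i)"
      using opE_cube_sum(1)[OF i cs1(1) cs0 up] z by (simp add: fun_eq_iff)
    then show ?thesis using new cs1 by auto
  next
    case two
    let ?\<gamma> = "b + c + \<alpha> i"
    have bc: "b \<in> set ds" "c \<in> set ds" using two by auto
    have bcs: "b \<in> set bs" "c \<in> set bs" using bc sub by auto
    have cs1: "cube_points cs v \<subseteq> orb" "cube_points cs (v + b) \<subseteq> orb" "cube_points cs (v + c) \<subseteq> orb"
      "cube_points cs (v + b + c) \<subseteq> orb" using orb two by auto
    have b1: "ip b (\<alpha> i) = - 1" "ip c (\<alpha> i) = - 1" "ip (\<alpha> i) b = - 1" "ip (\<alpha> i) c = - 1" "ip b c = 0" "ip c b = 0"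
      using ds1 ds1' bc srt' two ip_sym[of c b] by auto
    have "ip (v + b) (\<alpha> i) = 0" "ip (v + c) (\<alpha> i) = 0" and m: "ip (v + b + c) (\<alpha> i) = - 1"
      using up b1 by (simp_all add: ip_simps)
    then have z: "opE i (cube_sum cs (v + b)) = (\<lambda>x. 0)" "opE i (cube_sum cs (v + c)) = (\<lambda>x. 0)"
      using opE_cube_sum(3)[OF i cs1(2) cs0] opE_cube_sum(3)[OF i cs1(3) cs0] by simp_all
    have "cube_sum bs v = (\<lambda>x. (\<lambda>x. (\<lambda>x. cube_sum cs v x + qpow 1 * cube_sum cs (v + c) x) x
        + qpow 1 * cube_sum cs (v + b) x) x + (qpow 1 * qpow 1) * cube_sum cs (v + b + c) x)"
      using two by (auto simp: K algebra_simps)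
    then have "opE i (cube_sum bs v) = (\<lambda>x. opE i (cube_sum cs v) x + (qpow 1 * qpow 1) * opE i (cube_sum cs (v + b + c)) x)"
      using z by (simp only: opE_linear mult_zero_right add_0_right)
    also have "\<dots> = (\<lambda>x. cube_sum cs (v - \<alpha> i) x + qpow 1 * cube_sum cs v x +
        (qpow 1 * qpow 1) * (cube_sum cs (v + b + c + \<alpha> i) x + qpow (- 1) * cube_sum cs (v + b + c) x))"
      by (simp only: opE_cube_sum(1)[OF i cs1(1) cs0 up] opE_cube_sum(2)[OF i cs1(4) cs0 m])
    also have "\<dots> = (\<lambda>x. cube_sum cs (v - \<alpha> i) x + qpow 1 * cube_sum cs v x +
        qpow 2 * cube_sum cs (v + b + c + \<alpha> i) x + qpow 1 * cube_sum cs (v + b + c) x)"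
      by (rule ext) (simp add: distrib_left qpow_mult mult.assoc[symmetric])
    also have "\<dots> = cube_sum (\<alpha> i # ?\<gamma> # cs) (v - \<alpha> i)"
    proof
      fix x
      have "v - \<alpha> i + ?\<gamma> = v + b + c" "v - \<alpha> i + \<alpha> i + ?\<gamma> = v + b + c + \<alpha> i" "v - \<alpha> i + \<alpha> i = v"
        by (simp_all add: algebra_simps)
      then show "cube_sum cs (v - \<alpha> i) x + qpow 1 * cube_sum cs v x +
          qpow 2 * cube_sum cs (v + b + c + \<alpha> i) x + qpow 1 * cube_sum cs (v + b + c) x =
          cube_sum (\<alpha> i # ?\<gamma> # cs) (v - \<alpha> i) x"
        by (simp only: cube_sum.simps) (simp add: distrib_left qpow_mult mult.assoc[symmetric])
    qed
    finally have "opE i (cube_sum bs v) = cube_sum (\<alpha> i # ?\<gamma> # cs) (v - \<alpha> i)" .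
    moreover have "cups (\<alpha> i # ?\<gamma> # cs) (v - \<alpha> i)"
    proof -
      have "v - \<alpha> i + ?\<gamma> = v + b + c" "v - \<alpha> i + \<alpha> i + ?\<gamma> = v + b + c + \<alpha> i" "v - \<alpha> i + \<alpha> i = v"
        by (simp_all add: algebra_simps)
      then have "cube_points (\<alpha> i # ?\<gamma> # cs) (v - \<alpha> i) \<subseteq> orb"
        using cs1 cube_points_shift(1)[OF i cs1(1) cs0 up] cube_points_shift(2)[OF i cs1(4) cs0 m]
        by (simp only: cube_points.simps) simp
      moreover have "ip ?\<gamma> ?\<gamma> = 2" "ip (v - \<alpha> i) ?\<gamma> = - 1" "ip (\<alpha> i) ?\<gamma> = 0" "0 < ht ?\<gamma>"
        using b1 rr up props(1,2)[OF bcs(1)] props(1,2)[OF bcs(2)] props(3)[OF bcs(1)] props(3)[OF bcs(2)] ht_root[OF i]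
        by (simp_all add: ip_simps ht_add)
      moreover have "\<forall>d\<in>set cs. ip ?\<gamma> d = 0" using cs0' cross bc by (auto simp: ip_simps)
      ultimately show ?thesis using srt' cs0 cs0' props sub(2) rr ht_root[OF i] up
        by (auto simp: cups_def ip_simps)
    qed
    ultimately show ?thesis by blast
  next
    case more
    have "v + b + c + d \<in> cube_points (ds @ cs) v" using more cube_points_base by auto
    then have "ip (v + b + c + d) (\<alpha> i) \<in> {- 1, 0, 1}" using small P by simp
    then show ?thesis using up ds1 more by (auto simp: ip_simps)
  qed
qed

lemma word_sum_cups: "rword w v \<Longrightarrow> \<exists>bs. cups bs v \<and> word_sum w = cube_sum bs v"
proof (induction rule: rword.induct)
  case rword_Nil
  show ?case by (intro exI[of _ "[]"]) (auto simp: cups_def word_sum_Nil base_orb)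
next
  case (rword_snoc w v i)
  then obtain bs where bs: "cups bs v" "word_sum w = cube_sum bs v" by blast
  have v: "v \<in> Om" using rword_snoc rword_props by blast
  then have up: "ip v (\<alpha> i) = 1" using rword_snoc asc_iff by blast
  then have "act i v = v - \<alpha> i" using v rword_snoc act_cases by blast
  then show ?case using cups_step[OF bs(1) rword_snoc(2) up] bs(2) by (simp add: word_sum_snoc)
qed

lemma cube_points_ip:
  "\<forall>c\<in>set bs. ip c b = 0 \<Longrightarrow> x \<in> cube_points bs v \<Longrightarrow> ip x b = ip v b"
  by (induction bs arbitrary: v) (auto simp: ip_simps)

lemma cups_Cons:
  assumes "cups (b # bs) v" shows "cups bs v" "cups bs (v + b)"
  using assms by (auto simp: cups_def ip_simps)

text \<open>
  The \<open>2\<^sup>k\<close> points of a cube with pairwise orthogonal edges \<open>b\<close> are distinct: their inner products with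
  \<open>b\<close> are \<open>-1\<close> and \<open>1\<close> on the two faces transversal to \<open>b\<close>.
\<close>

lemma cube_sum_values:
  "cups bs v \<Longrightarrow> cube_sum bs v v = 1 \<and>
    (\<forall>x. x \<noteq> v \<longrightarrow> cube_sum bs v x = 0 \<or> (\<exists>d>0. cube_sum bs v x = qpow d))"
proof (induction bs arbitrary: v)
  case (Cons b bs)
  have b': "\<forall>c\<in>set bs. ip b c = 0" "ip b b = 2" "ip v b = - 1"
    using Cons.prems by (auto simp: cups_def)
  then have b: "\<forall>c\<in>set bs. ip c b = 0" "ip b b = 2" "ip v b = - 1"
    using ip_sym by metis+
  have vb: "ip (v + b) b = 1" using b by (simp add: ip_simps)
  have *: "cube_sum bs v x = 0 \<or> cube_sum bs (v + b) x = 0" for x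
    using cube_points_ip[OF b(1), of x v] cube_points_ip[OF b(1), of x "v + b"]
      cube_sum_support[of bs v x] cube_sum_support[of bs "v + b" x] b(3) vb by linarith
  note IH = Cons.IH[OF cups_Cons(1)[OF Cons.prems]] Cons.IH[OF cups_Cons(2)[OF Cons.prems]]
  have "cube_sum bs (v + b) v = 0" using *[of v] IH(1) by simp
  moreover have "cube_sum (b # bs) v x = 0 \<or> (\<exists>d>0. cube_sum (b # bs) v x = qpow d)" if "x \<noteq> v" for x
  proof (cases "cube_sum bs (v + b) x = 0")
    case True
    then show ?thesis using IH(1) that by simp
  next
    case False
    then have "cube_sum bs v x = 0" using *[of x] by blast
    moreover have "\<exists>d\<ge>0. cube_sum bs (v + b) x = qpow d"
    proof (cases "x = v + b")
      case True
      then show ?thesis using IH(2) by (intro exI[of _ 0]) (simp add: qpow_0)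
    next
      case False
      then obtain d where "d > 0" "cube_sum bs (v + b) x = qpow d" using IH(2) \<open>cube_sum bs (v + b) x \<noteq> 0\<close> by blast
      then show ?thesis by (intro exI[of _ d]) simp
    qed
    ultimately show ?thesis by (auto simp: qpow_mult intro!: exI[of _ "1 + _"])
  qed
  ultimately show ?case using IH by simp
qed (simp)

text \<open>
  The common path sum of all reduced words of \<open>v\<close>.
\<close>

definition canonical :: "'v \<Rightarrow> 'v \<Rightarrow> laurent" where
  "canonical v = word_sum (SOME w. rword w v)"

lemma canonical_eq: "rword w v \<Longrightarrow> canonical v = word_sum w"
  unfolding canonical_def using word_sum_comm_steps rword_unique someI by metis

lemma canonical_values:
  assumes "v \<in> orb"
  shows "canonical v v = 1" "x \<noteq> v \<Longrightarrow> canonical v x = 0 \<or> (\<exists>d>0. canonical v x = qpow d)"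
proof -
  obtain w where w: "rword w v" using assms by (auto simp: orb_def)
  then obtain bs where "cups bs v" "word_sum w = cube_sum bs v" using word_sum_cups by blast
  then show "canonical v v = 1" "x \<noteq> v \<Longrightarrow> canonical v x = 0 \<or> (\<exists>d>0. canonical v x = qpow d)"
    using cube_sum_values canonical_eq[OF w] by auto
qed

lemma canonical_q_ideal: "v \<in> orb \<Longrightarrow> x \<noteq> v \<Longrightarrow> canonical v x \<in> q_ideal"
  using canonical_values(2)[of v x] qpow_q_ideal zero_q_ideal by metis

lemma canonical_monomial: "v \<in> orb \<Longrightarrow> canonical v x = 0 \<or> (\<exists>d. canonical v x = qpow d)"
  using canonical_values[of v] qpow_0 by (cases "x = v") metis+

lemma canonical_support: "v \<in> orb \<Longrightarrow> canonical v x \<noteq> 0 \<Longrightarrow> wle x v"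
  using canonical_eq word_sum_support by (auto simp: orb_def)

text \<open>
  The path sums expand trivially, each being a member of the family, so in the recursion the symmetric
  parts \<open>b\<close> vanish off the diagonal.
\<close>

lemma kl_poly_canonical:
  assumes "x \<in> orb" "v \<in> orb"
  shows "kl_poly X (phi x) (phi v) = canonical v x"
proof (rule kl_poly_model[OF canonical_values(1) canonical_q_ideal canonical_support _ assms])
  fix w v assume w: "rword w v"
  have "(\<Sum>z\<in>orb. (if z = v then 1 else 0) * canonical z x) = word_sum w x" for x
    using canonical_eq[OF w] rword_props(5)[OF w] finite_orb by (simp add: if_distrib[of "\<lambda>c. c * _"] cong: if_cong)
  then show "\<exists>c. (\<forall>z\<in>orb. c z \<in> sym_laurent) \<and> (\<forall>x\<in>orb. word_sum w x = (\<Sum>z\<in>orb. c z * canonical z x))"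
    by (intro exI[of _ "\<lambda>z. if z = v then 1 else 0"]) (auto simp: sym_laurent_0 sym_laurent_1)
qed

lemma standard_bases_simply_laced:
  assumes "\<And>x w. standard X x w" and "\<And>y. y \<in> PW X \<Longrightarrow> reduced_word X y (rw y)"
  shows "standard_bases X rw"
  by (rule standard_bases_if_monomial[OF kl_poly_canonical canonical_monomial _ assms(2)])
    (auto simp: assms(1) canonical_eq)

end

section \<open>The simply laced pairs\<close>

definition unit_vec :: "nat \<Rightarrow> nat \<Rightarrow> real" where
  "unit_vec j p = (if p = j then 1 else 0)"

definition dot :: "nat set \<Rightarrow> (nat \<Rightarrow> real) \<Rightarrow> (nat \<Rightarrow> real) \<Rightarrow> real" where
  "dot I x y = (\<Sum>p\<in>I. x p * y p)"

lemma dot_linear: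
  "dot I (x + y) z = dot I x z + dot I y z" "dot I z (x + y) = dot I z x + dot I z y"
  "dot I (x - y) z = dot I x z - dot I y z" "dot I z (x - y) = dot I z x - dot I z y"
  by (simp_all add: dot_def algebra_simps sum.distrib sum_subtractf)

lemma dot_sym: "dot I x y = dot I y x"
  by (simp add: dot_def mult.commute)

lemma dot_unit_vec: "finite I \<Longrightarrow> dot I x (unit_vec j) = (if j \<in> I then x j else 0)"
  "finite I \<Longrightarrow> dot I (unit_vec j) x = (if j \<in> I then x j else 0)"
  by (simp_all add: dot_def unit_vec_def if_distrib[of "\<lambda>c. _ * c"] if_distrib[of "\<lambda>c. c * _"] cong: if_cong)

lemma dot_null:
  assumes "finite I" "dot I x x = 0" shows "dot I h x = 0"
proof -
  have "\<forall>p\<in>I. x p * x p = 0"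
    using assms by (subst sum_nonneg_eq_0_iff[symmetric]) (simp_all add: dot_def)
  then show ?thesis by (simp add: dot_def)
qed

text \<open>
  The square of \<open>v - t r\<close>, from which the Cauchy-Schwarz inequality arises by the choice of \<open>t\<close>.
\<close>

lemma dot_square_nonneg: "0 \<le> dot I v v - 2 * t * dot I v r + t\<^sup>2 * dot I r r"
proof -
  have "0 \<le> (\<Sum>p\<in>I. (v p - t * r p)\<^sup>2)" by (rule sum_nonneg) simp
  also have "\<dots> = (\<Sum>p\<in>I. v p * v p - 2 * t * (v p * r p) + t\<^sup>2 * (r p * r p))"
    by (rule sum.cong) (simp_all add: power2_eq_square algebra_simps)
  finally show ?thesis by (simp add: dot_def sum.distrib sum_subtractf sum_distrib_left)
qed

lemma dot_bound:
  assumes "finite I" "\<And>p. p \<in> I \<Longrightarrow> \<bar>x p\<bar> \<le> 2" "\<And>p. p \<in> I \<Longrightarrow> \<bar>y p\<bar> \<le> 2"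
  shows "dot I h (x - y) \<le> (\<Sum>p\<in>I. \<bar>h p\<bar> * 4)"
  unfolding dot_def
proof (rule sum_mono)
  fix p assume "p \<in> I"
  then have "\<bar>x p - y p\<bar> \<le> 4" using assms(2)[of p] assms(3)[of p] by linarith
  then have "\<bar>h p\<bar> * \<bar>x p - y p\<bar> \<le> \<bar>h p\<bar> * 4" by (rule mult_left_mono) simp
  then show "h p * (x - y) p \<le> \<bar>h p\<bar> * 4"
    using abs_ge_self[of "h p * (x p - y p)"] by (simp add: abs_mult)
qed

text \<open>
  The height is the inner product with a vector \<open>h\<close> playing the role of \<open>\<rho>\<close>.  The bound on the
  coordinates makes the ranks bounded, hence the orbit finite.
\<close>

lemma minuscule_coordinates:
  assumes "finite I" "omitted X \<in> nodes X" "double_bonds X = {}"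
    and "\<And>i j. i \<in> nodes X \<Longrightarrow> j \<in> nodes X \<Longrightarrow>
      dot I (\<alpha> i) (\<alpha> j) = (if i = j then 2 else if cmat X i j = 3 then - 1 else 0)"
    and "\<And>i. i \<in> nodes X \<Longrightarrow> dot I h (\<alpha> i) = 1"
    and "base \<in> Om"
    and "\<And>i. i \<in> nodes X \<Longrightarrow> dot I base (\<alpha> i) = (if i = omitted X then 1 else 0)"
    and "\<And>v i. v \<in> Om \<Longrightarrow> i \<in> nodes X \<Longrightarrow> dot I v (\<alpha> i) \<in> {- 1, 0, 1}"
    and "\<And>v i. v \<in> Om \<Longrightarrow> i \<in> nodes X \<Longrightarrow> dot I v (\<alpha> i) = 1 \<Longrightarrow> v - \<alpha> i \<in> Om"
    and "\<And>v i. v \<in> Om \<Longrightarrow> i \<in> nodes X \<Longrightarrow> dot I v (\<alpha> i) = - 1 \<Longrightarrow> v + \<alpha> i \<in> Om"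
    and "\<And>v p. v \<in> Om \<Longrightarrow> p \<in> I \<Longrightarrow> \<bar>v p\<bar> \<le> 2"
  shows "minuscule X (dot I) (dot I h) \<alpha> Om base (\<Sum>p\<in>I. \<bar>h p\<bar> * 4)"
proof unfold_locales
  show "dot I (x + y) z = dot I x z + dot I y z" for x y z by (rule dot_linear)
  show "dot I x y = dot I y x" for x y by (rule dot_sym)
  show "dot I h (x + y) = dot I h x + dot I h y" for x y by (rule dot_linear)
  show "dot I h x = 0" if "dot I x x = 0" for x by (rule dot_null[OF assms(1) that])
  show "dot I h (base - v) \<le> (\<Sum>p\<in>I. \<bar>h p\<bar> * 4)" if "v \<in> Om" for v
    by (rule dot_bound[OF assms(1)]) (use assms(6,11) that in blast)+
qed (fact assms)+

lemma cmat_eq_3_iff: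
  "double_bonds X = {} \<Longrightarrow> cmat X i j = 3 \<longleftrightarrow> i \<noteq> j \<and> {i, j} \<in> single_bonds X"
  by (simp add: cmat_def)

lemma path_bond_iff:
  "{i, j} \<in> {{i, i + 1} |i. P i} \<longleftrightarrow> (j = i + 1 \<and> P i) \<or> (i = j + 1 \<and> P (j :: nat))"
  by (auto simp: doubleton_eq_iff)

definition root_A :: "nat \<Rightarrow> nat \<Rightarrow> real" where
  "root_A i = unit_vec i - unit_vec (i + 1)"

text \<open>
  The weights of the \<open>k\<close>-th exterior power, as indicator functions of sets; the orbit consists of those
  agreeing with the base point outside \<open>{1..n + 1}\<close> and having \<open>k\<close> elements.
\<close>

lemma minuscule_A:
  assumes "1 \<le> k" "k \<le> n"
  shows "minuscule (PairA n k) (dot {1..n + 1}) (dot {1..n + 1} (\<lambda>p. - real p)) root_A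
    {v. \<forall>p. v p = 0 \<or> v p = 1} (\<lambda>p. if 1 \<le> p \<and> p \<le> k then 1 else 0) (\<Sum>p\<in>{1..n + 1}. \<bar>- real p\<bar> * 4)"
proof (rule minuscule_coordinates)
  have ip: "dot {1..n + 1} v (root_A i) = v i - v (i + 1)" if "i \<in> nodes (PairA n k)" for v i
    using that by (simp add: root_A_def dot_linear dot_unit_vec nodes_def)
  fix i assume i: "i \<in> nodes (PairA n k)"
  show "dot {1..n + 1} (\<lambda>p. - real p) (root_A i) = 1" unfolding ip[OF i] by simp
  show "dot {1..n + 1} (\<lambda>p. if 1 \<le> p \<and> p \<le> k then 1 else 0) (root_A i) =
      (if i = omitted (PairA n k) then 1 else 0)"
    unfolding ip[OF i] using i assms by (auto simp: nodes_def)
  fix v :: "nat \<Rightarrow> real" assume v: "v \<in> {v. \<forall>p. v p = 0 \<or> v p = 1}"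
  then have vp: "v p = 0 \<or> v p = 1" for p by blast
  show "dot {1..n + 1} v (root_A i) \<in> {- 1, 0, 1}"
    unfolding ip[OF i] using vp[of i] vp[of "i + 1"] by auto
  show "v - root_A i \<in> {v. \<forall>p. v p = 0 \<or> v p = 1}" if "dot {1..n + 1} v (root_A i) = 1"
  proof -
    have "v i = 1" "v (i + 1) = 0" using that[unfolded ip[OF i]] vp[of i] vp[of "i + 1"] by auto
    then show ?thesis using vp by (auto simp: root_A_def unit_vec_def)
  qed
  show "v + root_A i \<in> {v. \<forall>p. v p = 0 \<or> v p = 1}" if "dot {1..n + 1} v (root_A i) = - 1"
  proof -
    have "v i = 0" "v (i + 1) = 1" using that[unfolded ip[OF i]] vp[of i] vp[of "i + 1"] by auto
    then show ?thesis using vp by (auto simp: root_A_def unit_vec_def)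
  qed
next
  fix v :: "nat \<Rightarrow> real" and p assume "v \<in> {v. \<forall>p. v p = 0 \<or> v p = 1}"
  then have "v p = 0 \<or> v p = 1" by blast
  then show "\<bar>v p\<bar> \<le> 2" by auto
next
  fix i j assume ij: "i \<in> nodes (PairA n k)" "j \<in> nodes (PairA n k)"
  have db: "double_bonds (PairA n k) = {}" by simp
  have "cmat (PairA n k) i j = 3 \<longleftrightarrow> j = i + 1 \<or> i = j + 1"
    unfolding cmat_eq_3_iff[OF db] single_bonds.simps path_bond_iff using ij by (auto simp: nodes_def)
  then show "dot {1..n + 1} (root_A i) (root_A j) =
      (if i = j then 2 else if cmat (PairA n k) i j = 3 then - 1 else 0)"
    using ij by (auto simp: root_A_def dot_linear dot_unit_vec nodes_def unit_vec_def)
qed (use assms in \<open>auto simp: nodes_def\<close>)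

definition root_D :: "nat \<Rightarrow> nat \<Rightarrow> real" where
  "root_D i = (if i = 1 then unit_vec 1 + unit_vec 2 else unit_vec i - unit_vec (i - 1))"

lemma dot_root_D:
  "3 \<le> n \<Longrightarrow> i \<in> {1..n} \<Longrightarrow> dot {1..n} v (root_D i) = (if i = 1 then v 1 + v 2 else v i - v (i - 1))"
  by (auto simp: root_D_def dot_linear dot_unit_vec)

lemma root_D_gram:
  assumes "3 \<le> n" "i \<in> {1..n}" "j \<in> {1..n}"
    and "double_bonds X = {}" "single_bonds X = insert {1, 3} {{i, i + 1} |i. 2 \<le> i \<and> i < n}"
  shows "dot {1..n} (root_D i) (root_D j) = (if i = j then 2 else if cmat X i j = 3 then - 1 else 0)"
proof -
  have "cmat X i j = 3 \<longleftrightarrow> (i = 1 \<and> j = 3) \<or> (i = 3 \<and> j = 1) \<or>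
      (2 \<le> i \<and> 2 \<le> j \<and> (j = i + 1 \<or> i = j + 1))"
    unfolding cmat_eq_3_iff[OF assms(4)] assms(5) insert_iff path_bond_iff
    using assms(1-3) by (auto simp: doubleton_eq_iff)
  moreover have "i = 1 \<or> (\<exists>a\<ge>1. i = Suc a)" "j = 1 \<or> (\<exists>b\<ge>1. j = Suc b)"
    using assms(2,3) by (cases i; cases j; force)+
  ultimately show ?thesis
    unfolding dot_root_D[OF assms(1,3)]
    by (elim disjE exE conjE; hypsubst) (simp_all add: root_D_def unit_vec_def)
qed

lemma root_D_height:
  assumes "3 \<le> n" "i \<in> {1..n}" shows "dot {1..n} (\<lambda>p. real p - 1) (root_D i) = 1"
  unfolding dot_root_D[OF assms] using assms by auto

text \<open>
  The weights of a half-spin representation; the parity of the number of negative coordinates, which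
  is constant on the orbit, distinguishes the two ends of the fork.
\<close>

lemma minuscule_DA:
  assumes "3 \<le> n" "k \<in> {1, 2}"
  shows "minuscule (PairDA n k) (dot {1..n}) (dot {1..n} (\<lambda>p. real p - 1)) root_D
    {v. \<forall>p. v p = 1/2 \<or> v p = - 1/2} (\<lambda>p. if k = 2 \<and> p = 1 then - 1/2 else 1/2)
    (\<Sum>p\<in>{1..n}. \<bar>real p - 1\<bar> * 4)"
proof (rule minuscule_coordinates)
  fix i assume i: "i \<in> nodes (PairDA n k)"
  then have i': "i \<in> {1..n}" by (simp add: nodes_def)
  note ip = dot_root_D[OF assms(1) i']
  show "dot {1..n} (\<lambda>p. real p - 1) (root_D i) = 1" by (rule root_D_height[OF assms(1) i'])
  show "dot {1..n} (\<lambda>p. if k = 2 \<and> p = 1 then - 1/2 else 1/2) (root_D i) =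
      (if i = omitted (PairDA n k) then 1 else 0)"
    unfolding ip using i' assms by auto
  fix v :: "nat \<Rightarrow> real" assume v: "v \<in> {v. \<forall>p. v p = 1/2 \<or> v p = - 1/2}"
  then have vp: "v p = 1/2 \<or> v p = - 1/2" for p by blast
  show "dot {1..n} v (root_D i) \<in> {- 1, 0, 1}"
    unfolding ip using vp[of i] vp[of "i - 1"] vp[of 1] vp[of 2] by auto
  show "v - root_D i \<in> {v. \<forall>p. v p = 1/2 \<or> v p = - 1/2}" if d: "dot {1..n} v (root_D i) = 1"
  proof (cases "i = 1")
    case True
    then have "v 1 = 1/2" "v 2 = 1/2" using d[unfolded ip] vp[of 1] vp[of 2] by auto
    then show ?thesis using vp True by (auto simp: root_D_def unit_vec_def)
  next
    case False
    then have "v i = 1/2" "v (i - 1) = - 1/2" using d[unfolded ip] vp[of i] vp[of "i - 1"] by auto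
    then show ?thesis using vp False i' by (auto simp: root_D_def unit_vec_def)
  qed
  show "v + root_D i \<in> {v. \<forall>p. v p = 1/2 \<or> v p = - 1/2}" if d: "dot {1..n} v (root_D i) = - 1"
  proof (cases "i = 1")
    case True
    then have "v 1 = - 1/2" "v 2 = - 1/2" using d[unfolded ip] vp[of 1] vp[of 2] by auto
    then show ?thesis using vp True by (auto simp: root_D_def unit_vec_def)
  next
    case False
    then have "v i = - 1/2" "v (i - 1) = 1/2" using d[unfolded ip] vp[of i] vp[of "i - 1"] by auto
    then show ?thesis using vp False i' by (auto simp: root_D_def unit_vec_def)
  qed
next
  fix v :: "nat \<Rightarrow> real" and p assume "v \<in> {v. \<forall>p. v p = 1/2 \<or> v p = - 1/2}"
  then have "v p = 1/2 \<or> v p = - 1/2" by blast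
  then show "\<bar>v p\<bar> \<le> 2" by auto
next
  show "dot {1..n} (root_D i) (root_D j) = (if i = j then 2 else if cmat (PairDA n k) i j = 3 then - 1 else 0)"
    if "i \<in> nodes (PairDA n k)" "j \<in> nodes (PairDA n k)" for i j
    using that assms by (intro root_D_gram) (auto simp: nodes_def)
qed (use assms in \<open>auto simp: nodes_def\<close>)

text \<open>
  The weights of the vector representation.
\<close>

lemma minuscule_DD:
  assumes "4 \<le> n"
  shows "minuscule (PairDD n) (dot {1..n}) (dot {1..n} (\<lambda>p. real p - 1)) root_D
    {v. \<exists>p\<in>{1..n}. v = unit_vec p \<or> v = - unit_vec p} (unit_vec n) (\<Sum>p\<in>{1..n}. \<bar>real p - 1\<bar> * 4)"
proof (rule minuscule_coordinates)
  have n3: "3 \<le> n" using assms by simp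
  fix i assume i: "i \<in> nodes (PairDD n)"
  then have i': "i \<in> {1..n}" by (simp add: nodes_def)
  note ip = dot_root_D[OF n3 i']
  show "dot {1..n} (\<lambda>p. real p - 1) (root_D i) = 1" by (rule root_D_height[OF n3 i'])
  show "dot {1..n} (unit_vec n) (root_D i) = (if i = omitted (PairDD n) then 1 else 0)"
    unfolding ip using i' assms by (auto simp: unit_vec_def)
  fix v :: "nat \<Rightarrow> real" assume v: "v \<in> {v. \<exists>p\<in>{1..n}. v = unit_vec p \<or> v = - unit_vec p}"
  then obtain p where p: "p \<in> {1..n}" "v = unit_vec p \<or> v = - unit_vec p" by blast
  have "p - 1 \<noteq> p" "i - 1 \<noteq> i" using p i' by auto
  then show "dot {1..n} v (root_D i) \<in> {- 1, 0, 1}"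
    unfolding ip using p i' by (auto simp: unit_vec_def)
  have sub: "unit_vec a - unit_vec b - unit_vec a = - unit_vec b" "unit_vec a - (unit_vec a - unit_vec b) = unit_vec b"
    "- unit_vec b - (unit_vec a - unit_vec b) = - unit_vec a" "unit_vec a - (unit_vec a + unit_vec b) = - unit_vec b"
    "unit_vec b - (unit_vec a + unit_vec b) = - unit_vec a" "unit_vec b + (unit_vec a - unit_vec b) = unit_vec a"
    "- unit_vec a + (unit_vec a - unit_vec b) = - unit_vec b" "- unit_vec a + (unit_vec a + unit_vec b) = unit_vec b"
    "- unit_vec b + (unit_vec a + unit_vec b) = unit_vec a" for a b
    by (simp_all add: fun_eq_iff)
  show "v - root_D i \<in> {v. \<exists>p\<in>{1..n}. v = unit_vec p \<or> v = - unit_vec p}" if d: "dot {1..n} v (root_D i) = 1"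
  proof (cases "i = 1")
    case True
    then have "v = unit_vec 1 \<or> v = unit_vec 2" using d p unfolding ip by (auto simp: unit_vec_def split: if_splits)
    then have "v - root_D i = - unit_vec 2 \<or> v - root_D i = - unit_vec 1" using True sub by (auto simp: root_D_def)
    then show ?thesis using assms by auto
  next
    case False
    then have "v = unit_vec i \<or> v = - unit_vec (i - 1)" using d p unfolding ip by (auto simp: unit_vec_def split: if_splits)
    then have "v - root_D i = unit_vec (i - 1) \<or> v - root_D i = - unit_vec i" using False sub by (auto simp: root_D_def)
    moreover have "i - 1 \<in> {1..n}" using False i' by auto
    ultimately show ?thesis using i' by blast
  qed
  show "v + root_D i \<in> {v. \<exists>p\<in>{1..n}. v = unit_vec p \<or> v = - unit_vec p}" if d: "dot {1..n} v (root_D i) = - 1"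
  proof (cases "i = 1")
    case True
    then have "v = - unit_vec 1 \<or> v = - unit_vec 2" using d p unfolding ip by (auto simp: unit_vec_def split: if_splits)
    then have "v + root_D i = unit_vec 2 \<or> v + root_D i = unit_vec 1" using True sub by (auto simp: root_D_def)
    then show ?thesis using assms by auto
  next
    case False
    then have "v = - unit_vec i \<or> v = unit_vec (i - 1)" using d p unfolding ip by (auto simp: unit_vec_def split: if_splits)
    then have "v + root_D i = - unit_vec (i - 1) \<or> v + root_D i = unit_vec i" using False sub by (auto simp: root_D_def)
    moreover have "i - 1 \<in> {1..n}" using False i' by auto
    ultimately show ?thesis using i' by blast
  qed
next
  fix v :: "nat \<Rightarrow> real" and q assume "v \<in> {v. \<exists>p\<in>{1..n}. v = unit_vec p \<or> v = - unit_vec p}"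
  then show "\<bar>v q\<bar> \<le> 2" by (auto simp: unit_vec_def)
next
  show "dot {1..n} (root_D i) (root_D j) = (if i = j then 2 else if cmat (PairDD n) i j = 3 then - 1 else 0)"
    if "i \<in> nodes (PairDD n)" "j \<in> nodes (PairDD n)" for i j
    using that assms by (intro root_D_gram) (auto simp: nodes_def)
qed (use assms in \<open>auto simp: nodes_def\<close>)

text \<open>
  The simple roots of \<open>E\<^sub>7\<close> inside \<open>E\<^sub>8\<close>, in the coordinates of Bourbaki.
\<close>

definition root_E :: "nat \<Rightarrow> nat \<Rightarrow> real" where
  "root_E i =
    (if i = 1 then (\<lambda>p. if p = 1 \<or> p = 8 then 1/2 else - 1/2)
     else if i = 2 then unit_vec 1 + unit_vec 2 else unit_vec (i - 1) - unit_vec (i - 2))"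

lemma sum_8: "(\<Sum>p\<in>{1..8::nat}. f p) = f 1 + f 2 + f 3 + f 4 + f 5 + f 6 + f 7 + f 8"
  by (simp add: eval_nat_numeral add.assoc)

lemmas sum_8' = sum_8[unfolded One_nat_def]

lemma nat_1_7: "i \<in> {1..7::nat} \<longleftrightarrow> i = 1 \<or> i = 2 \<or> i = 3 \<or> i = 4 \<or> i = 5 \<or> i = 6 \<or> i = 7"
  by auto

lemma dot_root_E:
  assumes "i \<in> {1..7}"
  shows "dot {1..8} x (root_E i) =
    (if i = 1 then (x 1 + x 8 - x 2 - x 3 - x 4 - x 5 - x 6 - x 7) / 2
     else if i = 2 then x 1 + x 2 else x (i - 1) - x (i - 2))"
proof (cases "i = 1")
  case True
  then show ?thesis by (simp add: dot_def sum_8' root_E_def field_simps)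
next
  case False
  then show ?thesis using assms by (auto simp: root_E_def dot_linear dot_unit_vec)
qed

lemma root_E_gram:
  assumes "i \<in> {1..7}" "j \<in> {1..7}"
  shows "dot {1..8} (root_E i) (root_E j) =
    (if i = j then 2 else if {i, j} \<in> {{1, 3}, {3, 4}, {4, 5}, {5, 6}, {6, 7}, {2, 4}} then - 1 else 0)"
  using assms(1) assms(2)[unfolded nat_1_7] unfolding dot_root_E[OF assms(2)] nat_1_7
  by (elim disjE; hypsubst) (simp_all add: root_E_def unit_vec_def doubleton_eq_iff)

lemma root_E_height:
  assumes "i \<in> {1..7}"
  shows "dot {1..8} (\<lambda>p. if p = 7 then - 17/2 else if p = 8 then 17/2 else real p - 1) (root_E i) = 1"
  using assms unfolding dot_root_E[OF assms] nat_1_7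
  by (elim disjE; hypsubst) simp_all

text \<open>
  In types \<open>E\<close> the weights are not listed: they have square length below two, so by the Cauchy-Schwarz
  inequality their integral inner products with roots lie in \<open>{-1, 0, 1}\<close>.  The vector defining the
  height is \<open>\<rho>\<close> of \<open>E\<^sub>7\<close>.
\<close>

lemma minuscule_E:
  assumes "omitted X \<in> nodes X" "double_bonds X = {}" "nodes X \<subseteq> {1..7}"
    and bonds: "\<And>i j. i \<in> nodes X \<Longrightarrow> j \<in> nodes X \<Longrightarrow> {i, j} \<in> single_bonds X \<longleftrightarrow>
      {i, j} \<in> {{1, 3}, {3, 4}, {4, 5}, {5, 6}, {6, 7}, {2, 4}}"
    and base: "\<And>i. i \<in> nodes X \<Longrightarrow> dot {1..8} base (root_E i) = (if i = omitted X then 1 else 0)"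
    and norm: "dot {1..8} base base = c" "c < 2"
  shows "minuscule X (dot {1..8}) (dot {1..8} (\<lambda>p. if p = 7 then - 17/2 else if p = 8 then 17/2 else real p - 1))
    root_E {v. dot {1..8} v v = c \<and> (\<forall>i\<in>nodes X. dot {1..8} v (root_E i) \<in> \<int>)} base
    (\<Sum>p\<in>{1..8}. \<bar>if p = 7 then - 17/2 else if p = 8 then 17/2 else real p - 1\<bar> * 4)"
proof (rule minuscule_coordinates)
  have gram: "dot {1..8} (root_E i) (root_E j) = (if i = j then 2 else if cmat X i j = 3 then - 1 else 0)"
    if "i \<in> nodes X" "j \<in> nodes X" for i j
    unfolding root_E_gram[OF subsetD[OF assms(3) that(1)] subsetD[OF assms(3) that(2)]]
      cmat_eq_3_iff[OF assms(2)] bonds[OF that]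
    by (simp del: insert_iff)
  then show "dot {1..8} (root_E i) (root_E j) = (if i = j then 2 else if cmat X i j = 3 then - 1 else 0)"
    if "i \<in> nodes X" "j \<in> nodes X" for i j using that by blast
  show "base \<in> {v. dot {1..8} v v = c \<and> (\<forall>i\<in>nodes X. dot {1..8} v (root_E i) \<in> \<int>)}"
    using base norm by simp
  fix i assume i: "i \<in> nodes X"
  show "dot {1..8} (\<lambda>p. if p = 7 then - 17/2 else if p = 8 then 17/2 else real p - 1) (root_E i) = 1"
    using root_E_height i assms(3) by blast
  show "dot {1..8} base (root_E i) = (if i = omitted X then 1 else 0)" by (rule base[OF i])
  fix v :: "nat \<Rightarrow> real" assume "v \<in> {v. dot {1..8} v v = c \<and> (\<forall>i\<in>nodes X. dot {1..8} v (root_E i) \<in> \<int>)}"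
  then have v: "dot {1..8} v v = c" "\<And>i. i \<in> nodes X \<Longrightarrow> dot {1..8} v (root_E i) \<in> \<int>" by auto
  have rr: "dot {1..8} (root_E i) (root_E i) = 2" using gram[OF i i] by simp
  show "dot {1..8} v (root_E i) \<in> {- 1, 0, 1}"
  proof -
    let ?m = "dot {1..8} v (root_E i)"
    obtain k where k: "?m = of_int k" using v(2)[OF i] by (auto elim: Ints_cases)
    have "0 \<le> dot {1..8} v v - 2 * (?m / 2) * ?m + (?m / 2)\<^sup>2 * dot {1..8} (root_E i) (root_E i)"
      by (rule dot_square_nonneg)
    then have "(of_int k)\<^sup>2 < (4 :: real)" unfolding v(1) rr k using norm(2) by (simp add: power2_eq_square)
    then have "of_int (k\<^sup>2) < (of_int 4 :: real)" by simp
    then have "k\<^sup>2 < 4" by (simp only: of_int_less_iff)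
    then have "\<not> \<bar>2\<bar> \<le> \<bar>k\<bar>" unfolding abs_le_square_iff by simp
    then have "k = - 1 \<or> k = 0 \<or> k = 1" by linarith
    then show ?thesis using k by auto
  qed
  have ints: "dot {1..8} (root_E i) (root_E j) \<in> \<int>" if "j \<in> nodes X" for j using gram[OF i that] by auto
  show "v - root_E i \<in> {v. dot {1..8} v v = c \<and> (\<forall>i\<in>nodes X. dot {1..8} v (root_E i) \<in> \<int>)}"
    if "dot {1..8} v (root_E i) = 1"
    using v rr that ints dot_sym[of "{1..8}" "root_E i" v] by (auto simp: dot_linear)
  show "v + root_E i \<in> {v. dot {1..8} v v = c \<and> (\<forall>i\<in>nodes X. dot {1..8} v (root_E i) \<in> \<int>)}"
    if "dot {1..8} v (root_E i) = - 1"
    using v rr that ints dot_sym[of "{1..8}" "root_E i" v] by (auto simp: dot_linear)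
next
  fix v :: "nat \<Rightarrow> real" and p :: nat
  assume v: "v \<in> {v. dot {1..8} v v = c \<and> (\<forall>i\<in>nodes X. dot {1..8} v (root_E i) \<in> \<int>)}" and p: "p \<in> {1..8}"
  have "v p * v p \<le> dot {1..8} v v" unfolding dot_def by (rule member_le_sum) (use p in auto)
  then have "(v p)\<^sup>2 \<le> 2\<^sup>2" using v norm(2) by (simp add: power2_eq_square)
  then show "\<bar>v p\<bar> \<le> 2" using abs_le_square_iff[of "v p" 2] by simp
qed (simp_all add: assms(1,2))

lemma nodes_E: "nodes (PairE6 k) = {1..6}" "nodes PairE7 = {1..7}"
  by (simp_all add: nodes_def)

lemma minuscule_E6:
  assumes "k \<in> {1, 6}"
  shows "\<exists>ip ht \<alpha> Om (base :: nat \<Rightarrow> real) bound. minuscule (PairE6 k) ip ht \<alpha> Om base bound"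
proof -
  \<comment> \<open>the first and the last fundamental weight of \<open>E\<^sub>6\<close>\<close>
  let ?base = "\<lambda>p::nat. (if k = 1 then (if p = 8 then 2/3 else if p = 7 \<or> p = 6 then - 2/3 else 0)
    else (if p = 8 then 1/3 else if p = 7 \<or> p = 6 then - 1/3 else if p = 5 then 1 else 0)) :: real"
  have "dot {1..8} ?base (root_E i) = (if i = omitted (PairE6 k) then 1 else 0)" if "i \<in> nodes (PairE6 k)" for i
  proof -
    have "i = 1 \<or> i = 2 \<or> i = 3 \<or> i = 4 \<or> i = 5 \<or> i = 6" and i: "i \<in> {1..7}"
      using that by (auto simp: nodes_E)
    then show ?thesis using assms unfolding dot_root_E[OF i]
      by (elim disjE insertE emptyE; hypsubst) simp_all
  qed
  moreover have "dot {1..8} ?base ?base = 4/3" using assms by (auto simp: dot_def sum_8')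
  moreover have "{i, j} \<in> single_bonds (PairE6 k) \<longleftrightarrow> {i, j} \<in> {{1, 3}, {3, 4}, {4, 5}, {5, 6}, {6, 7}, {2, 4}}"
    if "i \<in> nodes (PairE6 k)" "j \<in> nodes (PairE6 k)" for i j
    using that by (auto simp: nodes_E doubleton_eq_iff)
  ultimately have "minuscule (PairE6 k) (dot {1..8})
    (dot {1..8} (\<lambda>p. if p = 7 then - 17/2 else if p = 8 then 17/2 else real p - 1))
    root_E {v. dot {1..8} v v = 4/3 \<and> (\<forall>i\<in>nodes (PairE6 k). dot {1..8} v (root_E i) \<in> \<int>)} ?base
    (\<Sum>p\<in>{1..8}. \<bar>if p = 7 then - 17/2 else if p = 8 then 17/2 else real p - 1\<bar> * 4)"
    using assms by (intro minuscule_E) (auto simp: nodes_E)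
  then show ?thesis by blast
qed

lemma minuscule_E7:
  shows "\<exists>ip ht \<alpha> Om (base :: nat \<Rightarrow> real) bound. minuscule PairE7 ip ht \<alpha> Om base bound"
proof -
  \<comment> \<open>the last fundamental weight of \<open>E\<^sub>7\<close>\<close>
  let ?base = "\<lambda>p::nat. (if p = 8 then 1/2 else if p = 7 then - 1/2 else if p = 6 then 1 else 0) :: real"
  have "dot {1..8} ?base (root_E i) = (if i = omitted PairE7 then 1 else 0)" if "i \<in> nodes PairE7" for i
  proof -
    have i: "i \<in> {1..7}" using that by (simp add: nodes_E)
    then show ?thesis unfolding dot_root_E[OF i] nat_1_7
      by (elim disjE; hypsubst) simp_all
  qed
  moreover have "dot {1..8} ?base ?base = 3/2" by (simp add: dot_def sum_8')
  ultimately have "minuscule PairE7 (dot {1..8})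
    (dot {1..8} (\<lambda>p. if p = 7 then - 17/2 else if p = 8 then 17/2 else real p - 1))
    root_E {v. dot {1..8} v v = 3/2 \<and> (\<forall>i\<in>nodes PairE7. dot {1..8} v (root_E i) \<in> \<int>)} ?base
    (\<Sum>p\<in>{1..8}. \<bar>if p = 7 then - 17/2 else if p = 8 then 17/2 else real p - 1\<bar> * 4)"
    by (intro minuscule_E) (auto simp: nodes_E)
  then show ?thesis by blast
qed

section \<open>Spans over the symmetric Laurent polynomials\<close>

context cox_model
begin

text \<open>
  Combinations with symmetric coefficients of the members \<open>g z\<close> of rank at most \<open>r\<close>; the bound on the
  rank makes inductions over lower points possible.
\<close>

inductive symspan :: "('a \<Rightarrow> 'a \<Rightarrow> laurent) \<Rightarrow> real \<Rightarrow> ('a \<Rightarrow> laurent) \<Rightarrow> bool" for g r where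
  symspan_zero: "symspan g r (\<lambda>x. 0)"
| symspan_add: "symspan g r f \<Longrightarrow> c \<in> sym_laurent \<Longrightarrow> z \<in> orb \<Longrightarrow> rk z \<le> r \<Longrightarrow>
    symspan g r (\<lambda>x. f x + c * g z x)"

lemma symspan_mono: "symspan g r f \<Longrightarrow> r \<le> s \<Longrightarrow> symspan g s f"
  by (induction rule: symspan.induct) (auto intro: symspan.intros)

lemma symspan_plus: "symspan g r h \<Longrightarrow> symspan g r f \<Longrightarrow> symspan g r (\<lambda>x. f x + h x)"
proof (induction rule: symspan.induct)
  case (symspan_add h c z)
  then have "symspan g r (\<lambda>x. (f x + h x) + c * g z x)" by (intro symspan.symspan_add) auto
  then show ?case by (simp add: add.assoc)
qed simp

lemma symspan_scale: "symspan g r f \<Longrightarrow> d \<in> sym_laurent \<Longrightarrow> symspan g r (\<lambda>x. d * f x)"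
proof (induction rule: symspan.induct)
  case (symspan_add f c z)
  then have "symspan g r (\<lambda>x. d * f x + (d * c) * g z x)"
    by (intro symspan.symspan_add sym_laurent_mult) auto
  then show ?case by (simp add: distrib_left mult.assoc)
qed (simp add: symspan_zero)

lemma symspan_self: "z \<in> orb \<Longrightarrow> rk z \<le> r \<Longrightarrow> symspan g r (g z)"
  using symspan_add[OF symspan_zero sym_laurent_1, of z r g] by simp

lemma opE_zero: "opE i (\<lambda>x. 0) = (\<lambda>x. 0)"
  by (auto simp: opE_def)

lemma symspan_opE:
  assumes "\<And>z. z \<in> orb \<Longrightarrow> rk z \<le> r \<Longrightarrow> symspan g s (opE i (g z))"
  shows "symspan g r f \<Longrightarrow> symspan g s (opE i f)"
proof (induction rule: symspan.induct)
  case (symspan_add f c z)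
  then show ?case unfolding opE_linear by (intro symspan_plus[OF symspan_scale] assms) auto
qed (simp add: opE_zero symspan_zero)

lemma symspan_expand:
  "symspan g r f \<Longrightarrow> \<exists>c. (\<forall>z\<in>orb. c z \<in> sym_laurent) \<and> (\<forall>x\<in>orb. f x = (\<Sum>z\<in>orb. c z * g z x))"
proof (induction rule: symspan.induct)
  case symspan_zero
  show ?case by (rule exI[of _ "\<lambda>_. 0"]) (simp add: sym_laurent_0)
next
  case (symspan_add f d y)
  then obtain c where c: "\<forall>z\<in>orb. c z \<in> sym_laurent" "\<forall>x\<in>orb. f x = (\<Sum>z\<in>orb. c z * g z x)" by blast
  let ?c = "c(y := c y + d)"
  have "(\<Sum>z\<in>orb. ?c z * g z x) = (\<Sum>z\<in>orb. c z * g z x + (if z = y then d * g y x else 0))" for x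
    by (rule sum.cong) (auto simp: algebra_simps)
  then have "(\<Sum>z\<in>orb. ?c z * g z x) = (\<Sum>z\<in>orb. c z * g z x) + d * g y x" for x
    using symspan_add finite_orb by (simp add: sum.distrib)
  then show ?case
    using c symspan_add sym_laurent_add by (intro exI[of _ ?c]) auto
qed

lemma updown_act:
  assumes "v \<in> orb" "i \<in> nodes X" "act i v \<noteq> v"
  shows "updown i v * updown i (act i v) = 1" "updown i v + updown i (act i v) = qbar"
  using moved_cases[of v i] assms orb_Om act_act
  by (auto simp: updown_def qpow_mult qpow_0 add.commute)

text \<open>
  Relation (ii) of the Temperley-Lieb algebra: on an orbit \<open>{x, y}\<close> the loops have weights \<open>q\<close> and
  \<open>q\<^sup>-\<^sup>1\<close>, so \<open>E\<^sub>i\<close> has rank one and trace \<open>q + q\<^sup>-\<^sup>1\<close>.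
\<close>

lemma opE_quad:
  assumes "i \<in> nodes X" shows "opE i (opE i f) = (\<lambda>x. qbar * opE i f x)"
proof
  fix x
  show "opE i (opE i f) x = qbar * opE i f x"
  proof (cases "x \<in> orb \<and> act i x \<noteq> x")
    case True
    then have y: "act i x \<in> orb" "act i (act i x) = x" using assms act_orb act_act orb_Om by auto
    note u = updown_act[of x i]
    let ?a = "updown i x" and ?b = "updown i (act i x)"
    have "opE i (opE i f) x = ?a * (?a * f x + f (act i x)) + (?b * f (act i x) + 1 * f x)"
      using True y by (auto simp: opE_def)
    also have "\<dots> = ?a * (?a * f x + f (act i x)) + (?b * f (act i x) + (?a * ?b) * f x)"
      using u True assms by simp
    also have "\<dots> = (?a + ?b) * (?a * f x + f (act i x))" by (simp add: algebra_simps)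
    finally have "opE i (opE i f) x = (?a + ?b) * (?a * f x + f (act i x))" .
    then show ?thesis using u True assms by (simp add: opE_def)
  qed (auto simp: opE_def)
qed

end

context minuscule
begin

lemma updown_ip: "v \<in> orb \<Longrightarrow> i \<in> nodes X \<Longrightarrow> updown i v = (if ip v (\<alpha> i) = 1 then qpow 1 else qpow (- 1))"
  using asc_iff orb_Om by (simp add: updown_def)

text \<open>
  On an orbit \<open>{x, y}\<close> of \<open>s\<^sub>i\<close> exactly one point is moved by \<open>s\<^sub>j\<close>, since the inner products with \<open>\<alpha>\<^sub>j\<close>
  differ by one; it is moved to a point fixed by \<open>s\<^sub>i\<close>, so \<open>E\<^sub>j\<close> only contributes the loop at this
  point.
\<close>

lemma opE_triple:
  assumes ij: "i \<in> nodes X" "j \<in> nodes X" "cmat X i j = 3"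
  shows "opE i (opE j (opE i f)) = opE i f"
proof
  fix x
  show "opE i (opE j (opE i f)) x = opE i f x"
  proof (cases "x \<in> orb \<and> act i x \<noteq> x")
    case True
    then have x: "x \<in> orb" "x \<in> Om" using orb_Om by auto
    define y where "y = act i x"
    have y: "y \<in> orb" "y \<in> Om" "act i y = x" "y \<noteq> x" using x ij True act_orb orb_Om act_act by (auto simp: y_def)
    have ne: "i \<noteq> j" using ij by auto
    have r: "ip (\<alpha> i) (\<alpha> j) = - 1" "ip (\<alpha> j) (\<alpha> i) = - 1" "ip (\<alpha> i) (\<alpha> i) = 2"
      using ip_root[of i j] ip_root[of j i] ip_root[of i i] ij ne by (simp_all add: cmat_sym)
    have a: "ip x (\<alpha> i) = 1 \<or> ip x (\<alpha> i) = - 1"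
      using minuscule[OF x(2) ij(1)] act_fixed_iff[OF x(2) ij(1)] True by auto
    have ya: "ip y (\<alpha> i) = - ip x (\<alpha> i)" "ip y (\<alpha> j) = ip x (\<alpha> j) + ip x (\<alpha> i)"
      using ip_act[OF x(2) ij(1)] r by (simp_all add: y_def)
    have one: "opE i f z = 0" if "z \<in> orb" "ip z (\<alpha> i) = 0" for z
      using that act_fixed_iff[of z i] orb_Om ij by (simp add: opE_def)
    have b: "(ip x (\<alpha> j) = 0 \<and> ip y (\<alpha> j) = ip x (\<alpha> i)) \<or> (ip x (\<alpha> j) = - ip x (\<alpha> i) \<and> ip y (\<alpha> j) = 0)"
      using not_equal_signs[OF x(2) ij] minuscule[OF x(2) ij(2)] a ya by auto
    have L: "opE i h x = updown i x * h x + h y" for h using True by (simp add: opE_def y_def)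
    have ui: "updown i x * updown i y = 1" using updown_act(1)[of x i] x ij True by (simp add: y_def)
    from b show ?thesis
    proof
      assume b: "ip x (\<alpha> j) = 0 \<and> ip y (\<alpha> j) = ip x (\<alpha> i)"
      let ?z = "act j y"
      have z: "?z \<in> orb" "ip ?z (\<alpha> i) = 0"
        using act_orb y ij ip_act[OF y(2) ij(2), of "\<alpha> i"] b r ya by auto
      have "opE j (opE i f) x = 0" using b act_fixed_iff[OF x(2) ij(2)] by (simp add: opE_def)
      moreover have "act j y \<noteq> y" using b a act_fixed_iff[OF y(2) ij(2)] by auto
      then have "opE j (opE i f) y = updown j y * opE i f y" using one[OF z] y by (simp add: opE_def[of j])
      moreover have "opE i f y = updown i y * f y + f x" using y by (simp add: opE_def)
      moreover have "updown j y = updown i x" using updown_ip x y ij b by simp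
      ultimately have "opE i (opE j (opE i f)) x = updown i x * (updown i y * f y + f x)" using L by simp
      also have "\<dots> = updown i x * f x + (updown i x * updown i y) * f y" by (simp add: algebra_simps)
      finally show ?thesis using ui L by simp
    next
      assume b: "ip x (\<alpha> j) = - ip x (\<alpha> i) \<and> ip y (\<alpha> j) = 0"
      let ?z = "act j x"
      have z: "?z \<in> orb" "ip ?z (\<alpha> i) = 0"
        using act_orb x ij ip_act[OF x(2) ij(2), of "\<alpha> i"] b r by auto
      have "opE j (opE i f) y = 0" using b act_fixed_iff[OF y(2) ij(2)] by (simp add: opE_def)
      moreover have "act j x \<noteq> x" using b a act_fixed_iff[OF x(2) ij(2)] by auto
      then have "opE j (opE i f) x = updown j x * opE i f x" using one[OF z] x by (simp add: opE_def[of j])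
      moreover have "updown j x = updown i y" using updown_ip x y ij b ya by simp
      ultimately have "opE i (opE j (opE i f)) x = (updown i x * updown i y) * opE i f x" using L by (simp add: mult.assoc)
      then show ?thesis using ui by simp
    qed
  qed (auto simp: opE_def)
qed

lemma canonical_up:
  assumes "z \<in> orb" "i \<in> nodes X" "rk z < rk (act i z)"
  shows "canonical (act i z) = opE i (canonical z)"
proof -
  obtain w where w: "rword w z" using assms by (auto simp: orb_def)
  then show ?thesis using canonical_eq[OF rword_snoc[OF w assms(2,3)]] canonical_eq[OF w] by (simp add: word_sum_snoc)
qed

text \<open>
  The span of the \<open>canonical z\<close> over the symmetric Laurent polynomials is stable under all generators.  If
  \<open>s\<^sub>i\<close> fixes \<open>z\<close>, the generator moves through the last letter of a word of \<open>z\<close>, or cancels against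
  the last two by \<open>E\<^sub>iE\<^sub>jE\<^sub>i = E\<^sub>i\<close>.
\<close>

lemma symspan_canonical:
  "rword w z \<Longrightarrow> i \<in> nodes X \<Longrightarrow> symspan canonical (rk z + 1) (opE i (canonical z)) \<and>
    (act i z = z \<longrightarrow> symspan canonical (rk z - 1) (opE i (canonical z)))"
proof (induction "length w" arbitrary: w z i rule: less_induct)
  case less
  note zp = rword_props[OF less.prems(1)]
  note i = less.prems(2)
  consider (up) "rk z < rk (act i z)" | (down) "rk (act i z) < rk z" | (fixed) "act i z = z"
    using moved_cases[OF zp(1) i] by blast
  then show ?case
  proof cases
    case up
    then have "rk (act i z) = rk z + 1" using rk_less_iff[OF zp(1) i] by simp
    then have "symspan canonical (rk z + 1) (canonical (act i z))" using symspan_self[of "act i z"] act_orb zp i by simp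
    then show ?thesis using up canonical_up zp i by auto
  next
    case down
    then obtain u where u: "rword (u @ [i]) z" using rword_descent less.prems by blast
    let ?y = "act i z"
    have y: "?y \<in> orb" "act i ?y = z" using act_orb act_act zp i by auto
    have "canonical z = opE i (canonical ?y)" using canonical_up[OF y(1) i] y down by simp
    then have "opE i (canonical z) = (\<lambda>x. qbar * canonical z x)" using opE_quad[OF i] by simp
    then have "symspan canonical (rk z + 1) (opE i (canonical z))"
      using symspan_scale[OF symspan_self[of z "rk z + 1" canonical] sym_laurent_qbar] zp by simp
    then show ?thesis using down by auto
  next
    case fixed
    have "symspan canonical (rk z - 1) (opE i (canonical z))"
    proof (cases w rule: rev_cases)
      case Nil
      then have z: "z = base" "canonical z = (\<lambda>x. if x = z then 1 else 0)"
        using less.prems canonical_eq[OF less.prems(1)] by (auto simp: rword_Nil_iff word_sum_Nil)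
      then show ?thesis using opE_point[of z i] zp i fixed by (simp add: symspan_zero)
    next
      case (snoc u j)
      note u = rword_snocD[OF less.prems(1)[unfolded snoc]]
      let ?y = "act j z"
      note yp = rword_props[OF u(1)]
      have ij: "i \<noteq> j" using fixed u by auto
      have jy: "act j ?y = z" using act_act zp u by simp
      have gz: "canonical z = opE j (canonical ?y)" using canonical_up[OF yp(5) u(2)] jy u(3) by simp
      have lu: "length u < length w" using snoc by simp
      show ?thesis
      proof (cases "cmat X i j = 2")
        case True
        then have "rk (act i ?y) = rk ?y"
          using rk_commute[of z j i] zp i u fixed by (simp add: cmat_sym)
        then have "act i ?y = ?y" by (rule iffD1[OF rk_eq_iff[OF yp(1) i]])
        then have S: "symspan canonical (rk ?y - 1) (opE i (canonical ?y))" using less.hyps[OF lu u(1) i] by blast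
        have "symspan canonical (rk ?y) (opE j (canonical y'))" if y': "y' \<in> orb" "rk y' \<le> rk ?y - 1" for y'
        proof -
          obtain w' where w': "rword w' y'" using y' by (auto simp: orb_def)
          have "length w' < length w" using rword_props(4)[OF w'] yp(4) y' lu by simp
          then have "symspan canonical (rk y' + 1) (opE j (canonical y'))" using less.hyps w' u by blast
          then show ?thesis using symspan_mono y' by fastforce
        qed
        then have "symspan canonical (rk ?y) (opE j (opE i (canonical ?y)))" using symspan_opE[OF _ S] by blast
        then show ?thesis using gz opE_commute[OF i u(2) True] u(4) by simp
      next
        case False
        then have three: "cmat X i j = 3" using cmat_two_three ij by blast
        have r: "ip (\<alpha> j) (\<alpha> i) = - 1" using ip_root[of j i] i u ij three by (simp add: cmat_sym)
        have "ip z (\<alpha> i) = 0" "ip z (\<alpha> j) = - 1"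
          using act_fixed_iff[OF zp(1) i] fixed desc_iff[OF zp(1) u(2)] u(3) by auto
        then have "ip ?y (\<alpha> i) = - 1" using ip_act[OF zp(1) u(2), of "\<alpha> i"] r by simp
        then have tdown: "rk (act i ?y) < rk ?y" using desc_iff yp i by blast
        let ?t = "act i ?y"
        have t: "?t \<in> orb" "act i ?t = ?y" using act_orb act_act yp i by auto
        have gy: "canonical ?y = opE i (canonical ?t)" using canonical_up[OF t(1) i] t tdown by simp
        have "opE i (canonical z) = canonical ?y" using opE_triple[OF i u(2) three] gz gy by simp
        then show ?thesis using symspan_self[of ?y "rk z - 1" canonical] yp u(4) by simp
      qed
    qed
    then show ?thesis using symspan_mono[of canonical "rk z - 1"] by auto
  qed
qed

lemma symspan_closed:
  assumes "symspan canonical r f" "i \<in> nodes X" shows "symspan canonical (r + 1) (opE i f)"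
proof (rule symspan_opE[OF _ assms(1)])
  fix z assume z: "z \<in> orb" "rk z \<le> r"
  then obtain w where "rword w z" by (auto simp: orb_def)
  then have "symspan canonical (rk z + 1) (opE i (canonical z))" using symspan_canonical assms by blast
  then show "symspan canonical (r + 1) (opE i (canonical z))" using symspan_mono z by fastforce
qed

end

section \<open>Type \<open>B\<close>\<close>

text \<open>
  The \<open>2n\<close> weights form a chain, indexed by \<open>-n, \<dots>, n - 1\<close>: the node \<open>i\<close> exchanges \<open>-i\<close> with
  \<open>1 - i\<close> and \<open>i - 2\<close> with \<open>i - 1\<close>; for \<open>i = 1\<close> these exchanges agree.
\<close>

definition rk_B :: "nat \<Rightarrow> int \<Rightarrow> real" where
  "rk_B n t = real_of_int (t + int n)"

lemma rk_B_less [simp]: "rk_B n s < rk_B n t \<longleftrightarrow> s < t" "rk_B n s \<le> rk_B n t \<longleftrightarrow> s \<le> t"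
  by (simp_all add: rk_B_def)

definition act_B :: "nat \<Rightarrow> int \<Rightarrow> int" where
  "act_B i t = (if t = - int i \<or> t = int i - 2 then t + 1
     else if t = 1 - int i \<or> t = int i - 1 then t - 1 else t)"

lemma cmat_B:
  assumes "i \<in> {1..n}" "j \<in> {1..n}" "i \<noteq> j"
  shows "cmat (PairB n) i j = 4 \<longleftrightarrow> (i = 1 \<and> j = 2) \<or> (i = 2 \<and> j = 1)"
    and "cmat (PairB n) i j = 3 \<longleftrightarrow> 2 \<le> i \<and> 2 \<le> j \<and> (j = i + 1 \<or> i = j + 1)"
    and "cmat (PairB n) i j = 2 \<longleftrightarrow> j \<noteq> i + 1 \<and> i \<noteq> j + 1"
proof -
  have s: "single_bonds (PairB n) = {{i, i + 1} |i. 2 \<le> i \<and> i < n}" by simp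
  have "cmat (PairB n) i j = (if (i = 1 \<and> j = 2) \<or> (i = 2 \<and> j = 1) then 4
    else if (j = i + 1 \<and> 2 \<le> i) \<or> (i = j + 1 \<and> 2 \<le> j) then 3 else 2)"
    unfolding cmat_def s path_bond_iff using assms by (auto simp: doubleton_eq_iff)
  then show "cmat (PairB n) i j = 4 \<longleftrightarrow> (i = 1 \<and> j = 2) \<or> (i = 2 \<and> j = 1)"
    and "cmat (PairB n) i j = 3 \<longleftrightarrow> 2 \<le> i \<and> 2 \<le> j \<and> (j = i + 1 \<or> i = j + 1)"
    and "cmat (PairB n) i j = 2 \<longleftrightarrow> j \<noteq> i + 1 \<and> i \<noteq> j + 1"
    using assms by auto
qed

lemma act_B_up: "1 \<le> i \<Longrightarrow> t < act_B i t \<longleftrightarrow> t = - int i \<or> t = int i - 2"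
  and act_B_down: "1 \<le> i \<Longrightarrow> act_B i t < t \<longleftrightarrow> t = 1 - int i \<or> t = int i - 1"
  unfolding act_B_def by presburger+

lemma act_B_step: "t < act_B i t \<Longrightarrow> act_B i t = t + 1" "act_B i t < t \<Longrightarrow> act_B i t = t - 1"
  unfolding act_B_def by presburger+

lemma act_B_braid_3:
  assumes "2 \<le> i"
  shows "act_B (i + 1) (act_B i (act_B (i + 1) (act_B i (act_B (i + 1) (act_B i t))))) = t"
    and "act_B i (act_B (i + 1) (act_B i (act_B (i + 1) (act_B i (act_B (i + 1) t))))) = t"
proof -
  consider "t = - int i - 1" | "t = - int i" | "t = 1 - int i" | "t = int i - 2" | "t = int i - 1" | "t = int i"
    | "t \<noteq> - int i - 1 \<and> t \<noteq> - int i \<and> t \<noteq> 1 - int i \<and> t \<noteq> int i - 2 \<and> t \<noteq> int i - 1 \<and> t \<noteq> int i"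
    by blast
  then show "act_B (i + 1) (act_B i (act_B (i + 1) (act_B i (act_B (i + 1) (act_B i t))))) = t"
    and "act_B i (act_B (i + 1) (act_B i (act_B (i + 1) (act_B i (act_B (i + 1) t))))) = t"
    using assms by (cases; simp add: act_B_def)+
qed

lemma act_B_braid_4:
  "act_B 2 (act_B 1 (act_B 2 (act_B 1 (act_B 2 (act_B 1 (act_B 2 (act_B 1 t))))))) = t"
  "act_B 1 (act_B 2 (act_B 1 (act_B 2 (act_B 1 (act_B 2 (act_B 1 (act_B 2 t))))))) = t"
proof -
  consider "t = - 2" | "t = - 1" | "t = 0" | "t = 1" | "t \<noteq> - 2 \<and> t \<noteq> - 1 \<and> t \<noteq> 0 \<and> t \<noteq> 1" by blast
  then show "act_B 2 (act_B 1 (act_B 2 (act_B 1 (act_B 2 (act_B 1 (act_B 2 (act_B 1 t))))))) = t"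
    "act_B 1 (act_B 2 (act_B 1 (act_B 2 (act_B 1 (act_B 2 (act_B 1 (act_B 2 t))))))) = t"
    by (cases; simp add: act_B_def)+
qed

lemma act_B_four:
  "act_B 1 t = t \<Longrightarrow> act_B 2 t \<noteq> t \<Longrightarrow> act_B 1 (act_B 2 t) \<noteq> act_B 2 t"
  "act_B 2 t = t \<Longrightarrow> act_B 1 t = t"
  by (simp_all add: act_B_def split: if_splits)

lemma act_B_invol: "act_B i (act_B i t) = t"
  unfolding act_B_def by (simp split: if_split) presburger

lemma act_B_far:
  assumes "1 \<le> i" "1 \<le> j" "i \<noteq> j" "j \<noteq> i + 1" "i \<noteq> j + 1" "act_B i t \<noteq> t"
  shows "act_B j t = t"
proof -
  have t: "t = - int i \<or> t = int i - 2 \<or> t = 1 - int i \<or> t = int i - 1"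
    using assms(6) by (metis act_B_def)
  consider "j \<ge> i + 2" | "i \<ge> j + 2" using assms(3-5) by linarith
  then show ?thesis
    using t assms(1,2) by cases (elim disjE; simp add: act_B_def)+
qed

lemma cox_model_B:
  assumes n: "2 \<le> n"
  shows "cox_model (PairB n) act_B (rk_B n) {- int n..int n - 1} (- int n) (real (2 * n))"
proof
  fix v assume v: "v \<in> {- int n..int n - 1}"
  show "rk_B n v \<le> real (2 * n)" using v by (simp add: rk_B_def)
  fix i assume "i \<in> nodes (PairB n)"
  then have i: "1 \<le> i" "i \<le> n" "i \<in> {1..n}" by (auto simp: nodes_def)
  show "act_B i v \<in> {- int n..int n - 1}" using v i by (auto simp: act_B_def)
  show "act_B i (act_B i v) = v" by (rule act_B_invol)
  show "rk_B n (act_B i v) = rk_B n v + 1 \<or>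
    rk_B n (act_B i v) = rk_B n v - 1" if "act_B i v \<noteq> v"
  proof -
    have "act_B i v = v + 1 \<or> act_B i v = v - 1" using that act_B_step by (meson linorder_neqE)
    then show ?thesis by (auto simp: rk_B_def)
  qed
  fix j assume "j \<in> nodes (PairB n)"
  then have j: "1 \<le> j" "j \<le> n" "j \<in> {1..n}" by (auto simp: nodes_def)
  note m = cmat_B[OF i(3) j(3)]
  have far: "act_B j (act_B i v) - act_B i v = act_B j v - v" if "cmat (PairB n) i j = 2"
  proof -
    have ne: "i \<noteq> j" using that by auto
    then have "j \<noteq> i + 1" "i \<noteq> j + 1" using m(3) that by auto
    note f = ne this
    show ?thesis
    proof (cases "act_B i v = v")
      case False
      then have "act_B i (act_B i v) \<noteq> act_B i v" using act_B_invol by metis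
      then show ?thesis using act_B_far[OF i(1) j(1) f, of v] act_B_far[OF i(1) j(1) f, of "act_B i v"] False by simp
    qed simp
  qed
  show "((\<lambda>v. act_B j (act_B i v)) ^^ cmat (PairB n) i j) v = v" if ne: "i \<noteq> j"
  proof -
    consider "cmat (PairB n) i j = 2" | "cmat (PairB n) i j = 3" | "cmat (PairB n) i j = 4"
      using cmat_cases ne by blast
    then show ?thesis
    proof cases
      case 1
      then have f: "j \<noteq> i + 1" "i \<noteq> j + 1" using m(3) ne by auto
      have "act_B i (act_B j v) = act_B j (act_B i v)"
        using act_B_far[OF i(1) j(1) ne f, of v] act_B_far[OF i(1) j(1) ne f, of "act_B i v"] far[OF 1] act_B_invol[of i v]
          act_B_far[OF j(1) i(1) ne[symmetric] f(2,1), of v] act_B_far[OF j(1) i(1) ne[symmetric] f(2,1), of "act_B j v"]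
          act_B_invol[of j v] by (cases "act_B i v = v"; cases "act_B j v = v") auto
      then show ?thesis using 1 by (simp add: eval_nat_numeral) (metis act_B_invol)
    next
      case 2
      then have "2 \<le> i \<and> j = i + 1 \<or> 2 \<le> j \<and> i = j + 1" using m(2) ne by auto
      then show ?thesis using 2 act_B_braid_3[of i v] act_B_braid_3[of j v] by (auto simp: eval_nat_numeral)
    next
      case 3
      then have "(i = 1 \<and> j = 2) \<or> (i = 2 \<and> j = 1)" using m(1) ne by auto
      then show ?thesis using 3 act_B_braid_4[of v]
        by (auto simp: numeral_eq_Suc simp del: One_nat_def) 
    qed
  qed
  show "cmat (PairB n) i j = 2"
    if "i \<noteq> j" "rk_B n v < rk_B n (act_B i v)"
      "rk_B n v < rk_B n (act_B j v)"
    using that act_B_up[OF i(1), of v] act_B_up[OF j(1), of v] i j by auto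
  show "cmat (PairB n) i j = 2"
    if "i \<noteq> j" "rk_B n (act_B i v) < rk_B n v"
      "rk_B n (act_B j v) < rk_B n v"
    using that act_B_down[OF i(1), of v] act_B_down[OF j(1), of v] i j by auto
  show "rk_B n (act_B j (act_B i v)) - rk_B n (act_B i v) =
    rk_B n (act_B j v) - rk_B n v" if "cmat (PairB n) i j = 2"
    using arg_cong[OF far[OF that], of real_of_int] by (simp add: rk_B_def)
  show "act_B i (act_B j v) \<noteq> act_B j v"
    if "cmat (PairB n) i j = 4" "act_B i v = v" "act_B j v \<noteq> v"
  proof -
    have "i \<noteq> j" using that by auto
    then have "(i = 1 \<and> j = 2) \<or> (i = 2 \<and> j = 1)" using m(1) that by auto
    then show ?thesis using that act_B_four by blast
  qed
next
  fix i assume "i \<in> nodes (PairB n)" "i \<noteq> omitted (PairB n)"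
  then show "act_B i (- int n) = - int n" by (auto simp: act_B_def nodes_def)
qed (use n in \<open>auto simp: nodes_def act_B_def rk_B_def\<close>)

text \<open>
  On a chain the Kazhdan-Lusztig family consists of the sums \<open>t + q (t - 1)\<close>, as for a projective
  space.  A generator maps such a sum to a combination, with coefficients \<open>1\<close> or \<open>q + q\<^sup>-\<^sup>1\<close>, of at most two
  sums of this form, so all path sums expand in them.  A path sum itself may have further terms, at
  points of smaller length; the standard condition removes these.
\<close>

theorem standard_bases_type_B:
  assumes n: "2 \<le> n" and rw: "\<And>y. y \<in> PW (PairB n) \<Longrightarrow> reduced_word (PairB n) y (rw y)"
  shows "standard_bases (PairB n) rw"
proof -
  interpret cox_model "PairB n" act_B "rk_B n" "{- int n..int n - 1}" "- int n" "real (2 * n)"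
    by (rule cox_model_B[OF n])
  define g :: "int \<Rightarrow> int \<Rightarrow> laurent" where
    "g t x = (if x \<notin> orb then 0 else if x = t then 1 else if x = t - 1 then qpow 1 else 0)" for t x
  have node: "1 \<le> i" if "i \<in> nodes (PairB n)" for i using that by (simp add: nodes_def)
  have range: "- int n \<le> t \<and> t \<le> int n - 1" if "t \<in> orb" for t using orb_Om[OF that] by simp
  have g_point: "g t = (\<lambda>x. (if x = t then 1 else 0) + qpow 1 * (if x \<in> orb \<and> x = t - 1 then 1 else 0))" if "t \<in> orb" for t
    using that by (auto simp: g_def)
  have point: "opE i (\<lambda>x. if x = t then 1 else 0) =
      (if act_B i t = t then (\<lambda>x. 0) else if t < act_B i t then g (t + 1) else (\<lambda>x. qpow (- 1) * g t x))"
    if t: "t \<in> orb" and i: "i \<in> nodes (PairB n)" for i t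
  proof -
    have o: "act_B i t \<in> orb" using act_orb[OF t i] .
    have up: "act_B i t = t + 1" if "t < act_B i t" using that by (rule act_B_step)
    have down: "act_B i t = t - 1" if "act_B i t < t" using that by (rule act_B_step)
    show ?thesis
      unfolding opE_point[OF t i] using t o up down
      by (auto simp: fun_eq_iff updown_def g_def qpow_mult qpow_0)
  qed
  have closed: "symspan g (real (2 * n)) (opE i (g t))" if t: "t \<in> orb" and i: "i \<in> nodes (PairB n)" for i t
  proof -
    have self: "symspan g (real (2 * n)) (g s)" if "s \<in> orb" for s
      using symspan_self that rk_bound orb_Om by blast
    let ?A = "opE i (\<lambda>x. if x = t then 1 else 0)"
    have split: "opE i (g t) = (\<lambda>x. ?A x + qpow 1 * opE i (\<lambda>x. if x \<in> orb \<and> x = t - 1 then 1 else 0) x)"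
      unfolding g_point[OF t] by (rule opE_linear)
    show ?thesis
    proof (cases "t - 1 \<in> orb")
      case False
      then have z: "(\<lambda>x. if x \<in> orb \<and> x = t - 1 then 1 else 0) = (\<lambda>x. 0 :: laurent)" by auto
      have "opE i (g t) = ?A" unfolding split z opE_zero by simp
      moreover have "\<not> act_B i t < t"
      proof
        assume "act_B i t < t"
        then have "act_B i t = t - 1" by (rule act_B_step)
        then show False using act_orb[OF t i] False by simp
      qed
      moreover have "t + 1 \<in> orb" if "t < act_B i t"
        using act_orb[OF t i] act_B_step(1)[OF that] by simp
      ultimately show ?thesis using self by (auto simp: point[OF t i] symspan_zero)
    next
      case True
      let ?B = "opE i (\<lambda>x. if x = t - 1 then 1 else 0)"
      have z: "(\<lambda>x. if x \<in> orb \<and> x = t - 1 then 1 else 0) = (\<lambda>x. if x = t - 1 then 1 else 0 :: laurent)"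
        using True by auto
      have E: "opE i (g t) = (\<lambda>x. ?A x + qpow 1 * ?B x)" unfolding split z ..
      have B: "qpow 1 * ?B x = (if act_B i (t - 1) = t - 1 then 0 else if t - 1 < act_B i (t - 1) then qpow 1 * g t x
         else g (t - 1) x)" for x
        using point[OF True i] by (simp add: mult.assoc[symmetric] qpow_mult qpow_0)
      consider (down) "act_B i t < t" | (up) "t < act_B i t" | (fixed) "act_B i t = t" by linarith
      then show ?thesis
      proof cases
        case down
        then have "t - 1 < act_B i (t - 1)"
          using act_B_up[OF node[OF i], of "t - 1"] act_B_down[OF node[OF i], of t] by presburger
        then have "opE i (g t) = (\<lambda>x. qbar * g t x)"
          unfolding E B using point[OF t i] down by (auto simp: algebra_simps)
        then show ?thesis using symspan_scale[OF self[OF t] sym_laurent_qbar] by simp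
      next
        case up
        then have n1: "\<not> t - 1 < act_B i (t - 1)"
          using act_B_up[OF node[OF i], of "t - 1"] act_B_up[OF node[OF i], of t] by presburger
        have o: "t + 1 \<in> orb" using act_orb[OF t i] act_B_step(1)[OF up] by simp
        have "opE i (g t) = (\<lambda>x. g (t + 1) x + (if act_B i (t - 1) = t - 1 then 0 else g (t - 1) x))"
          unfolding E B using point[OF t i] up n1 by auto
        then show ?thesis using symspan_plus[OF self[OF True] self[OF o]] self[OF o]
          by (cases "act_B i (t - 1) = t - 1") simp_all
      next
        case fixed
        then have n1: "\<not> t - 1 < act_B i (t - 1)"
          using act_B_up[OF node[OF i], of "t - 1"] act_B_down[OF node[OF i], of t] by presburger
        have "opE i (g t) = (\<lambda>x. if act_B i (t - 1) = t - 1 then 0 else g (t - 1) x)"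
          unfolding E B using point[OF t i] fixed n1 by auto
        then show ?thesis using self[OF True] symspan_zero
          by (cases "act_B i (t - 1) = t - 1") simp_all
      qed
    qed
  qed
  have word_sum_span: "symspan g (real (2 * n)) (word_sum w)" if "rword w v" for w v
    using that
  proof (induction rule: rword.induct)
    case rword_Nil
    have "word_sum [] = g (- int n)" using base_orb range[of "- int n - 1"] by (auto simp: word_sum_Nil g_def fun_eq_iff)
    moreover have "rk_B n (- int n) \<le> real (2 * n)" by (simp add: rk_B_def)
    ultimately show ?case using symspan_self[OF base_orb, of "real (2 * n)" g] by simp
  next
    case (rword_snoc w v i)
    then show ?case unfolding word_sum_snoc using symspan_opE closed by blast
  qed
  have next_wle: "wle x (x + 1)" if x: "x \<in> orb" "x + 1 \<in> orb" for x
  proof -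
    define i where "i = nat (if x < 0 then - x else x + 2)"
    have i: "i \<in> nodes (PairB n)" "act_B i x = x + 1"
      using range[OF x(1)] range[OF x(2)] by (auto simp: i_def nodes_def act_B_def)
    then show ?thesis using wle_one[OF x(1) i(1)] by simp
  qed
  have below: "word_sum w (v - 1) = qpow 1" if w: "rword w v" and o: "v - 1 \<in> orb" for w v
  proof (cases w rule: rev_cases)
    case Nil
    then show ?thesis using w o range[OF o] by (auto simp: rword_Nil_iff)
  next
    case (snoc u i)
    note u = rword_snocD[OF w[unfolded snoc]]
    have v: "act_B i v = v - 1" using u(3) by (intro act_B_step) simp
    have iv: "act_B i (v - 1) = v" using act_B_invol[of i v] v by simp
    have "word_sum u v = 0" using word_sum_above[OF u(1), of v] v by simp
    moreover have "word_sum u (v - 1) = 1" using word_sum_top[OF u(1)] v by simp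
    ultimately show ?thesis using o iv by (simp add: snoc word_sum_snoc opE_def updown_def)
  qed
  show ?thesis
  proof (rule standard_bases_if_monomial[where g = g])
    show "reduced_word (PairB n) y (rw y)" if "y \<in> PW (PairB n)" for y by (rule rw[OF that])
    show "g v x = 0 \<or> (\<exists>d. g v x = qpow d)" for x v
      using qpow_0 by (auto simp: g_def intro: exI[of _ 0])
    show "kl_poly (PairB n) (phi x) (phi v) = g v x" if "x \<in> orb" "v \<in> orb" for x v
    proof (rule kl_poly_model[OF _ _ _ _ that])
      show "g v v = 1" if "v \<in> orb" for v using that by (simp add: g_def)
      show "g v x \<in> q_ideal" if "x \<noteq> v" for v x
        using that by (simp add: g_def zero_q_ideal qpow_q_ideal)
      show "wle x v" if "v \<in> orb" "x \<in> orb" "g v x \<noteq> 0" for v x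
        using that next_wle[of x] wle_refl by (auto simp: g_def split: if_splits)
      show "\<exists>c. (\<forall>z\<in>orb. c z \<in> sym_laurent) \<and> (\<forall>x\<in>orb. word_sum w x = (\<Sum>z\<in>orb. c z * g z x))" if "rword w v" for w v
        using symspan_expand[OF word_sum_span[OF that]] .
    qed
    show "(if standard (PairB n) (phi x) w then word_sum w x else 0) = g v x" if w: "rword w v" and x: "x \<in> orb" for w v x
    proof -
      have v: "v \<in> orb" using rword_props(5)[OF w] .
      have len: "int (cox_len (phi t)) = t + int n" if "t \<in> orb" for t
      proof -
        have "real (cox_len (phi t)) = real_of_int (t + int n)"
          by (rule HOL.trans[OF cox_len_phi[OF that] rk_B_def])
        then show ?thesis by (metis of_int_eq_iff of_int_of_nat_eq)
      qed
      have "int (cox_len (elt_of (PairB n) w)) - int (cox_len (phi x)) = v - x"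
        using len[OF x] len[OF v] phi_rword[OF w] by simp
      then have "standard (PairB n) (phi x) w \<longleftrightarrow> x = v \<or> x = v - 1" by auto
      then show ?thesis using word_sum_top[OF w] below[OF w] x by (auto simp: g_def)
    qed
  qed
qed

section \<open>Stacking a generator on a tangle\<close>

definition boundary :: "nat \<Rightarrow> vertex set" where
  "boundary N = South ` {1..N} \<union> North ` {1..N}"

definition matching :: "nat \<Rightarrow> (vertex \<Rightarrow> vertex) \<Rightarrow> vertex set \<Rightarrow> bool" where
  "matching N m Bd \<longleftrightarrow> (\<forall>u\<in>boundary N. m u \<in> boundary N \<and> m (m u) = u \<and> m u \<noteq> u) \<and>
     Bd \<subseteq> boundary N \<and> (\<forall>u\<in>Bd. m u \<in> Bd)"

text \<open>
  The strands as a fixed point free involution of the boundary, with the set of the ends of the beaded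
  strands.
\<close>

definition tangle_of :: "nat \<Rightarrow> (vertex \<Rightarrow> vertex) \<Rightarrow> vertex set \<Rightarrow> tangle" where
  "tangle_of N m Bd = \<lparr>strands = (\<lambda>u. {u, m u}) ` boundary N, beaded = (\<lambda>u. {u, m u}) ` Bd\<rparr>"

text \<open>
  The strands after stacking the generator \<open>i\<close>: the cup of the generator joins the strands that ended at
  \<open>i\<close> and \<open>i + 1\<close> into one, and the cap on top is new.
\<close>

definition glue :: "nat \<Rightarrow> (vertex \<Rightarrow> vertex) \<Rightarrow> vertex \<Rightarrow> vertex" where
  "glue i m u =
    (if u = North i then North (i + 1) else if u = North (i + 1) then North i
     else if u = m (North i) then m (North (i + 1)) else if u = m (North (i + 1)) then m (North i) else m u)"

text \<open>
  The beads after stacking the generator \<open>i\<close>; those of a joined strand come from either part or from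
  the cup of the generator, which carries a bead if \<open>i = 1\<close>.
\<close>

definition glue_beads :: "nat \<Rightarrow> (vertex \<Rightarrow> vertex) \<Rightarrow> vertex set \<Rightarrow> vertex set" where
  "glue_beads i m Bd = (if i = 1 then {North i, North (i + 1)} else {}) \<union> (Bd - {North i, North (i + 1)}) \<union>
     (if i = 1 \<or> North i \<in> Bd \<or> North (i + 1) \<in> Bd then {m (North i), m (North (i + 1))} else {})"

fun swap_ends :: "vertex \<Rightarrow> vertex" where
  "swap_ends (South j) = North j"
| "swap_ends (North j) = South j"
| "swap_ends (Mid j) = Mid j"

lemma matching_id: "matching N swap_ends {}"
  by (auto simp: matching_def boundary_def)

lemma id_tangle_eq: "id_tangle N = tangle_of N swap_ends {}"
proof -
  have "{{South j, North j} |j. j \<in> {1..N}} = (\<lambda>u. {u, swap_ends u}) ` boundary N"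
    unfolding boundary_def image_Un image_image by (auto simp: insert_commute)
  then show ?thesis by (simp add: id_tangle_def tangle_of_def)
qed

text \<open>
  The last assumption excludes that a closed loop arises.
\<close>

locale gluing =
  fixes N i :: nat and m :: "vertex \<Rightarrow> vertex" and Bd :: "vertex set"
  assumes m: "matching N m Bd" and i: "1 \<le> i" "i + 1 \<le> N" and ne: "m (North i) \<noteq> North (i + 1)"
begin

abbreviation "p \<equiv> m (North i)"
abbreviation "p' \<equiv> m (North (i + 1))"
abbreviation "m' \<equiv> glue i m"

lemma ends: "North i \<in> boundary N" "North (i + 1) \<in> boundary N"
  using i by (auto simp: boundary_def)

lemma mm: "u \<in> boundary N \<Longrightarrow> m u \<in> boundary N" "u \<in> boundary N \<Longrightarrow> m (m u) = u" "u \<in> boundary N \<Longrightarrow> m u \<noteq> u"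
  using m by (auto simp: matching_def)

lemma m_Bd: "u \<in> Bd \<Longrightarrow> m u \<in> Bd" "u \<in> Bd \<Longrightarrow> u \<in> boundary N"
  using m by (auto simp: matching_def)

lemma pp: "m p = North i" "m p' = North (i + 1)" "p \<noteq> North i" "p \<noteq> North (i + 1)"
    "p' \<noteq> North i" "p' \<noteq> North (i + 1)" "p \<noteq> p'" "p \<in> boundary N" "p' \<in> boundary N"
proof -
  show a: "m p = North i" "m p' = North (i + 1)" "p \<noteq> North i" "p \<noteq> North (i + 1)" "p' \<noteq> North (i + 1)"
    "p \<in> boundary N" "p' \<in> boundary N"
    using mm ends ne by auto
  show "p' \<noteq> North i" using a(2) ne by metis
  show "p \<noteq> p'" using a(1,2) by (metis n_not_Suc_n Suc_eq_plus1 vertex.inject(3))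
qed

lemma glue_values: "m' (North i) = North (i + 1)" "m' (North (i + 1)) = North i" "m' p = p'" "m' p' = p"
  using pp by (simp_all add: glue_def)

lemma glue_other: "u \<notin> {North i, North (i + 1), p, p'} \<Longrightarrow> m' u = m u"
  by (simp add: glue_def)

lemma other_m:
  assumes "u \<in> boundary N" "u \<notin> {North i, North (i + 1), p, p'}"
  shows "m u \<notin> {North i, North (i + 1), p, p'}"
  using assms mm(2)[OF assms(1)] pp by (metis insertE insertI1 insertI2 singletonD)

lemma matching_glue: "matching N m' (glue_beads i m Bd)"
proof -
  have "m' u \<in> boundary N \<and> m' (m' u) = u \<and> m' u \<noteq> u" if u: "u \<in> boundary N" for u
  proof (cases "u \<in> {North i, North (i + 1), p, p'}")
    case True
    then show ?thesis using glue_values ends pp by auto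
  next
    case False
    then show ?thesis using glue_other[OF False] glue_other[OF other_m[OF u False]] mm[OF u] by simp
  qed
  moreover have "m' u \<in> glue_beads i m Bd" if u: "u \<in> glue_beads i m Bd" for u
  proof (cases "u \<in> {North i, North (i + 1), p, p'}")
    case True
    have *: "p \<in> Bd \<longleftrightarrow> North i \<in> Bd" "p' \<in> Bd \<longleftrightarrow> North (i + 1) \<in> Bd"
      using m_Bd(1)[of p] m_Bd(1)[of "North i"] m_Bd(1)[of p'] m_Bd(1)[of "North (i + 1)"] pp by auto
    from True show ?thesis
      using u * glue_values pp by (auto simp: glue_beads_def split: if_splits)
  next
    case False
    then have "u \<in> Bd" using u by (auto simp: glue_beads_def split: if_splits)
    then show ?thesis
      using glue_other[OF False] other_m[OF m_Bd(2) False] m_Bd by (simp add: glue_beads_def)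
  qed
  moreover have "glue_beads i m Bd \<subseteq> boundary N"
    using ends pp m_Bd by (auto simp: glue_beads_def split: if_splits)
  ultimately show ?thesis by (simp add: matching_def)
qed

abbreviation "d \<equiv> tangle_of N m Bd"
abbreviation "e \<equiv> gen_tangle N i"
abbreviation "J \<equiv> joined d e"

lemma lower_piece: "u \<in> boundary N \<Longrightarrow> {to_lower u, to_lower (m u)} \<in> pieces d e"
  by (auto simp: pieces_def tangle_of_def image_iff intro!: bexI[of _ u])

lemma upper_pieces:
  "{Mid i, Mid (i + 1)} \<in> pieces d e" "{North i, North (i + 1)} \<in> pieces d e"
  "j \<in> {1..N} - {i, i + 1} \<Longrightarrow> {Mid j, North j} \<in> pieces d e"
proof -
  have upper: "to_upper ` s \<in> pieces d e" if "s \<in> strands e" for s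
    using that by (simp add: pieces_def)
  have "{South i, South (i + 1)} \<in> strands e" "{North i, North (i + 1)} \<in> strands e"
    by (simp_all add: gen_tangle_def)
  from this[THEN upper] show "{Mid i, Mid (i + 1)} \<in> pieces d e" "{North i, North (i + 1)} \<in> pieces d e"
    by simp_all
  show "{Mid j, North j} \<in> pieces d e" if "j \<in> {1..N} - {i, i + 1}"
  proof -
    have "{South j, North j} \<in> strands e" unfolding gen_tangle_def tangle.simps using that by blast
    from upper[OF this] show ?thesis by simp
  qed
qed

lemma pieces_cases:
  assumes "s \<in> pieces d e"
  obtains u where "u \<in> boundary N" "s = {to_lower u, to_lower (m u)}"
  | "s = {Mid i, Mid (i + 1)}" | "s = {North i, North (i + 1)}"
  | j where "j \<in> {1..N} - {i, i + 1}" "s = {Mid j, North j}"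
  using assms by (auto simp: pieces_def tangle_of_def gen_tangle_def)

lemma J_refl: "(u, u) \<in> J"
  by (simp add: joined_def)

lemma J_trans: "(u, v) \<in> J \<Longrightarrow> (v, w) \<in> J \<Longrightarrow> (u, w) \<in> J"
  unfolding joined_def by (rule rtrancl_trans)

lemma J_sym: "(u, v) \<in> J \<Longrightarrow> (v, u) \<in> J"
proof -
  have "sym {(u, v). \<exists>s\<in>pieces d e. u \<in> s \<and> v \<in> s}" by (auto simp: sym_def)
  from symD[OF sym_rtrancl[OF this]] show "(u, v) \<in> J \<Longrightarrow> (v, u) \<in> J" unfolding joined_def .
qed

lemma J_piece: "s \<in> pieces d e \<Longrightarrow> u \<in> s \<Longrightarrow> v \<in> s \<Longrightarrow> (u, v) \<in> J"
  unfolding joined_def by (intro r_into_rtrancl) auto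

text \<open>
  An outer vertex on the same strand of the stacked tangle.  Both glued vertices \<open>i\<close> and \<open>i + 1\<close> lie on
  the strand ending at \<open>p\<close>.
\<close>

definition rep :: "vertex \<Rightarrow> vertex" where
  "rep v = (case v of Mid j \<Rightarrow> if j = i \<or> j = i + 1 then p else North j | _ \<Rightarrow> v)"

text \<open>
  This is constant on every piece, hence on chains of pieces, and so shows that there are no strands
  but the expected ones.
\<close>

definition strand_of :: "vertex \<Rightarrow> vertex set" where
  "strand_of v = {rep v, m' (rep v)}"

lemma rep_outer: "outer v \<Longrightarrow> rep v = v"
  by (cases v) (auto simp: rep_def)

lemma outer_boundary: "v \<in> boundary N \<Longrightarrow> outer v"
  by (auto simp: boundary_def)

lemma rep_lower: "v \<in> boundary N \<Longrightarrow> rep (to_lower v) = (if v = North i \<or> v = North (i + 1) then p else v)"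
  by (auto simp: boundary_def rep_def split: if_splits)

lemma strand_of_piece: "s \<in> pieces d e \<Longrightarrow> u \<in> s \<Longrightarrow> v \<in> s \<Longrightarrow> strand_of u = strand_of v"
proof -
  have lower: "strand_of (to_lower u) = strand_of (to_lower (m u))" if u: "u \<in> boundary N" for u
  proof (cases "u \<in> {North i, North (i + 1), p, p'}")
    case True
    then show ?thesis
      using rep_lower[OF u] rep_lower[OF mm(1)[OF u]] glue_values pp by (auto simp: strand_of_def)
  next
    case False
    then show ?thesis
      using rep_lower[OF u] rep_lower[OF mm(1)[OF u]] glue_other[OF False] glue_other[OF other_m[OF u False]]
        other_m[OF u False] mm(2)[OF u] by (auto simp: strand_of_def)
  qed
  assume "s \<in> pieces d e" "u \<in> s" "v \<in> s"
  then show "strand_of u = strand_of v"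
  proof (cases rule: pieces_cases)
    case (1 x)
    then show ?thesis using lower[of x] \<open>u \<in> s\<close> \<open>v \<in> s\<close> by auto
  next
    case 2
    then show ?thesis using \<open>u \<in> s\<close> \<open>v \<in> s\<close> by (auto simp: strand_of_def rep_def)
  next
    case 3
    then show ?thesis using \<open>u \<in> s\<close> \<open>v \<in> s\<close> glue_values by (auto simp: strand_of_def rep_def)
  next
    case (4 j)
    then show ?thesis using \<open>u \<in> s\<close> \<open>v \<in> s\<close> by (auto simp: strand_of_def rep_def)
  qed
qed

lemma strand_of_joined: "(u, v) \<in> J \<Longrightarrow> strand_of u = strand_of v"
  unfolding joined_def by (induction rule: rtrancl_induct) (use strand_of_piece in blast)+

lemma to_lower_joined: "u \<in> boundary N \<Longrightarrow> u \<notin> {North i, North (i + 1)} \<Longrightarrow> (u, to_lower u) \<in> J"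
  by (auto simp: boundary_def intro: J_refl J_piece[OF upper_pieces(3)])

lemma arc_joined: "u \<in> boundary N \<Longrightarrow> (to_lower u, to_lower (m u)) \<in> J"
  by (rule J_piece[OF lower_piece]) auto

lemma p_joined: "(p, Mid i) \<in> J" "(p', Mid (i + 1)) \<in> J" "(p, p') \<in> J"
proof -
  show 1: "(p, Mid i) \<in> J"
    using J_trans[OF to_lower_joined[of p] arc_joined[of p]] pp by simp
  show 2: "(p', Mid (i + 1)) \<in> J"
    using J_trans[OF to_lower_joined[of p'] arc_joined[of p']] pp by simp
  have "(Mid i, Mid (i + 1)) \<in> J" by (rule J_piece[OF upper_pieces(1)]) auto
  then show "(p, p') \<in> J" using 1 2 J_trans J_sym by blast
qed

lemma glue_joined:
  assumes u: "u \<in> boundary N" shows "(u, m' u) \<in> J"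
proof (cases "u \<in> {North i, North (i + 1), p, p'}")
  case True
  have "(North i, North (i + 1)) \<in> J" by (rule J_piece[OF upper_pieces(2)]) auto
  then show ?thesis using True glue_values p_joined(3) J_sym by auto
next
  case False
  have "(u, to_lower (m u)) \<in> J" using J_trans[OF to_lower_joined[OF u] arc_joined[OF u]] False by simp
  moreover have "(to_lower (m u), m u) \<in> J"
    using J_sym[OF to_lower_joined[OF mm(1)[OF u]]] other_m[OF u False] by simp
  ultimately show ?thesis using J_trans glue_other[OF False] by metis
qed

lemma joined_outer:
  assumes "u \<noteq> v" "outer u" "outer v" "(u, v) \<in> J"
  shows "u \<in> boundary N" "v = m' u"
proof -
  obtain x where "(u, x) \<in> {(u, v). \<exists>s\<in>pieces d e. u \<in> s \<and> v \<in> s}"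
    using assms(1,4) unfolding joined_def by (meson converse_rtranclE)
  then obtain s where s: "s \<in> pieces d e" "u \<in> s" by auto
  then show u: "u \<in> boundary N"
  proof (cases rule: pieces_cases)
    case (1 x)
    have "to_lower y \<in> boundary N" if "outer (to_lower y)" "y \<in> boundary N" for y
      using that by (cases y) auto
    then show ?thesis using 1 s(2) assms(2) mm(1)[of x] by auto
  qed (use s(2) assms(2) ends in \<open>auto simp: boundary_def\<close>)
  have "{u, m' u} = {v, m' v}"
    using strand_of_joined[OF assms(4)] assms by (simp add: strand_of_def rep_outer)
  then show "v = m' u" using assms(1) by (metis doubleton_eq_iff)
qed

lemma stack_strands: "strands (stack d e) = (\<lambda>u. {u, m' u}) ` boundary N"
proof (intro equalityI subsetI)
  fix s assume "s \<in> strands (stack d e)"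
  then obtain u v where "s = {u, v}" "u \<noteq> v" "outer u" "outer v" "(u, v) \<in> J" by (auto simp: stack_def)
  then show "s \<in> (\<lambda>u. {u, m' u}) ` boundary N" using joined_outer by blast
next
  fix s assume "s \<in> (\<lambda>u. {u, m' u}) ` boundary N"
  then obtain u where u: "u \<in> boundary N" "s = {u, m' u}" by blast
  have "m' u \<in> boundary N" "m' u \<noteq> u" using matching_glue u by (auto simp: matching_def)
  then have "u \<noteq> m' u \<and> outer u \<and> outer (m' u) \<and> (u, m' u) \<in> J"
    using u glue_joined[OF u(1)] outer_boundary by auto
  then show "s \<in> strands (stack d e)"
    unfolding stack_def u(2) tangle.simps mem_Collect_eq by (intro exI[of _ u] exI[of _ "m' u"]) simp
qed

lemma beaded_pieces_eq:
  "beaded_pieces d e = (\<lambda>u. {to_lower u, to_lower (m u)}) ` Bd \<union>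
     (if i = 1 then {{Mid i, Mid (i + 1)}, {North i, North (i + 1)}} else {})"
  by (auto simp: beaded_pieces_def tangle_of_def gen_tangle_def image_image)

lemma beaded_lower: "u \<in> Bd \<Longrightarrow> {to_lower u, to_lower (m u)} \<in> beaded_pieces d e"
  unfolding beaded_pieces_eq by blast

lemma stack_beaded: "beaded (stack d e) = (\<lambda>u. {u, m' u}) ` glue_beads i m Bd"
proof (intro equalityI subsetI)
  fix t assume "t \<in> beaded (stack d e)"
  then obtain u v s x where u: "t = {u, v}" "u \<noteq> v" "outer u" "outer v" "(u, v) \<in> J"
    and s: "s \<in> beaded_pieces d e" "x \<in> s" "(u, x) \<in> J" by (auto simp: stack_def)
  have "rep x \<in> glue_beads i m Bd"
  proof -
    have low: "rep (to_lower y) \<in> glue_beads i m Bd" if "y \<in> Bd" for y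
      using that rep_lower[of y] m_Bd by (auto simp: glue_beads_def)
    consider y where "y \<in> Bd" "x = to_lower y" | "i = 1" "x = Mid i \<or> x = Mid (i + 1)"
      | "i = 1" "x = North i \<or> x = North (i + 1)"
      using s(1,2) m_Bd(1) unfolding beaded_pieces_eq by (auto split: if_splits)
    then show ?thesis
    proof cases
      case 1
      then show ?thesis using low by simp
    next
      case 2
      have "rep (Mid i) = p" "rep (Mid (i + 1)) = p" by (simp_all add: rep_def)
      with 2(2) have "rep x = p" by metis
      moreover have "p \<in> glue_beads i m Bd" using 2(1) by (simp add: glue_beads_def)
      ultimately show ?thesis by (simp only:)
    next
      case 3
      have "rep (North i) = North i" "rep (North (i + 1)) = North (i + 1)" by (simp_all add: rep_def)
      with 3(2) have "rep x = x" by metis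
      moreover have "x \<in> glue_beads i m Bd" using 3 by (auto simp: glue_beads_def)
      ultimately show ?thesis by (simp only:)
    qed
  qed
  moreover have "t = {rep x, m' (rep x)}"
    using joined_outer[OF u(2-5)] u(1) strand_of_joined[OF s(3)] rep_outer[OF u(3)] by (simp add: strand_of_def)
  ultimately show "t \<in> (\<lambda>u. {u, m' u}) ` glue_beads i m Bd" by blast
next
  fix t assume "t \<in> (\<lambda>u. {u, m' u}) ` glue_beads i m Bd"
  then obtain u where u: "u \<in> glue_beads i m Bd" "t = {u, m' u}" by blast
  have ub: "u \<in> boundary N" "m' u \<in> boundary N" "m' u \<noteq> u"
    using matching_glue u by (auto simp: matching_def)
  have bead: "\<exists>s\<in>beaded_pieces d e. \<exists>x\<in>s. (u, x) \<in> J"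
  proof -
    consider (north) "i = 1" "u = North i \<or> u = North (i + 1)"
      | (old) "u \<in> Bd" "u \<notin> {North i, North (i + 1)}"
      | (new) "i = 1" "u = p \<or> u = p'" | (left) "North i \<in> Bd" "u = p \<or> u = p'" | (right) "North (i + 1) \<in> Bd" "u = p \<or> u = p'"
      using u(1) by (auto simp: glue_beads_def split: if_splits)
    then show ?thesis
    proof cases
      case north
      then have "{North i, North (i + 1)} \<in> beaded_pieces d e" unfolding beaded_pieces_eq by simp
      then show ?thesis using north J_refl by blast
    next
      case old
      then have "{to_lower u, to_lower (m u)} \<in> beaded_pieces d e" by (intro beaded_lower)
      then show ?thesis using to_lower_joined[OF ub(1) old(2)] by blast
    next
      case new
      then have "{Mid i, Mid (i + 1)} \<in> beaded_pieces d e" unfolding beaded_pieces_eq by simp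
      then show ?thesis using new p_joined by blast
    next
      case left
      then have "{to_lower (North i), to_lower p} \<in> beaded_pieces d e" by (intro beaded_lower)
      moreover have "(u, Mid i) \<in> J" using left p_joined J_sym J_trans by blast
      ultimately show ?thesis by (intro bexI[of _ "{to_lower (North i), to_lower p}"] bexI[of _ "Mid i"]) auto
    next
      case right
      then have "{to_lower (North (i + 1)), to_lower p'} \<in> beaded_pieces d e" by (intro beaded_lower)
      moreover have "(u, Mid (i + 1)) \<in> J" using right p_joined J_sym J_trans by blast
      ultimately show ?thesis by (intro bexI[of _ "{to_lower (North (i + 1)), to_lower p'}"] bexI[of _ "Mid (i + 1)"]) auto
    qed
  qed
  have "u \<noteq> m' u \<and> outer u \<and> outer (m' u) \<and> (u, m' u) \<in> J"
    using ub outer_boundary glue_joined by auto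
  then show "t \<in> beaded (stack d e)"
    unfolding stack_def u(2) tangle.simps mem_Collect_eq using bead
    by (intro exI[of _ u] exI[of _ "m' u"]) simp
qed

lemma stack_glue: "stack d e = tangle_of N m' (glue_beads i m Bd)"
  using stack_strands stack_beaded by (simp add: tangle_of_def)

end

section \<open>Type \<open>C\<close>\<close>

text \<open>
  A sequence of symbols is encoded by the signs of the coordinates \<open>2, \<dots>, n + 1\<close>, positive for \<open>\<or>\<close>.  The
  first coordinate, in the place of \<open>\<circ>\<close>, keeps the number of negative coordinates even: in this way the
  sequences become the weights of a half-spin representation of \<open>D\<^sub>n\<^sub>+\<^sub>1\<close>.
\<close>

definition act_C :: "nat \<Rightarrow> (nat \<Rightarrow> real) \<Rightarrow> nat \<Rightarrow> real" where
  "act_C i v = (if i = 1 then v(1 := - v 1, 2 := - v 2) else v(i := v (i + 1), i + 1 := v i))"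

definition pair_D :: "nat \<Rightarrow> hs_pair" where
  "pair_D n = PairDA (n + 1) 1"

definition ip_C :: "nat \<Rightarrow> (nat \<Rightarrow> real) \<Rightarrow> (nat \<Rightarrow> real) \<Rightarrow> real" where
  "ip_C n = dot {1..n + 1}"

definition ht_C :: "nat \<Rightarrow> (nat \<Rightarrow> real) \<Rightarrow> real" where
  "ht_C n = dot {1..n + 1} (\<lambda>p. real p - 1)"

definition halves :: "(nat \<Rightarrow> real) set" where
  "halves = {v. \<forall>p. v p = 1/2 \<or> v p = - 1/2}"

definition base_C :: "nat \<Rightarrow> real" where
  "base_C = (\<lambda>p. 1/2)"

definition bound_C :: "nat \<Rightarrow> real" where
  "bound_C n = (\<Sum>p\<in>{1..n + 1}. \<bar>real p - 1\<bar> * 4)"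

lemma halves_cases: "v \<in> halves \<Longrightarrow> v p = 1/2 \<or> v p = - 1/2"
  by (simp add: halves_def)

lemma cmat_C: "cmat (PairC n) = cmat (PairB n)"
  by (simp add: cmat_def fun_eq_iff)

lemma cmat_pair_D:
  assumes "2 \<le> n" "i \<in> {1..n + 1}" "j \<in> {1..n + 1}" "i \<noteq> j"
  shows "cmat (pair_D n) i j = (if (i = 1 \<and> j = 3) \<or> (i = 3 \<and> j = 1) \<or>
      (2 \<le> i \<and> 2 \<le> j \<and> (j = i + 1 \<or> i = j + 1)) then 3 else 2)"
proof -
  have s: "single_bonds (PairDA (n + 1) 1) = insert {1, 3} {{i, i + 1} |i. 2 \<le> i \<and> i < n + 1}"
    and d: "double_bonds (PairDA (n + 1) 1) = {}" by simp_all
  show ?thesis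
    unfolding pair_D_def cmat_def s d insert_iff path_bond_iff
    using assms by (auto simp: doubleton_eq_iff)
qed

lemma act_C_braid_4:
  "act_C 2 (act_C 1 (act_C 2 (act_C 1 (act_C 2 (act_C 1 (act_C 2 (act_C 1 v))))))) = v"
  "act_C 1 (act_C 2 (act_C 1 (act_C 2 (act_C 1 (act_C 2 (act_C 1 (act_C 2 v))))))) = v"
  by (rule ext; simp add: act_C_def)+

lemma act_C_braid_3:
  assumes "2 \<le> i"
  shows "act_C (i + 1) (act_C i (act_C (i + 1) (act_C i (act_C (i + 1) (act_C i v))))) = v"
    and "act_C i (act_C (i + 1) (act_C i (act_C (i + 1) (act_C i (act_C (i + 1) v))))) = v"
  using assms by (auto simp: act_C_def fun_eq_iff)

lemma act_C_invol: "act_C i (act_C i v) = v"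
  by (auto simp: act_C_def fun_eq_iff)

lemma act_C_far:
  assumes "1 \<le> i" "1 \<le> j" "i \<noteq> j" "j \<noteq> i + 1" "i \<noteq> j + 1"
  shows "act_C i (act_C j v) = act_C j (act_C i v)"
  using assms by (auto simp: act_C_def fun_eq_iff)

lemma act_C_off: "p \<noteq> i \<Longrightarrow> p \<noteq> i + 1 \<Longrightarrow> act_C i v p = v p"
  by (auto simp: act_C_def)

text \<open>
  The reflection of type \<open>D\<close> with the same effect on \<open>v\<close> as the reflection \<open>i\<close> of type \<open>C\<close>.  At the
  fork it depends on \<open>v\<close>.
\<close>

definition lift_node :: "nat \<Rightarrow> (nat \<Rightarrow> real) \<Rightarrow> nat" where
  "lift_node i v = (if i = 1 then (if v 1 = v 2 then 1 else 2) else i + 1)"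

locale type_C =
  fixes n :: nat
  assumes n: "2 \<le> n"
begin

sublocale D: minuscule "pair_D n" "ip_C n" "ht_C n" root_D halves base_C "bound_C n"
  using minuscule_DA[of "n + 1" 1] n
  by (simp add: pair_D_def ip_C_def ht_C_def halves_def base_C_def bound_C_def)

abbreviation rk :: "(nat \<Rightarrow> real) \<Rightarrow> real" where
  "rk \<equiv> D.rk"

lemma nodes_D: "nodes (pair_D n) = {1..n + 1}"
  by (simp add: nodes_def pair_D_def)

lemma nodes_C: "nodes (PairC n) = {1..n}"
  by (simp add: nodes_def)

lemma ip_root_D:
  "ip_C n v (root_D 1) = v 1 + v 2" "ip_C n v (root_D 2) = v 2 - v 1"
  "i \<in> {2..n} \<Longrightarrow> ip_C n v (root_D (i + 1)) = v (i + 1) - v i"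
proof -
  have a: "3 \<le> n + 1" "1 \<in> {1..n + 1}" "2 \<in> {1..n + 1}" using n by auto
  show "ip_C n v (root_D 1) = v 1 + v 2" "ip_C n v (root_D 2) = v 2 - v 1"
    unfolding ip_C_def dot_root_D[OF a(1,2)] dot_root_D[OF a(1,3)] by simp_all
  assume i: "i \<in> {2..n}"
  then have "i + 1 \<in> {1..n + 1}" by auto
  then show "ip_C n v (root_D (i + 1)) = v (i + 1) - v i"
    unfolding ip_C_def using dot_root_D[OF a(1)] i by auto
qed

lemma act_D:
  assumes "v \<in> halves"
  shows "D.act 1 v = (if v 1 = v 2 then act_C 1 v else v)"
    and "D.act 2 v = (if v 1 = v 2 then v else act_C 1 v)"
    and "i \<in> {2..n} \<Longrightarrow> D.act (i + 1) v = act_C i v"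
proof -
  note h = halves_cases[OF assms]
  have flip: "act_C 1 v = v(1 := - v 1, 2 := - v 2)" by (simp add: act_C_def)
  have D1: "v - root_D 1 = v(1 := v 1 - 1, 2 := v 2 - 1)" "v + root_D 1 = v(1 := v 1 + 1, 2 := v 2 + 1)"
    by (rule ext; simp add: root_D_def unit_vec_def)+
  have D2: "v - root_D 2 = v(1 := v 1 + 1, 2 := v 2 - 1)" "v + root_D 2 = v(1 := v 1 - 1, 2 := v 2 + 1)"
    by (rule ext; simp add: root_D_def unit_vec_def)+
  show "D.act 1 v = (if v 1 = v 2 then act_C 1 v else v)"
    unfolding minuscule_act_def ip_root_D D1 flip
    by (rule disjE[OF h[of 1]]; rule disjE[OF h[of 2]]) (auto simp: fun_eq_iff)
  show "D.act 2 v = (if v 1 = v 2 then v else act_C 1 v)"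
    unfolding minuscule_act_def ip_root_D D2 flip
    by (rule disjE[OF h[of 1]]; rule disjE[OF h[of 2]]) (auto simp: fun_eq_iff)
  assume i: "i \<in> {2..n}"
  then have i1: "i \<noteq> 1" by simp
  then have swap: "act_C i v = v(i := v (i + 1), i + 1 := v i)" by (simp add: act_C_def)
  have Di: "v - root_D (i + 1) = v(i := v i + 1, i + 1 := v (i + 1) - 1)"
    "v + root_D (i + 1) = v(i := v i - 1, i + 1 := v (i + 1) + 1)"
    using i by (auto simp: root_D_def unit_vec_def fun_eq_iff)
  show "D.act (i + 1) v = act_C i v"
    unfolding minuscule_act_def ip_root_D(3)[OF i] Di swap
    by (rule disjE[OF h[of i]]; rule disjE[OF h[of "i + 1"]]) (auto simp: fun_eq_iff)
qed

lemma node_cases: "i \<in> {1..n} \<Longrightarrow> i = 1 \<or> i \<in> {2..n}"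
  by auto

lemma act_C_lift:
  assumes "v \<in> halves" "i \<in> {1..n}"
  shows "act_C i v = D.act (lift_node i v) v" "lift_node i v \<in> {1..n + 1}"
proof -
  show "act_C i v = D.act (lift_node i v) v"
    using node_cases[OF assms(2)] act_D[OF assms(1)] by (auto simp: lift_node_def)
  show "lift_node i v \<in> {1..n + 1}" using assms n by (auto simp: lift_node_def)
qed

lemma act_D_C:
  assumes "v \<in> halves" "l \<in> {1..n + 1}" "D.act l v \<noteq> v"
  shows "\<exists>i\<in>{1..n}. D.act l v = act_C i v"
proof -
  have "l = 1 \<or> l = 2 \<or> (\<exists>i\<in>{2..n}. l = i + 1)"
    using assms(2) by (auto intro!: bexI[of _ "l - 1"])
  then show ?thesis
  proof (elim disjE bexE)
    assume "l = 1"
    then show ?thesis using assms act_D(1)[OF assms(1)] n by (intro bexI[of _ 1]) (auto split: if_splits)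
  next
    assume "l = 2"
    then show ?thesis using assms act_D(2)[OF assms(1)] n by (intro bexI[of _ 1]) (auto split: if_splits)
  next
    fix i assume "i \<in> {2..n}" "l = i + 1"
    then show ?thesis using act_D(3)[OF assms(1)] by (intro bexI[of _ i]) auto
  qed
qed

lemma act_C_1_moved: "v \<in> halves \<Longrightarrow> act_C 1 v \<noteq> v"
proof
  assume h: "v \<in> halves" and e: "act_C 1 v = v"
  have "act_C 1 v 1 = v 1" by (rule fun_cong[OF e])
  then show False using halves_cases[OF h, of 1] by (auto simp: act_C_def)
qed

lemma act_C_fixed: "i \<in> {2..n} \<Longrightarrow> act_C i v = v \<longleftrightarrow> v i = v (i + 1)"
proof
  assume i: "i \<in> {2..n}" and e: "act_C i v = v"
  have "act_C i v i = v i" by (rule fun_cong[OF e])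
  then show "v i = v (i + 1)" using i by (simp add: act_C_def split: if_splits)
next
  assume i: "i \<in> {2..n}" and e: "v i = v (i + 1)"
  have "v(i := v (i + 1), i + 1 := v i) = v(i := v i, i + 1 := v (i + 1))" by (simp only: e)
  then show "act_C i v = v" using i by (simp add: act_C_def)
qed

lemma lift_adjacent:
  assumes "i \<in> {1..n}" "j \<in> {1..n}" "i \<noteq> j"
  shows "cmat (PairC n) i j = 2 \<longleftrightarrow> cmat (pair_D n) (lift_node i v) (lift_node j v) = 2"
    and "lift_node i v \<noteq> lift_node j v"
proof -
  show ne: "lift_node i v \<noteq> lift_node j v" using assms by (auto simp: lift_node_def)
  have l: "lift_node i v \<in> {1..n + 1}" "lift_node j v \<in> {1..n + 1}"
    using assms n by (auto simp: lift_node_def)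
  show "cmat (PairC n) i j = 2 \<longleftrightarrow> cmat (pair_D n) (lift_node i v) (lift_node j v) = 2"
    unfolding cmat_C cmat_B(3)[OF assms] cmat_pair_D[OF n l ne]
    using assms by (auto simp: lift_node_def)
qed

lemma lift_far:
  assumes "i \<in> {1..n}" "j \<in> {1..n}" "cmat (PairC n) i j = 2"
  shows "lift_node j (act_C i v) = lift_node j v"
proof -
  have "i \<noteq> j" using assms(3) by auto
  then have "j \<noteq> i + 1" "i \<noteq> j + 1" using assms cmat_B(3) by (auto simp: cmat_C)
  then show ?thesis using assms \<open>i \<noteq> j\<close> by (auto simp: lift_node_def act_C_def)
qed

text \<open>
  The model of type \<open>C\<close> has the points and the rank of the model of type \<open>D\<close>, and locally also its
  reflections, so most assumptions are inherited through \<open>lift_node\<close>.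
\<close>

lemma cox_model_C: "cox_model (PairC n) act_C rk halves base_C (bound_C n)"
proof
  show "omitted (PairC n) \<in> nodes (PairC n)" using n by (simp add: nodes_C)
  show "base_C \<in> halves" by (rule D.base_Om)
  show "rk base_C = 0" by (rule D.rk_base)
  fix v assume v: "v \<in> halves"
  show "rk v \<le> bound_C n" by (rule D.rk_bound[OF v])
  fix i assume "i \<in> nodes (PairC n)"
  then have i: "i \<in> {1..n}" by (simp add: nodes_C)
  note li = act_C_lift[OF v i]
  then have lin: "lift_node i v \<in> nodes (pair_D n)" by (simp add: nodes_D)
  show o: "act_C i v \<in> halves" using D.act_Om[OF v lin] li by simp
  show "act_C i (act_C i v) = v" by (rule act_C_invol)
  show "rk (act_C i v) = rk v + 1 \<or> rk (act_C i v) = rk v - 1" if "act_C i v \<noteq> v"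
    using D.rk_act[OF v lin] that li by simp
  fix j assume "j \<in> nodes (PairC n)"
  then have j: "j \<in> {1..n}" by (simp add: nodes_C)
  note lj = act_C_lift[OF v j]
  then have ljn: "lift_node j v \<in> nodes (pair_D n)" by (simp add: nodes_D)
  have ij1: "1 \<le> i" "1 \<le> j" using i j by auto
  show "((\<lambda>v. act_C j (act_C i v)) ^^ cmat (PairC n) i j) v = v" if ne: "i \<noteq> j"
  proof -
    consider "cmat (PairB n) i j = 2" | "cmat (PairB n) i j = 3" | "cmat (PairB n) i j = 4"
      using cmat_cases ne by blast
    then show ?thesis
    proof cases
      case 1
      then have "j \<noteq> i + 1" "i \<noteq> j + 1" using cmat_B(3)[OF i j ne] by auto
      then have "act_C j (act_C i (act_C j (act_C i v))) = v"
        using act_C_far[OF ij1 ne, of "act_C i v"] act_C_invol by simp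
      then show ?thesis using 1 by (simp add: cmat_C eval_nat_numeral)
    next
      case 2
      then have "2 \<le> i \<and> j = i + 1 \<or> 2 \<le> j \<and> i = j + 1" using cmat_B(2)[OF i j ne] by auto
      then show ?thesis using 2 act_C_braid_3[of i v] act_C_braid_3[of j v]
        by (auto simp: eval_nat_numeral cmat_C)
    next
      case 3
      then have "(i = 1 \<and> j = 2) \<or> (i = 2 \<and> j = 1)" using cmat_B(1)[OF i j ne] by auto
      then show ?thesis using 3 act_C_braid_4[of v]
        by (auto simp: numeral_eq_Suc cmat_C simp del: One_nat_def)
    qed
  qed
  show "cmat (PairC n) i j = 2" if "i \<noteq> j" "rk v < rk (act_C i v)" "rk v < rk (act_C j v)"
    using D.asc_asc[OF v lin ljn] lift_adjacent[OF i j that(1), of v] that li lj by simp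
  show "cmat (PairC n) i j = 2" if "i \<noteq> j" "rk (act_C i v) < rk v" "rk (act_C j v) < rk v"
    using D.desc_desc[OF v lin ljn] lift_adjacent[OF i j that(1), of v] that li lj by simp
  show "rk (act_C j (act_C i v)) - rk (act_C i v) = rk (act_C j v) - rk v" if c: "cmat (PairC n) i j = 2"
  proof -
    have "i \<noteq> j" using c by auto
    then have "cmat (pair_D n) (lift_node i v) (lift_node j v) = 2" using lift_adjacent(1)[OF i j] c by simp
    moreover have "act_C j (act_C i v) = D.act (lift_node j v) (act_C i v)"
      using act_C_lift(1)[OF o j] lift_far[OF i j c] by simp
    ultimately show ?thesis using D.rk_commute[OF v lin ljn] li lj by simp
  qed
  show "act_C i (act_C j v) \<noteq> act_C j v"
    if "cmat (PairC n) i j = 4" "act_C i v = v" "act_C j v \<noteq> v"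
  proof -
    have "i \<noteq> j" using that by auto
    then have "(i = 1 \<and> j = 2) \<or> (i = 2 \<and> j = 1)" using cmat_B(1)[OF i j] that by (auto simp: cmat_C)
    then have ij: "i = 2" "j = 1" using act_C_1_moved[OF v] that by auto
    then have "v 2 = v 3" using act_C_fixed[of 2 v] that n by simp
    then have "act_C 1 v 2 \<noteq> act_C 1 v 3" using halves_cases[OF v, of 3] by (auto simp: act_C_def)
    then show ?thesis using act_C_fixed[of 2 "act_C 1 v"] ij n by simp
  qed
next
  fix i assume "i \<in> nodes (PairC n)" "i \<noteq> omitted (PairC n)"
  then show "act_C i base_C = base_C" by (auto simp: nodes_C act_C_def base_C_def fun_eq_iff)
next
  have "act_C 1 base_C = D.act 1 base_C" using act_D(1)[OF D.base_Om] by (simp add: base_C_def)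
  moreover have "omitted (pair_D n) = 1" by (simp add: pair_D_def)
  ultimately show "rk (act_C (omitted (PairC n)) base_C) = 1" using D.rk_omitted by simp
qed

sublocale C: cox_model "PairC n" act_C rk halves base_C "bound_C n"
  by (rule cox_model_C)

lemma orb_eq: "C.orb = D.orb"
proof (intro equalityI subsetI)
  fix v assume "v \<in> C.orb"
  then obtain w where "C.rword w v" by (auto simp: C.orb_def)
  then show "v \<in> D.orb"
  proof (induction rule: C.rword.induct)
    case rword_Nil
    show ?case by (rule D.base_orb)
  next
    case (rword_snoc w v i)
    have v: "v \<in> halves" using rword_snoc C.rword_props by blast
    have i: "i \<in> {1..n}" using rword_snoc by (simp add: nodes_C)
    show ?case using act_C_lift[OF v i] D.act_orb rword_snoc by (simp add: nodes_D)
  qed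
next
  fix v assume "v \<in> D.orb"
  then obtain w where "D.rword w v" by (auto simp: D.orb_def)
  then show "v \<in> C.orb"
  proof (induction rule: D.rword.induct)
    case rword_Nil
    show ?case by (rule C.base_orb)
  next
    case (rword_snoc w v l)
    have v: "v \<in> halves" using rword_snoc D.rword_props by blast
    have "D.act l v \<noteq> v" using rword_snoc by auto
    then obtain i where "i \<in> {1..n}" "D.act l v = act_C i v"
      using act_D_C[OF v, of l] rword_snoc by (auto simp: nodes_D)
    then show ?case using C.act_orb[of v i] rword_snoc by (simp add: nodes_C)
  qed
qed

lemma wle_D_C: "D.wle u v \<Longrightarrow> C.wle u v"
proof (induction rule: D.wle.induct)
  case (wle_refl v)
  then show ?case using C.wle_refl orb_eq by simp
next
  case (wle_step v l u)
  have v: "v \<in> halves" using wle_step D.orb_Om by blast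
  have "D.act l v \<noteq> v" using wle_step by auto
  then obtain i where "i \<in> {1..n}" "D.act l v = act_C i v"
    using act_D_C[OF v, of l] wle_step by (auto simp: nodes_D)
  then show ?case using C.wle_step[of v i u] wle_step orb_eq by (simp add: nodes_C)
qed

lemma opE_eq:
  assumes "y \<in> D.orb" "D.act l y \<noteq> y" "D.act l y = act_C i y"
  shows "D.opE l f y = C.opE i f y"
  using assms orb_eq by (simp add: D.opE_def C.opE_def D.updown_def C.updown_def)

text \<open>
  The generator of type \<open>C\<close> at the double bond acts as the sum of the two generators of type \<open>D\<close> at
  the fork, since exactly one of these moves a given weight.
\<close>

lemma opE_C:
  "C.opE 1 f = (\<lambda>x. D.opE 1 f x + 1 * D.opE 2 f x)"
  "i \<in> {2..n} \<Longrightarrow> C.opE i f = D.opE (i + 1) f"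
proof -
  show "C.opE 1 f = (\<lambda>x. D.opE 1 f x + 1 * D.opE 2 f x)"
  proof
    fix x
    show "C.opE 1 f x = D.opE 1 f x + 1 * D.opE 2 f x"
    proof (cases "x \<in> D.orb")
      case True
      then have h: "x \<in> halves" using D.orb_Om by blast
      note a = act_D(1,2)[OF h] and m = act_C_1_moved[OF h]
      show ?thesis
      proof (cases "x 1 = x 2")
        case e: True
        have "D.opE 1 f x = C.opE 1 f x" by (rule opE_eq) (use True a m e in simp_all)
        moreover have "D.opE 2 f x = 0" using a e by (simp add: D.opE_def)
        ultimately show ?thesis by simp
      next
        case e: False
        have "D.opE 2 f x = C.opE 1 f x" by (rule opE_eq) (use True a m e in simp_all)
        moreover have "D.opE 1 f x = 0" using a e by (simp add: D.opE_def)
        ultimately show ?thesis by simp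
      qed
    qed (simp add: orb_eq D.opE_def C.opE_def)
  qed
  assume i: "i \<in> {2..n}"
  show "C.opE i f = D.opE (i + 1) f"
  proof
    fix x
    show "C.opE i f x = D.opE (i + 1) f x"
    proof (cases "x \<in> D.orb \<and> act_C i x \<noteq> x")
      case True
      then show ?thesis using opE_eq[of x "i + 1" i f] act_D(3)[OF _ i] D.orb_Om by simp
    next
      case False
      then show ?thesis using act_D(3)[OF _ i] D.orb_Om by (auto simp: orb_eq D.opE_def C.opE_def)
    qed
  qed
qed

lemma word_sum_C_span: "C.rword w v \<Longrightarrow> \<exists>r. D.symspan D.canonical r (C.word_sum w)"
proof (induction rule: C.rword.induct)
  case rword_Nil
  have "C.word_sum [] = D.canonical base_C" using D.canonical_eq[OF D.rword_Nil] by (simp add: fun_eq_iff C.word_sum_Nil D.word_sum_Nil)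
  then show ?case using D.symspan_self[OF D.base_orb, of "rk base_C" D.canonical] by auto
next
  case (rword_snoc w v i)
  then obtain r where r: "D.symspan D.canonical r (C.word_sum w)" by blast
  have i: "i \<in> {1..n}" using rword_snoc by (simp add: nodes_C)
  show ?case
  proof (cases "i = 1")
    case True
    have "D.symspan D.canonical (r + 1) (D.opE 1 (C.word_sum w))" "D.symspan D.canonical (r + 1) (D.opE 2 (C.word_sum w))"
      using D.symspan_closed[OF r] n by (simp_all add: nodes_D)
    then have "D.symspan D.canonical (r + 1) (\<lambda>x. D.opE 1 (C.word_sum w) x + D.opE 2 (C.word_sum w) x)"
      using D.symspan_plus by blast
    then show ?thesis using opE_C(1) True by (auto simp: C.word_sum_snoc)
  next
    case False
    then have i2: "i \<in> {2..n}" using i by auto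
    have "D.symspan D.canonical (r + 1) (D.opE (i + 1) (C.word_sum w))"
      using D.symspan_closed[OF r, of "i + 1"] i by (simp add: nodes_D)
    then show ?thesis using opE_C(2)[OF i2] by (auto simp: C.word_sum_snoc)
  qed
qed

text \<open>
  By \<open>opE_C\<close> the path sums of type \<open>C\<close> lie in the span of the polynomials of type \<open>D\<close>, which therefore
  are the Kazhdan-Lusztig polynomials of both types.
\<close>

lemma kl_poly_C:
  assumes "x \<in> C.orb" "v \<in> C.orb"
  shows "kl_poly (PairC n) (C.phi x) (C.phi v) = D.canonical v x"
proof (rule C.kl_poly_model[OF _ _ _ _ assms])
  show "D.canonical v v = 1" if "v \<in> C.orb" for v using that orb_eq D.canonical_values(1) by simp
  show "D.canonical v x \<in> q_ideal" if "v \<in> C.orb" "x \<noteq> v" for v x using that orb_eq D.canonical_q_ideal by simp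
  show "C.wle x v" if "v \<in> C.orb" "D.canonical v x \<noteq> 0" for v x using that orb_eq D.canonical_support wle_D_C by simp
  show "\<exists>c. (\<forall>z\<in>C.orb. c z \<in> sym_laurent) \<and> (\<forall>x\<in>C.orb. C.word_sum w x = (\<Sum>z\<in>C.orb. c z * D.canonical z x))"
    if "C.rword w v" for w v
    using word_sum_C_span[OF that] D.symspan_expand unfolding orb_eq by blast
qed

lemma seq_of_run:
  "w \<in> lists {1..n} \<Longrightarrow> v \<in> halves \<Longrightarrow> f 1 = Circ \<Longrightarrow> \<forall>j\<ge>2. f j = (if v j > 0 then Down else Up) \<Longrightarrow>
    foldl act_seq f w 1 = Circ \<and>
    (\<forall>j\<ge>2. foldl act_seq f w j = (if foldl (\<lambda>v i. act_C i v) v w j > 0 then Down else Up))"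
proof (induction w arbitrary: f v)
  case (Cons i w)
  have i: "i \<in> {1..n}" using Cons.prems by auto
  have h: "act_C i v \<in> halves" using C.act_Om[OF Cons.prems(2)] i by (simp add: nodes_C)
  have "act_seq f i 1 = Circ" using Cons.prems(3) i by (auto simp: act_seq_def)
  moreover have "\<forall>j\<ge>2. act_seq f i j = (if act_C i v j > 0 then Down else Up)"
    using Cons.prems(4) i halves_cases[OF Cons.prems(2), of 2] by (auto simp: act_seq_def act_C_def)
  ultimately show ?case using Cons.IH[OF _ h, of "act_seq f i"] Cons.prems by simp
qed simp

lemma seq_of_phi:
  assumes "y \<in> C.orb"
  shows "seq_of (C.phi y) 1 = Circ" "2 \<le> j \<Longrightarrow> seq_of (C.phi y) j = (if y j > 0 then Down else Up)"
proof -
  define w where "w = (SOME w. w \<in> C.phi y)"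
  have "w \<in> C.phi y" unfolding w_def using someI_ex[OF C.phi_nonempty[OF assms]] .
  then have w: "w \<in> lists {1..n}" "foldl (\<lambda>v i. act_C i v) base_C w = y"
    using C.mem_phi[OF assms] by (simp_all add: nodes_C)
  have s: "seq_of (C.phi y) = foldl act_seq empty_seq w" by (simp add: seq_of_def w_def)
  note r = seq_of_run[OF w(1) D.base_Om, of empty_seq]
  have "foldl act_seq empty_seq w 1 = Circ \<and>
    (\<forall>j\<ge>2. foldl act_seq empty_seq w j = (if y j > 0 then Down else Up))"
    using r w(2) by (simp add: empty_seq_def base_C_def)
  then show "seq_of (C.phi y) 1 = Circ" "2 \<le> j \<Longrightarrow> seq_of (C.phi y) j = (if y j > 0 then Down else Up)"
    by (simp_all add: s)
qed

lemma flip_oriented_iff: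
  assumes "a \<noteq> b"
  shows "flip_oriented x {a, b} \<longleftrightarrow>
    (if vertex_label x a = Circ \<or> vertex_label x b = Circ then vertex_label x a \<noteq> vertex_label x b
     else points_in x a = points_in x b)" (is "_ \<longleftrightarrow> ?P a b")
proof
  assume "flip_oriented x {a, b}"
  then obtain u v where "{a, b} = {u, v}" "?P u v" unfolding flip_oriented_def by blast
  then show "?P a b" by (auto simp: doubleton_eq_iff split: if_splits)
next
  assume "?P a b"
  then show "flip_oriented x {a, b}" unfolding flip_oriented_def using assms
    by (intro exI[of _ a] exI[of _ b]) simp
qed

text \<open>
  The orientation of a boundary vertex when \<open>y\<close> is on the northern edge; no southern symbol points
  inwards, being \<open>\<circ>\<close> or \<open>\<or>\<close>.
\<close>

definition inward :: "(nat \<Rightarrow> real) \<Rightarrow> vertex \<Rightarrow> bool" where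
  "inward y u = (case u of North j \<Rightarrow> y j > 0 | _ \<Rightarrow> False)"

text \<open>
  The standard condition without the symbols \<open>\<circ>\<close>.  A strand at the northern vertex \<open>1\<close> always counts
  as flip-oriented and is exempted.  A decorated strand at the southern vertex \<open>1\<close> ends at another
  southern vertex; no southern vertex points inwards, so it satisfies the equation anyway.
\<close>

definition flips :: "(vertex \<Rightarrow> vertex) \<Rightarrow> vertex set \<Rightarrow> (nat \<Rightarrow> real) \<Rightarrow> bool" where
  "flips m Bd y \<longleftrightarrow> (\<forall>u\<in>Bd. u \<noteq> North 1 \<longrightarrow> m u \<noteq> North 1 \<longrightarrow> inward y u = inward y (m u))"

text \<open>
  The diagram of an ascending word of \<open>v\<close>: \<open>v\<close> orients all undecorated strands and flip-orients the
  decorated ones, the decorated northern ends of \<open>v\<close> are \<open>\<and>\<close>, and undecorated northern arcs read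
  \<open>\<or>\<and>\<close>.  A path of the word ends in a weight orienting the undecorated strands; the weights occurring
  in the type \<open>D\<close> polynomial of \<open>v\<close> agree with \<open>v\<close> on every strand up to reversal; and on weights
  flipping the decorated strands the two sums coincide.
\<close>

definition diagram :: "nat list \<Rightarrow> (nat \<Rightarrow> real) \<Rightarrow> (vertex \<Rightarrow> vertex) \<Rightarrow> vertex set \<Rightarrow> bool" where
  "diagram w v m Bd \<longleftrightarrow>
    matching (n + 1) m Bd \<and> word_tangle (n + 1) w = tangle_of (n + 1) m Bd \<and>
    (\<forall>u\<in>boundary (n + 1) - Bd. inward v u \<noteq> inward v (m u)) \<and>
    flips m Bd v \<and>
    (\<forall>j\<ge>2. North j \<in> Bd \<longrightarrow> \<not> v j > 0) \<and>
    (\<forall>a b. North a \<in> boundary (n + 1) - Bd \<longrightarrow> m (North a) = North b \<longrightarrow> a < b \<longrightarrow> v a > 0) \<and>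
    (if w = [] then m = swap_ends \<and> Bd = {} else North 1 \<in> Bd \<and> (\<exists>k. m (South 1) = South k)) \<and>
    (\<forall>y. C.word_sum w y \<noteq> 0 \<longrightarrow> (\<forall>u\<in>boundary (n + 1) - Bd. inward y u \<noteq> inward y (m u))) \<and>
    (\<forall>y. D.canonical v y \<noteq> 0 \<longrightarrow>
      (\<forall>u\<in>boundary (n + 1). (inward y u = inward y (m u)) = (inward v u = inward v (m u)))) \<and>
    (\<forall>y\<in>C.orb. flips m Bd y \<longrightarrow> C.word_sum w y = D.canonical v y)"

lemma diagram_Nil: "diagram [] base_C swap_ends {}"
proof -
  have g: "D.canonical base_C = (\<lambda>y. if y = base_C then 1 else 0)"
    using D.canonical_eq[OF D.rword_Nil] by (simp add: fun_eq_iff D.word_sum_Nil)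
  have b: "\<forall>u\<in>boundary (n + 1). inward base_C u \<noteq> inward base_C (swap_ends u)"
    by (auto simp: boundary_def inward_def base_C_def)
  have t: "word_tangle (n + 1) [] = tangle_of (n + 1) swap_ends {}"
    unfolding word_tangle_def foldl.simps by (rule id_tangle_eq)
  show ?thesis
    unfolding diagram_def g using matching_id[of "n + 1"] b t
    by (auto simp: flips_def C.word_sum_Nil split: if_splits)
qed

text \<open>
  The type \<open>D\<close> lift of an ascent of \<open>v\<close> moves just those weights whose symbols at \<open>i\<close> and \<open>i + 1\<close> are equal
  or different according to those of \<open>v\<close>.
\<close>

lemma moved_iff:
  assumes "y \<in> halves" "v \<in> halves" "i \<in> {1..n}" "act_C i v \<noteq> v"
  shows "D.act (lift_node i v) y \<noteq> y \<longleftrightarrow> ((y i > 0) = (y (i + 1) > 0)) = ((v i > 0) = (v (i + 1) > 0))"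
    and "D.act (lift_node i v) y \<noteq> y \<Longrightarrow> D.act (lift_node i v) y = act_C i y"
proof -
  note h = halves_cases[OF assms(1)] halves_cases[OF assms(2)]
  have e: "(y a > 0) = (y b > 0) \<longleftrightarrow> y a = y b" "(v a > 0) = (v b > 0) \<longleftrightarrow> v a = v b" for a b
    using h(1)[of a] h(1)[of b] h(2)[of a] h(2)[of b] by auto
  have "(D.act (lift_node i v) y \<noteq> y \<longleftrightarrow> ((y i > 0) = (y (i + 1) > 0)) = ((v i > 0) = (v (i + 1) > 0))) \<and>
    (D.act (lift_node i v) y \<noteq> y \<longrightarrow> D.act (lift_node i v) y = act_C i y)"
  proof (cases "i = 1")
    case True
    have two: "(1 :: nat) + 1 = 2" by simp
    show ?thesis unfolding e True two using act_D(1,2)[OF assms(1)] act_C_1_moved[OF assms(1)]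
      by (auto simp: lift_node_def)
  next
    case False
    then have i: "i \<in> {2..n}" using assms by auto
    show ?thesis unfolding e using act_D(3)[OF assms(1) i] act_C_fixed[OF i, of y] act_C_fixed[OF i, of v] assms(4) False
      by (auto simp: lift_node_def)
  qed
  then show "D.act (lift_node i v) y \<noteq> y \<longleftrightarrow> ((y i > 0) = (y (i + 1) > 0)) = ((v i > 0) = (v (i + 1) > 0))"
    and "D.act (lift_node i v) y \<noteq> y \<Longrightarrow> D.act (lift_node i v) y = act_C i y" by blast+
qed

text \<open>
  The strands at \<open>i\<close> and \<open>i + 1\<close> end at \<open>p\<close> and \<open>q\<close> in the old tangle.  The strand at \<open>i + 1\<close> is undecorated, because
  the symbol of \<open>v\<close> there is \<open>\<or>\<close>; it does not end at \<open>i\<close>, by the condition on undecorated arcs if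
  \<open>i > 1\<close>, and since northern vertex \<open>1\<close> is decorated (or the tangle trivial) if \<open>i = 1\<close>.  All
  conditions off these four vertices are inherited.  For the comparison of the sums, \<open>E\<^sub>i\<close> collects the
  values at \<open>y\<close> and \<open>s\<^sub>iy\<close>.  If \<open>y\<close> flips the new decorated strands, then the two old sums agree at
  both points: either the point flips the old ones, or both sums vanish there.  Only for \<open>i = 1\<close> can
  the lift to type \<open>D\<close> fix \<open>y\<close> although \<open>s\<^sub>1\<close> moves it; then both old values vanish, since the relative
  orientation of \<open>p\<close> and \<open>q\<close> forces that of the symbols at \<open>1\<close> and \<open>2\<close>.
\<close>

lemma diagram_step:
  assumes dia: "diagram w v m Bd" and w: "C.rword w v" and node: "i \<in> {1..n}" and up: "rk v < rk (act_C i v)"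
  shows "diagram (w @ [i]) (act_C i v) (glue i m) (glue_beads i m Bd)"
proof -
  let ?v = "act_C i v" and ?Bd = "glue_beads i m Bd" and ?l = "lift_node i v"
  let ?a = "North i" and ?b = "North (i + 1)"
  have mat: "matching (n + 1) m Bd"
    using dia unfolding diagram_def by (elim conjE)
  have tan: "word_tangle (n + 1) w = tangle_of (n + 1) m Bd"
    using dia unfolding diagram_def by (elim conjE)
  have 1: "\<forall>u\<in>boundary (n + 1) - Bd. inward v u \<noteq> inward v (m u)"
    using dia unfolding diagram_def by (elim conjE)
  have dec: "flips m Bd v"
    using dia unfolding diagram_def by (elim conjE)
  have 2: "\<forall>j\<ge>2. North j \<in> Bd \<longrightarrow> \<not> v j > 0"
    using dia unfolding diagram_def by (elim conjE)
  have 3: "\<forall>a b. North a \<in> boundary (n + 1) - Bd \<longrightarrow> m (North a) = North b \<longrightarrow> a < b \<longrightarrow> v a > 0"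
    using dia unfolding diagram_def by (elim conjE)
  have start: "if w = [] then m = swap_ends \<and> Bd = {} else North 1 \<in> Bd \<and> (\<exists>k. m (South 1) = South k)"
    using dia unfolding diagram_def by (elim conjE)
  have 4: "\<forall>y. C.word_sum w y \<noteq> 0 \<longrightarrow> (\<forall>u\<in>boundary (n + 1) - Bd. inward y u \<noteq> inward y (m u))"
    using dia unfolding diagram_def by (elim conjE)
  have 5: "\<forall>y. D.canonical v y \<noteq> 0 \<longrightarrow>
      (\<forall>u\<in>boundary (n + 1). (inward y u = inward y (m u)) = (inward v u = inward v (m u)))"
    using dia unfolding diagram_def by (elim conjE)
  have 6: "\<forall>y\<in>C.orb. flips m Bd y \<longrightarrow> C.word_sum w y = D.canonical v y"
    using dia unfolding diagram_def by (elim conjE)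
  have undec: "inward v u \<noteq> inward v (m u)" if "u \<in> boundary (n + 1)" "u \<notin> Bd" for u
    using 1 that by blast
  have decN: "\<not> v j > 0" if "2 \<le> j" "North j \<in> Bd" for j using 2 that by blast
  have arcN: "v a > 0" if "North a \<in> boundary (n + 1)" "North a \<notin> Bd" "m (North a) = North b" "a < b" for a b
    using 3 that by blast
  have supC: "inward y u \<noteq> inward y (m u)" if "C.word_sum w y \<noteq> 0" "u \<in> boundary (n + 1)" "u \<notin> Bd" for y u
    using 4 that by blast
  have supD: "(inward y u = inward y (m u)) = (inward v u = inward v (m u))"
    if "D.canonical v y \<noteq> 0" "u \<in> boundary (n + 1)" for y u
    using 5 that by blast
  have same: "C.word_sum w y = D.canonical v y" if "y \<in> C.orb" "flips m Bd y" for y using 6 that by blast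
  have vorb: "v \<in> C.orb" "v \<in> D.orb" and v: "v \<in> halves"
    using C.rword_props[OF w] orb_eq by auto
  have iC: "i \<in> nodes (PairC n)" using node by (simp add: nodes_C)
  have lift: "act_C i v = D.act ?l v" "?l \<in> nodes (pair_D n)"
    using act_C_lift[OF v node] by (simp_all add: nodes_D)
  have moved: "act_C i v \<noteq> v" using up by auto
  have i1: "1 \<le> i" "i + 1 \<le> n + 1" using node by auto
  have hv: "v p = 1/2 \<or> v p = - 1/2" for p using halves_cases[OF v] .
  have ipl: "ip_C n v (root_D ?l) = 1" using D.asc_iff[OF v lift(2)] up lift(1) by simp
  have vb: "v (i + 1) > 0"
  proof (cases "i = 1")
    case True
    have "(1 :: nat) + 1 = 2" by simp
    then show ?thesis using ipl hv[of 1] hv[of 2] unfolding True lift_node_def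
      by (auto simp only: ip_root_D if_True split: if_splits)
  next
    case False
    then have "i \<in> {2..n}" using node by auto
    from ip_root_D(3)[OF this, of v] show ?thesis using ipl hv[of i] hv[of "i + 1"] False
      unfolding lift_node_def by auto
  qed
  have va: "\<not> v i > 0" if "i \<noteq> 1"
  proof -
    have "i \<in> {2..n}" using node that by auto
    from ip_root_D(3)[OF this, of v] show ?thesis using ipl hv[of i] hv[of "i + 1"] that
      unfolding lift_node_def by auto
  qed
  have first: "i = 1" if "w = []"
  proof (rule ccontr)
    assume "i \<noteq> 1"
    moreover have "v = base_C" using w that C.rword_Nil_iff by simp
    ultimately show False using va by (simp add: base_C_def)
  qed
  have inN: "inward y (North j) \<longleftrightarrow> y j > 0" and inS: "\<not> inward y (South j)" for y j by (simp_all add: inward_def)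
  have bB: "?b \<notin> Bd" using decN[of "i + 1"] vb i1 by auto
  have ab: "?a \<in> boundary (n + 1)" "?b \<in> boundary (n + 1)" using i1 by (auto simp: boundary_def)
  have mBd: "\<And>u. u \<in> Bd \<Longrightarrow> m u \<in> Bd" "\<And>u. u \<in> Bd \<Longrightarrow> u \<in> boundary (n + 1)" using mat by (auto simp: matching_def)
  have ne: "m ?a \<noteq> ?b"
  proof
    assume e: "m ?a = ?b"
    then have aB: "?a \<notin> Bd" using mBd(1)[of ?a] bB by auto
    show False
    proof (cases "w = []")
      case True
      then show False using start e by simp
    next
      case False
      then have "i \<noteq> 1" using start aB by auto
      then show False using arcN[OF ab(1) aB e] va by simp
    qed
  qed
  interpret gluing "n + 1" i m Bd using mat i1 ne by unfold_locales
  let ?p = "m ?a" and ?q = "m ?b"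
  have inq: "\<not> inward v ?q" using undec[OF ab(2) bB] vb by (simp add: inN)
  have off: "inward (act_C i y) u = inward y u" if "u \<noteq> ?a" "u \<noteq> ?b" for y u
    using that act_C_off[of _ i y] by (cases u) (auto simp: inward_def)
  have offp: "inward (act_C i y) ?p = inward y ?p" "inward (act_C i y) ?q = inward y ?q" for y
    using off[of ?p y] off[of ?q y] pp by blast+
  have sep: "(y i > 0) \<noteq> (y (i + 1) > 0)" if "i \<noteq> 1" "y \<in> halves" "act_C i y \<noteq> y" for y
  proof -
    have "i \<in> {2..n}" using node that by auto
    then show ?thesis using act_C_fixed[of i y] that halves_cases[OF that(2), of i] halves_cases[OF that(2), of "i + 1"] by auto
  qed
  have Bd_other: "u \<in> ?Bd \<longleftrightarrow> u \<in> Bd" if "u \<notin> {?a, ?b, ?p, ?q}" for u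
    using that by (auto simp: glue_beads_def)
  have Bd_ends: "u \<in> ?Bd \<longleftrightarrow> i = 1" if "u = ?a \<or> u = ?b" for u
    using that pp by (auto simp: glue_beads_def)
  have pB: "?p \<in> Bd \<longleftrightarrow> ?a \<in> Bd" "?q \<notin> Bd"
    using mBd(1)[of ?p] mBd(1)[of ?a] mBd(1)[of ?q] bB pp by auto
  have Bd_pq: "u \<in> ?Bd \<longleftrightarrow> i = 1 \<or> ?a \<in> Bd" if "u = ?p \<or> u = ?q" for u
    using that pp pB bB by (auto simp: glue_beads_def)
  have q1: "?q \<noteq> North 1"
  proof
    assume e: "?q = North 1"
    then have e': "m (North 1) = ?b" using pp by metis
    show False
    proof (cases "w = []")
      case True
      then show False using start e' by simp
    next
      case False
      then have "m (North 1) \<in> Bd" using start mBd by simp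
      then show False using e' bB by simp
    qed
  qed
  \<comment> \<open>the new strand through the cap inherits its constraint from the three pieces\<close>
  have inp: "\<not> inward v ?p" if "i = 1 \<or> ?a \<in> Bd" "?p \<noteq> North 1"
  proof (cases "i = 1")
    case True
    show ?thesis
    proof (cases "w = []")
      case True
      then have "?p = South i" using start by simp
      then show ?thesis by (simp add: inS)
    next
      case False
      then have "?p \<in> Bd" using start \<open>i = 1\<close> pB by simp
      then have "\<not> inward v (North j)" if "?p = North j" for j
        using decN[of j] that \<open>?p \<noteq> North 1\<close> mBd(2)[of ?p] by (cases "j = 1") (auto simp: inN boundary_def)
      then show ?thesis by (cases ?p) (auto simp: inward_def)
    qed
  next
    case False
    then have "?a \<in> Bd" "?a \<noteq> North 1" using that by auto
    then have "inward v ?a = inward v ?p" using dec that unfolding flips_def by blast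
    then show ?thesis using va[OF False] by (simp add: inN)
  qed
  have S': "flips m' ?Bd ?v"
    unfolding flips_def
  proof (intro ballI impI)
    fix u assume u: "u \<in> ?Bd" "u \<noteq> North 1" "m' u \<noteq> North 1"
    show "inward ?v u = inward ?v (m' u)"
    proof (cases "u \<in> {?a, ?b, ?p, ?q}")
      case False
      then have "u \<in> Bd" using u Bd_other by simp
      then have "inward v u = inward v (m u)" using dec u glue_other[OF False] unfolding flips_def by simp
      then show ?thesis using off False other_m[OF mBd(2)[OF \<open>u \<in> Bd\<close>] False] glue_other[OF False] by simp
    next
      case True
      then consider "u = ?a \<or> u = ?b" | "u = ?p" | "u = ?q" by blast
      then show ?thesis
      proof cases
        case 1
        then have "i = 1" using u(1) Bd_ends by blast
        then show ?thesis using 1 u(2,3) glue_values by auto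
      next
        case 2
        then have "i = 1 \<or> ?a \<in> Bd" using u(1) Bd_pq by blast
        moreover have "?p \<noteq> North 1" using u(2) 2 by simp
        ultimately show ?thesis using inp inq offp glue_values 2 by simp
      next
        case 3
        then have "i = 1 \<or> ?a \<in> Bd" using u(1) Bd_pq by blast
        moreover have "?p \<noteq> North 1" using u(3) 3 glue_values by simp
        ultimately show ?thesis using inp inq offp glue_values 3 by simp
      qed
    qed
  qed
  have old_flips: "flips m Bd y0"
    if y: "y \<in> halves" and fl: "flips m' ?Bd y" and y0: "y0 = y \<or> y0 = act_C i y" and mv: "act_C i y \<noteq> y"
      and or: "\<And>u. u \<in> boundary (n + 1) \<Longrightarrow> u \<notin> Bd \<Longrightarrow> inward y0 u \<noteq> inward y0 (m u)" for y y0
    unfolding flips_def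
  proof (intro ballI impI)
    fix u assume u: "u \<in> Bd" "u \<noteq> North 1" "m u \<noteq> North 1"
    have same_off: "inward y0 x = inward y x" if "x \<noteq> ?a" "x \<noteq> ?b" for x using off[OF that, of y] y0 by auto
    show "inward y0 u = inward y0 (m u)"
    proof (cases "u \<in> {?a, ?b, ?p, ?q}")
      case False
      then have "u \<in> ?Bd" using u Bd_other by simp
      then have "inward y u = inward y (m' u)" using fl u glue_other[OF False] unfolding flips_def by simp
      then show ?thesis using same_off False other_m[OF mBd(2)[OF u(1)] False] glue_other[OF False] by simp
    next
      case True
      then have ua: "u = ?a \<or> u = ?p" and aB: "?a \<in> Bd" using u(1) bB pB by auto
      then have a1: "?a \<noteq> North 1" and p1: "?p \<noteq> North 1" using u(2,3) pp by auto
      then have i1': "i \<noteq> 1" by auto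
      have "?p \<in> ?Bd" using Bd_pq aB by blast
      then have "inward y ?p = inward y ?q" using fl p1 q1 glue_values unfolding flips_def by simp
      then have 1: "inward y0 ?p = inward y0 ?q" using same_off pp by simp
      have 2: "inward y0 ?b \<noteq> inward y0 ?q" using or[OF ab(2) bB] .
      have "y0 \<in> halves" "act_C i y0 \<noteq> y0"
        using y y0 mv C.act_Om[OF y iC] act_C_invol[of i y] by auto
      then have "inward y0 ?a \<noteq> inward y0 ?b" using sep[OF i1'] by (simp add: inN)
      then have "inward y0 ?a = inward y0 ?p" using 1 2 by blast
      then show ?thesis using ua pp by auto
    qed
  qed
  have gv: "D.canonical ?v = D.opE ?l (D.canonical v)"
    using D.canonical_up[OF vorb(2) lift(2)] up lift(1) by simp
  have support_flips: "flips m Bd y0" if "D.canonical v y0 \<noteq> 0" for y0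
    unfolding flips_def
  proof (intro ballI impI)
    fix u assume u: "u \<in> Bd" "u \<noteq> North 1" "m u \<noteq> North 1"
    then have "inward v u = inward v (m u)" using dec unfolding flips_def by blast
    then show "inward y0 u = inward y0 (m u)" using supD[OF that mBd(2)[OF u(1)]] by blast
  qed
  have equal: "C.word_sum w y0 = D.canonical v y0"
    if y: "y \<in> C.orb" and fl: "flips m' ?Bd y" and y0: "y0 = y \<or> y0 = act_C i y" and mv: "act_C i y \<noteq> y" for y y0
  proof (cases "flips m Bd y0")
    case True
    have "y0 \<in> C.orb" using y y0 C.act_orb[OF y iC] by auto
    then show ?thesis using same True by blast
  next
    case False
    then have "D.canonical v y0 = 0" using support_flips by blast
    moreover have "C.word_sum w y0 = 0"
    proof (rule ccontr)
      assume "C.word_sum w y0 \<noteq> 0"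
      then have "flips m Bd y0" using old_flips[OF C.orb_Om[OF y] fl y0 mv] supC by blast
      then show False using False by blast
    qed
    ultimately show ?thesis by simp
  qed
  have rel_transfer: "(inward y ?p = inward y ?q) = (inward v ?p = inward v ?q)"
    if g: "D.canonical v y0 \<noteq> 0" and y0: "y0 = y \<or> y0 = act_C i y"
      and r: "(inward y0 ?a = inward y0 ?b) = (inward v ?a = inward v ?b)" for y y0
  proof -
    have "inward y0 ?p = inward y ?p" "inward y0 ?q = inward y ?q" using offp y0 by auto
    moreover note supD[OF g ab(1)] supD[OF g ab(2)] r
    ultimately show ?thesis by blast
  qed
  have nodes_rel: "(inward (act_C i y) ?a = inward (act_C i y) ?b) = (inward y ?a = inward y ?b)" if "y \<in> halves" for y
  proof (cases "i = 1")
    case True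
    then have "act_C i y = y(1 := - y 1, 2 := - y 2)" by (simp add: act_C_def)
    then show ?thesis using True halves_cases[OF that, of 1] halves_cases[OF that, of 2]
      by (auto simp: inN eval_nat_numeral)
  next
    case False
    then have "act_C i y = y(i := y (i + 1), i + 1 := y i)" by (simp add: act_C_def)
    then show ?thesis by (auto simp: inN)
  qed
  have "C.word_sum (w @ [i]) y = D.canonical ?v y" if y: "y \<in> C.orb" and fl: "flips m' ?Bd y" for y
  proof (cases "act_C i y = y")
    case True
    have yh: "y \<in> halves" using C.orb_Om[OF y] .
    have "D.act ?l y = y" using moved_iff(2)[OF yh v node moved] True by metis
    then show ?thesis using True gv by (simp add: C.word_sum_snoc C.opE_def D.opE_def)
  next
    case mv: False
    have yh: "y \<in> halves" using C.orb_Om[OF y] .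
    have eqs: "C.word_sum w y = D.canonical v y" "C.word_sum w (act_C i y) = D.canonical v (act_C i y)"
      using equal[OF y fl _ mv] by blast+
    show ?thesis
    proof (cases "D.act ?l y = y")
      case False
      have "D.canonical ?v y = C.opE i (D.canonical v) y"
        unfolding gv using opE_eq[OF _ False moved_iff(2)[OF yh v node moved False]] y orb_eq by simp
      then show ?thesis using eqs by (simp add: C.word_sum_snoc C.opE_def)
    next
      case True
      have zero: "D.canonical v y0 = 0" if y0: "y0 = y \<or> y0 = act_C i y" for y0
      proof (rule ccontr)
        assume g: "D.canonical v y0 \<noteq> 0"
        have i1': "i = 1"
        proof (rule ccontr)
          assume "i \<noteq> 1"
          then show False using moved_iff(1)[OF yh v node moved] True sep[OF _ yh mv] sep[OF _ v moved] by blast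
        qed
        have "?p \<noteq> North 1" "?p \<in> ?Bd" using pp i1' Bd_pq by auto
        then have "inward y ?p = inward y ?q" "inward ?v ?p = inward ?v ?q"
          using fl S' q1 glue_values unfolding flips_def by auto
        then have "(inward y0 ?p = inward y0 ?q) = (inward v ?p = inward v ?q)" using offp y0 by auto
        then have "(inward y0 ?a = inward y0 ?b) = (inward v ?a = inward v ?b)"
          using supD[OF g ab(1)] supD[OF g ab(2)] by blast
        then have "(inward y ?a = inward y ?b) = (inward v ?a = inward v ?b)"
          using y0 nodes_rel[OF yh] by auto
        then show False using moved_iff(1)[OF yh v node moved] True by (simp add: inN)
      qed
      then have "C.word_sum (w @ [i]) y = 0" using eqs by (simp add: C.word_sum_snoc C.opE_def)
      moreover have "D.canonical ?v y = 0" unfolding gv using True by (simp add: D.opE_def)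
      ultimately show ?thesis by simp
    qed
  qed
  moreover have "inward y u \<noteq> inward y (m' u)"
    if F: "C.word_sum (w @ [i]) y \<noteq> 0" and u: "u \<in> boundary (n + 1)" "u \<notin> ?Bd" for y u
  proof -
    have y: "y \<in> C.orb" "act_C i y \<noteq> y" using F by (auto simp: C.word_sum_snoc C.opE_def split: if_splits)
    have "C.word_sum w y \<noteq> 0 \<or> C.word_sum w (act_C i y) \<noteq> 0"
      using F y by (auto simp: C.word_sum_snoc C.opE_def)
    then obtain y0 where y0: "y0 = y \<or> y0 = act_C i y" "C.word_sum w y0 \<noteq> 0" by blast
    have yh: "y \<in> halves" using C.orb_Om[OF y(1)] .
    have y0h: "y0 \<in> halves" "act_C i y0 \<noteq> y0"
      using yh y0 y C.act_Om[OF yh iC] act_C_invol[of i y] by auto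
    have same_off: "inward y0 x = inward y x" if "x \<noteq> ?a" "x \<noteq> ?b" for x using off[OF that, of y] y0 by auto
    show ?thesis
    proof (cases "u \<in> {?a, ?b, ?p, ?q}")
      case False
      then have "inward y0 u \<noteq> inward y0 (m u)" using supC[OF y0(2) u(1)] u(2) Bd_other by simp
      then show ?thesis using same_off False other_m[OF u(1) False] glue_other[OF False] by simp
    next
      case True
      then have i1': "i \<noteq> 1" using u(2) Bd_ends Bd_pq by blast
      have "inward y ?a \<noteq> inward y ?b" using sep[OF i1' yh y(2)] by (simp add: inN)
      moreover have "inward y ?p \<noteq> inward y ?q" if "u = ?p \<or> u = ?q"
      proof -
        have "?a \<notin> Bd" using u(2) that Bd_pq by blast
        then have "inward y0 ?a \<noteq> inward y0 ?p" "inward y0 ?b \<noteq> inward y0 ?q"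
          using supC[OF y0(2) ab(1)] supC[OF y0(2) ab(2) bB] by auto
        moreover have "inward y0 ?a \<noteq> inward y0 ?b" using sep[OF i1' y0h] by (simp add: inN)
        ultimately have "inward y0 ?p \<noteq> inward y0 ?q" by blast
        then show ?thesis using same_off pp by simp
      qed
      ultimately show ?thesis using True glue_values by auto
    qed
  qed
  moreover have "(inward y u = inward y (m' u)) = (inward ?v u = inward ?v (m' u))"
    if G: "D.canonical ?v y \<noteq> 0" and u: "u \<in> boundary (n + 1)" for y u
  proof -
    have y: "y \<in> D.orb" "D.act ?l y \<noteq> y" using G unfolding gv by (auto simp: D.opE_def split: if_splits)
    have yh: "y \<in> halves" using D.orb_Om[OF y(1)] .
    have ay: "D.act ?l y = act_C i y" by (rule moved_iff(2)[OF yh v node moved y(2)])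
    have "D.canonical v y \<noteq> 0 \<or> D.canonical v (act_C i y) \<noteq> 0"
      using G y ay unfolding gv by (auto simp: D.opE_def)
    then obtain y0 where y0: "y0 = y \<or> y0 = act_C i y" "D.canonical v y0 \<noteq> 0" by blast
    have same_off: "inward y0 x = inward y x" if "x \<noteq> ?a" "x \<noteq> ?b" for x using off[OF that, of y] y0 by auto
    have rab: "(inward y ?a = inward y ?b) = (inward v ?a = inward v ?b)"
      using moved_iff(1)[OF yh v node moved] y(2) by (simp add: inN)
    then have rab0: "(inward y0 ?a = inward y0 ?b) = (inward v ?a = inward v ?b)"
      using y0(1) nodes_rel[OF yh] by auto
    show ?thesis
    proof (cases "u \<in> {?a, ?b, ?p, ?q}")
      case False
      then show ?thesis
        using supD[OF y0(2) u] same_off off other_m[OF u False] glue_other[OF False] by simp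
    next
      case True
      have "(inward y ?p = inward y ?q) = (inward ?v ?p = inward ?v ?q)"
        using rel_transfer[OF y0(2,1) rab0] offp by simp
      moreover have "(inward y ?a = inward y ?b) = (inward ?v ?a = inward ?v ?b)"
        using rab nodes_rel[OF v] by simp
      ultimately have "(inward y x = inward y (m' x)) = (inward ?v x = inward ?v (m' x))"
        if "x = ?a \<or> x = ?b \<or> x = ?p \<or> x = ?q" for x
        using that by (elim disjE) (simp_all only: glue_values eq_commute)
      then show ?thesis using True by blast
    qed
  qed
  moreover have "inward ?v u \<noteq> inward ?v (m' u)" if u: "u \<in> boundary (n + 1)" "u \<notin> ?Bd" for u
  proof (cases "u \<in> {?a, ?b, ?p, ?q}")
    case False
    then have "inward v u \<noteq> inward v (m u)" using undec[OF u(1)] u(2) Bd_other by simp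
    then show ?thesis using off False other_m[OF u(1) False] glue_other[OF False] by simp
  next
    case True
    then have i1': "i \<noteq> 1" using u(2) Bd_ends Bd_pq by blast
    have vh: "?v \<in> halves" "act_C i ?v \<noteq> ?v" using C.act_Om[OF v iC] moved act_C_invol[of i v] by auto
    have "inward ?v ?a \<noteq> inward ?v ?b" using sep[OF i1' vh] by (simp add: inN)
    moreover have "inward ?v ?p \<noteq> inward ?v ?q" if "u = ?p \<or> u = ?q"
    proof -
      have "?a \<notin> Bd" using u(2) that Bd_pq by blast
      then have "inward v ?p" using undec[OF ab(1)] va[OF i1'] by (simp add: inN)
      then show ?thesis using inq offp by simp
    qed
    ultimately show ?thesis using True glue_values by auto
  qed
  moreover have "\<not> ?v j > 0" if j: "2 \<le> j" "North j \<in> ?Bd" for j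
  proof (cases "North j \<in> {?a, ?b, ?p, ?q}")
    case False
    then have "North j \<in> Bd" using j Bd_other by simp
    then have "\<not> inward v (North j)" using decN j by (simp add: inN)
    then have "\<not> inward ?v (North j)" using off False by simp
    then show ?thesis by (simp add: inN)
  next
    case True
    then consider "North j = ?a \<or> North j = ?b" | "North j = ?p" | "North j = ?q" by blast
    then show ?thesis
    proof cases
      case 1
      then have "i = 1" using j(2) Bd_ends by blast
      moreover have "j = i \<or> j = i + 1" using 1 by simp
      ultimately have "i = 1" "j = 2" using j(1) by auto
      then show ?thesis using vb by (simp add: act_C_def numeral_2_eq_2)
    next
      case 2
      then have "i = 1 \<or> ?a \<in> Bd" using j(2) Bd_pq by blast
      moreover have "?p \<noteq> North 1" using 2[symmetric] j(1) by auto
      ultimately have "\<not> inward ?v (North j)" using inp offp 2 by simp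
      then show ?thesis by (simp add: inN)
    next
      case 3
      then have "\<not> inward ?v (North j)" using inq offp by simp
      then show ?thesis by (simp add: inN)
    qed
  qed
  moreover have "?v a > 0"
    if a: "North a \<in> boundary (n + 1)" "North a \<notin> ?Bd" "m' (North a) = North b" "a < b" for a b
  proof (cases "North a \<in> {?a, ?b, ?p, ?q}")
    case False
    then have "inward v (North a)" using arcN[OF a(1)] a Bd_other glue_other[OF False] by (simp add: inN)
    then have "inward ?v (North a)" using off False by simp
    then show ?thesis by (simp add: inN)
  next
    case True
    then have i1': "i \<noteq> 1" using a(2) Bd_ends Bd_pq by blast
    consider "North a = ?a" | "North a = ?b" | "North a = ?p" | "North a = ?q" using True by blast
    then show ?thesis
    proof cases
      case 1
      then have "a = i" by simp
      then show ?thesis using i1' vb by (simp add: act_C_def)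
    next
      case 2
      then have "North b = ?a" "a = i + 1" using a(3) glue_values by auto
      then show ?thesis using a(4) by simp
    next
      case 3
      then have aB: "?a \<notin> Bd" using a(2) Bd_pq by blast
      then have "inward v ?p" using undec[OF ab(1)] va[OF i1'] by (simp add: inN)
      then have "inward ?v (North a)" using offp 3 by simp
      then show ?thesis by (simp add: inN)
    next
      case 4
      \<comment> \<open>this arc would have to be traversed from right to left\<close>
      then have aB: "?a \<notin> Bd" using a(2) Bd_pq by blast
      have b: "North b = ?p" using a(3) 4 glue_values by simp
      have mb: "m (North a) = ?b" using 4 pp by simp
      have aB': "North a \<notin> Bd" using 4 pB by simp
      have "\<not> a < i + 1"
      proof
        assume "a < i + 1"
        then have "inward v (North a)" using arcN[OF a(1) aB' mb] inN by simp
        then show False using inq 4 by simp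
      qed
      moreover have "a \<noteq> i + 1" using 4 pp by auto
      ultimately have "i < b" using a(4) by simp
      then have "v i > 0" using arcN[OF ab(1) aB b[symmetric]] by simp
      then show ?thesis using va[OF i1'] by simp
    qed
  qed
  moreover have "North 1 \<in> ?Bd \<and> (\<exists>k. m' (South 1) = South k)"
  proof (cases "w = []")
    case True
    then have i1': "i = 1" by (rule first)
    have "?p = South 1" "?q = South 2" using start True i1' by simp_all
    then show ?thesis using i1' glue_values Bd_ends[of "North 1"] by auto
  next
    case False
    then obtain k where k: "North 1 \<in> Bd" "m (South 1) = South k" using start by auto
    have "South 1 \<noteq> ?p" "South 1 \<noteq> ?q" using k pp by auto
    then have "m' (South 1) = South k" using k glue_other[of "South 1"] by simp
    moreover have "North 1 \<in> ?Bd" using k(1) i1 by (auto simp: glue_beads_def)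
    ultimately show ?thesis by blast
  qed
  moreover have "word_tangle (n + 1) (w @ [i]) = tangle_of (n + 1) m' ?Bd"
    using stack_glue tan by (simp add: word_tangle_def)
  ultimately show ?thesis
    unfolding diagram_def using matching_glue S' by simp
qed

lemma ex_diagram: "C.rword w v \<Longrightarrow> \<exists>m Bd. diagram w v m Bd"
proof (induction rule: C.rword.induct)
  case rword_Nil
  show ?case using diagram_Nil by blast
next
  case (rword_snoc w v i)
  then show ?case using diagram_step[of w v _ _ i] nodes_C by blast
qed

lemma standard_iff_flips:
  assumes dia: "diagram w v m Bd" and y: "y \<in> C.orb"
  shows "standard (PairC n) (C.phi y) w \<longleftrightarrow> flips m Bd y"
proof -
  have mat: "matching (n + 1) m Bd" and tan: "word_tangle (n + 1) w = tangle_of (n + 1) m Bd"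
    and start: "if w = [] then m = swap_ends \<and> Bd = {} else North 1 \<in> Bd \<and> (\<exists>k. m (South 1) = South k)"
    using dia by (auto simp: diagram_def)
  have label: "vertex_label (C.phi y) u = Circ \<longleftrightarrow> u = South 1 \<or> u = North 1"
    "u \<noteq> South 1 \<Longrightarrow> u \<noteq> North 1 \<Longrightarrow> points_in (C.phi y) u = inward y u" if "u \<in> boundary (n + 1)" for u
  proof -
    from that consider j where "u = South j" "1 \<le> j" | j where "u = North j" "1 \<le> j"
      by (auto simp: boundary_def)
    then have "(vertex_label (C.phi y) u = Circ \<longleftrightarrow> u = South 1 \<or> u = North 1) \<and>
      (u \<noteq> South 1 \<longrightarrow> u \<noteq> North 1 \<longrightarrow> points_in (C.phi y) u = inward y u)"
    proof cases
      case (1 j)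
      then show ?thesis by (auto simp: empty_seq_def inward_def)
    next
      case (2 j)
      then show ?thesis using seq_of_phi[OF y] by (cases "j = 1") (auto simp: inward_def)
    qed
    then show "vertex_label (C.phi y) u = Circ \<longleftrightarrow> u = South 1 \<or> u = North 1"
      "u \<noteq> South 1 \<Longrightarrow> u \<noteq> North 1 \<Longrightarrow> points_in (C.phi y) u = inward y u" by blast+
  qed
  have "flip_oriented (C.phi y) {u, m u} \<longleftrightarrow> (u \<noteq> North 1 \<longrightarrow> m u \<noteq> North 1 \<longrightarrow> inward y u = inward y (m u))"
    if u: "u \<in> Bd" for u
  proof -
    have ub: "u \<in> boundary (n + 1)" "m u \<in> boundary (n + 1)" "m u \<noteq> u" "m (m u) = u" "m u \<in> Bd"
      using mat u by (auto simp: matching_def)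
    have "w \<noteq> []" using start u by auto
    then obtain k where k: "m (South 1) = South k" using start by auto
    have s1: "k \<noteq> 1" if "u = South 1" using k that ub by auto
    have circ: "\<not> inward y (South j)" for j by (simp add: inward_def)
    consider "u = South 1" | "m u = South 1" | "u \<noteq> South 1" "m u \<noteq> South 1" "u = North 1 \<or> m u = North 1"
      | "u \<noteq> South 1" "m u \<noteq> South 1" "u \<noteq> North 1" "m u \<noteq> North 1" by blast
    then show ?thesis
    proof cases
      case 1
      then have "m u = South k" using k by simp
      then show ?thesis
        using 1 ub label(1)[OF ub(1)] label(1)[OF ub(2)] by (auto simp: flip_oriented_iff circ)
    next
      case 2
      then have "u = South k" using k ub by metis
      then show ?thesis
        using 2 ub label(1)[OF ub(1)] label(1)[OF ub(2)] by (auto simp: flip_oriented_iff circ)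
    next
      case 3
      then show ?thesis using ub label(1)[OF ub(1)] label(1)[OF ub(2)] by (auto simp: flip_oriented_iff)
    next
      case 4
      then show ?thesis
        using ub label(1)[OF ub(1)] label(1)[OF ub(2)] label(2)[OF ub(1)] label(2)[OF ub(2)]
        by (simp add: flip_oriented_iff)
    qed
  qed
  then show ?thesis using tan by (simp add: tangle_of_def flips_def)
qed

text \<open>
  Weights occurring in the type \<open>D\<close> polynomial of \<open>v\<close> flip the decorated strands, as \<open>v\<close> does, so they
  all satisfy the standard condition; and where the condition holds, the path sum has the value of
  this polynomial.
\<close>

theorem standard_bases_type_C:
  assumes rw: "\<And>y. y \<in> PW (PairC n) \<Longrightarrow> reduced_word (PairC n) y (rw y)"
  shows "standard_bases (PairC n) rw"
proof (rule C.standard_bases_if_monomial[where g = D.canonical, OF kl_poly_C])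
  show "reduced_word (PairC n) y (rw y)" if "y \<in> PW (PairC n)" for y by (rule rw[OF that])
  show "D.canonical v x = 0 \<or> (\<exists>d. D.canonical v x = qpow d)" if "v \<in> C.orb" for x v
    using that orb_eq D.canonical_monomial by simp
  show "(if standard (PairC n) (C.phi x) w then C.word_sum w x else 0) = D.canonical v x"
    if w: "C.rword w v" and x: "x \<in> C.orb" for w v x
  proof -
    obtain m Bd where d: "diagram w v m Bd" using ex_diagram[OF w] by blast
    have "D.canonical v x = 0" if "\<not> flips m Bd x"
    proof (rule ccontr)
      assume "D.canonical v x \<noteq> 0"
      then have "\<forall>u\<in>boundary (n + 1). (inward x u = inward x (m u)) = (inward v u = inward v (m u))"
        and "flips m Bd v" "Bd \<subseteq> boundary (n + 1)"
        using d by (auto simp: diagram_def matching_def)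
      then have "flips m Bd x" unfolding flips_def by blast
      then show False using that by blast
    qed
    moreover have "C.word_sum w x = D.canonical v x" if "flips m Bd x" using that d x by (auto simp: diagram_def)
    ultimately show ?thesis using standard_iff_flips[OF d x] by auto
  qed
qed

end

section \<open>All pairs\<close>

theorem theoremA:
  fixes X :: hs_pair and rw :: "elt \<Rightarrow> nat list"
  assumes "hermitian X"
    and "\<And>y. y \<in> PW X \<Longrightarrow> reduced_word X y (rw y)"
  shows "\<forall>x\<in>PW X. \<forall>y\<in>PW X.
    (\<exists>B. homogeneous_basis (kl_poly X x y) (NPath X x (rw y)) (path_deg X)
           (\<lambda>T. B (path_elt X T))) \<and>
    kl_poly X x y = (\<Sum>T\<in>NPath X x (rw y). qpow (path_deg X T)) \<and>
    (\<forall>w. reduced_word X y w \<longrightarrow>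
      path_elt X ` NPath X x w = path_elt X ` NPath X x (rw y))"
proof -
  note main = minuscule.standard_bases_simply_laced[OF _ _ assms(2)]
  have "standard_bases X rw"
  proof (cases X)
    case (PairA n k)
    then have "1 \<le> k" "k \<le> n" using assms(1) by auto
    then show ?thesis by (intro main[OF minuscule_A[of k n, folded PairA]]) (simp_all add: PairA)
  next
    case (PairDA n k)
    then have "3 \<le> n" "k \<in> {1, 2}" using assms(1) by auto
    then show ?thesis by (intro main[OF minuscule_DA[of n k, folded PairDA]]) (simp_all add: PairDA)
  next
    case (PairDD n)
    then have "4 \<le> n" using assms(1) by auto
    then show ?thesis by (intro main[OF minuscule_DD[of n, folded PairDD]]) (simp_all add: PairDD)
  next
    case (PairB n)
    then have "2 \<le> n" using assms(1) by auto
    from standard_bases_type_B[OF this, of rw, folded PairB] show ?thesis using assms(2) by blast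
  next
    case (PairC n)
    then have "type_C n" using assms(1) by (auto intro: type_C.intro)
    from type_C.standard_bases_type_C[OF this, of rw, folded PairC] show ?thesis using assms(2) by blast
  next
    case (PairE6 k)
    then have "k \<in> {1, 6}" using assms(1) by simp
    then obtain ip ht \<alpha> Om and base :: "nat \<Rightarrow> real" and bound where "minuscule X ip ht \<alpha> Om base bound"
      using minuscule_E6[of k] unfolding PairE6 by blast
    then show ?thesis by (rule main) (simp add: PairE6)
  next
    case PairE7
    obtain ip ht \<alpha> Om and base :: "nat \<Rightarrow> real" and bound where "minuscule X ip ht \<alpha> Om base bound"
      using minuscule_E7 unfolding PairE7 by blast
    then show ?thesis by (rule main) (simp add: PairE7)
  qed
  then show ?thesis unfolding standard_bases_def .
qed

end
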